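(* Let $\Omega$ be a bounded domain in $\mathbb C^n$ and let $D\subset\mathbb R$ be open. Suppose that $\varphi$ is real-valued and $$\varphi\in C^\infty(\overline\Omega\times D)\cap G_t^s(\overline\Omega\times D)$$ for some $s\ge1$, and set $\varphi_t=\varphi(\cdot,t)$. Then $$K_{\varphi_t}(z,w)\in G_t^s(\Omega\times\Omega\times D).$$
   Context: $dV$ is Lebesgue measure. $\varphi\in C^\infty(\overline\Omega\times D)$ means that, for every compact interval $J\subset D$, $\varphi$ extends smoothly to a neighborhood of $\overline\Omega\times J$ (no regularity of $\partial\Omega$ is assumed). For such $\varphi$, $\varphi\in G_t^s(\overline\Omega\times D)$ means that for every compact $J\subset D$ there are constants $C_J,R_J>0$ with $\sup_{(\zeta,t)\in\overline\Omega\times J}|\partial_t^\mu\varphi(\zeta,t)|\le C_JR_J^\mu(\mu!)^s$ for all $\mu\in\mathbb N_0$. For an open set $V\subset\mathbb R^{d}$, $f\in G_t^s(V\times D)$ means that $f\in C^\infty(V\times D)$ (jointly smooth) and, for every compact $K\subset V\times D$, there exist $C_K,R_K>0$ such that $\sup_{(x,t)\in K}|\partial_t^\mu f(x,t)|\le C_KR_K^{\mu}(\mu!)^s$ for all $\mu\in\mathbb N_0$. Here $V=\Omega\times\Omega\subset\mathbb C^{2n}=\mathbb R^{4n}$ and the function is $(z,w,t)\mapsto K_{\varphi_t}(z,w)$. $A^2(\Omega,\varphi_t)$ is the Hilbert space of holomorphic $f$ on $\Omega$ with $\|f\|_{\varphi_t}^2=\int_\Omega|f|^2e^{-\varphi_t}\,dV<\infty$,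 and $K_{\varphi_t}(z,w)$ is its reproducing kernel (holomorphic in $z$, with $f(w)=\int_\Omega f\,\overline{K_{\varphi_t}(\cdot,w)}e^{-\varphi_t}dV$ for $f\in A^2(\Omega,\varphi_t)$). *)

theory Defs
  imports "HOL-Analysis.Analysis"
begin

subsection \<open>Smooth functions\<close>

text \<open>Continuously differentiable of order \<open>k\<close>: all iterated directional derivatives of order at
  most \<open>k\<close> exist and are continuous. Only meant for open \<open>S\<close>, where the derivative \<open>at x\<close>
  depends only on the values of \<open>f\<close> on \<open>S\<close>.\<close>

fun Ck_on :: "nat \<Rightarrow> 'a::euclidean_space set \<Rightarrow> ('a \<Rightarrow> 'b::real_normed_vector) \<Rightarrow> bool" where
  "Ck_on 0 S f \<longleftrightarrow> continuous_on S f"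
| "Ck_on (Suc k) S f \<longleftrightarrow>
     (\<forall>x\<in>S. f differentiable (at x)) \<and>
     (\<forall>v. Ck_on k S (\<lambda>x. frechet_derivative f (at x) v))"

definition smooth_on :: "'a::euclidean_space set \<Rightarrow> ('a \<Rightarrow> 'b::real_normed_vector) \<Rightarrow> bool" where
  "smooth_on S f \<longleftrightarrow> (\<forall>k. Ck_on k S f)"

text \<open>The class \<open>C\<^sup>\<infinity>\<close> on \<open>closure \<Omega> \<times> D\<close>. The boundary of \<open>\<Omega>\<close> is arbitrary, so smoothness means
  existence of a smooth extension, which may depend on the compact interval \<open>{a..b}\<close>.\<close>

definition smooth_on_closure_times ::
    "'a::euclidean_space set \<Rightarrow> real set \<Rightarrow> ('a \<times> real \<Rightarrow> 'b::real_normed_vector) \<Rightarrow> bool" where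
  "smooth_on_closure_times \<Omega> D f \<longleftrightarrow>
     (\<forall>a b. a \<le> b \<and> {a..b} \<subseteq> D \<longrightarrow>
        (\<exists>U F. open U \<and> closure \<Omega> \<times> {a..b} \<subseteq> U \<and> smooth_on U F \<and>
               (\<forall>p\<in>closure \<Omega> \<times> {a..b}. F p = f p)))"

subsection \<open>Gevrey regularity in the parameter\<close>

definition dt :: "nat \<Rightarrow> ('a \<times> real \<Rightarrow> 'b::real_normed_vector) \<Rightarrow> 'a \<times> real \<Rightarrow> 'b" where
  "dt \<mu> f = (\<lambda>(x, t). ((\<lambda>g \<tau>. vector_derivative g (at \<tau>)) ^^ \<mu>) (\<lambda>\<tau>. f (x, \<tau>)) t)"

definition gevrey_bound_on ::
    "real \<Rightarrow> ('a \<times> real) set \<Rightarrow> ('a \<times> real \<Rightarrow> 'b::real_normed_vector) \<Rightarrow> bool" where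
  "gevrey_bound_on s X f \<longleftrightarrow>
     (\<exists>C>0. \<exists>R>0. \<forall>\<mu>. \<forall>p\<in>X. norm (dt \<mu> f p) \<le> C * R ^ \<mu> * fact \<mu> powr s)"

text \<open>The two Gevrey classes: on \<open>closure \<Omega> \<times> D\<close> the constants are uniform in the first variable up
  to the boundary, on \<open>V \<times> D\<close> with \<open>V\<close> open they are only locally uniform.\<close>

definition gevrey_on_closure_times ::
    "real \<Rightarrow> 'a::euclidean_space set \<Rightarrow> real set \<Rightarrow> ('a \<times> real \<Rightarrow> 'b::real_normed_vector) \<Rightarrow> bool" where
  "gevrey_on_closure_times s \<Omega> D f \<longleftrightarrow>
     smooth_on_closure_times \<Omega> D f \<and>
     (\<forall>J. compact J \<and> J \<subseteq> D \<longrightarrow> gevrey_bound_on s (closure \<Omega> \<times> J) f)"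

definition gevrey_on_times ::
    "real \<Rightarrow> 'a::euclidean_space set \<Rightarrow> real set \<Rightarrow> ('a \<times> real \<Rightarrow> 'b::real_normed_vector) \<Rightarrow> bool" where
  "gevrey_on_times s V D f \<longleftrightarrow>
     smooth_on (V \<times> D) f \<and>
     (\<forall>K. compact K \<and> K \<subseteq> V \<times> D \<longrightarrow> gevrey_bound_on s K f)"

subsection \<open>Weighted Bergman spaces and kernels\<close>

text \<open>Holomorphy in several variables: real Frechet differentiable with complex linear
  derivative.\<close>

definition holomorphic_several_on :: "(complex ^ 'n) set \<Rightarrow> (complex ^ 'n \<Rightarrow> complex) \<Rightarrow> bool" where
  "holomorphic_several_on \<Omega> f \<longleftrightarrow>
     (\<forall>z\<in>\<Omega>. \<exists>f'. (f has_derivative f') (at z) \<and> (\<forall>c v. f' (c *s v) = c * f' v))"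

definition bergman_space ::
    "(complex ^ 'n) set \<Rightarrow> (complex ^ 'n \<Rightarrow> real) \<Rightarrow> (complex ^ 'n \<Rightarrow> complex) set" where
  "bergman_space \<Omega> \<psi> =
     {f. holomorphic_several_on \<Omega> f \<and>
         set_integrable lborel \<Omega> (\<lambda>z. (cmod (f z))\<^sup>2 * exp (- \<psi> z))}"

definition is_reproducing_kernel ::
    "(complex ^ 'n) set \<Rightarrow> (complex ^ 'n \<Rightarrow> real) \<Rightarrow> (complex ^ 'n \<Rightarrow> complex ^ 'n \<Rightarrow> complex) \<Rightarrow> bool" where
  "is_reproducing_kernel \<Omega> \<psi> K \<longleftrightarrow>
     (\<forall>w\<in>\<Omega>. (\<lambda>z. K z w) \<in> bergman_space \<Omega> \<psi> \<and>
       (\<forall>f\<in>bergman_space \<Omega> \<psi>.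
          f w = (LINT z:\<Omega>|lborel. f z * cnj (K z w) * complex_of_real (exp (- \<psi> z)))))"

text \<open>For open \<open>\<Omega>\<close> and continuous \<open>\<psi>\<close> such a kernel exists by the Riesz representation theorem,
  and its values on \<open>\<Omega> \<times> \<Omega>\<close> are unique; the choice affects only the irrelevant values elsewhere.\<close>

definition bergman_kernel ::
    "(complex ^ 'n) set \<Rightarrow> (complex ^ 'n \<Rightarrow> real) \<Rightarrow> complex ^ 'n \<Rightarrow> complex ^ 'n \<Rightarrow> complex" where
  "bergman_kernel \<Omega> \<psi> = (SOME K. is_reproducing_kernel \<Omega> \<psi> K)"

end

theory Submission
  imports Defs "HOL-Complex_Analysis.Complex_Analysis"
begin

text \<open>Let \<open>A2 \<Omega>\<close> be the space of square integrable holomorphic functions on \<open>\<Omega>\<close>. For \<open>t\<close> in a compact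
  subset of \<open>D\<close> the weight \<open>exp (- \<phi>\<^sub>t)\<close> is bounded above and bounded below by a positive constant, so that
  all weighted Bergman spaces coincide with \<open>A2 \<Omega>\<close> as vector spaces and have equivalent norms. Only the
  inner product \<open>\<langle>f, g\<rangle>\<^sub>W = \<integral> f (cnj g) W\<close>, taken for the weight \<open>W = exp (- \<phi>\<^sub>t)\<close>, depends on \<open>t\<close>.

  Fix \<open>w\<close>, put \<open>u\<^sub>0(t) = K\<^sub>t(\<cdot>, w)\<close> and let \<open>E\<^sub>k(t)\<close> be the \<open>k\<close>-th derivative of \<open>exp (- \<phi>\<^sub>t)\<close> in \<open>t\<close>. In the
  reproducing property \<open>\<langle>f, u\<^sub>0(t)\<rangle>\<^bsub>E\<^sub>0(t)\<^esub> = f w\<close> the right-hand side is constant in \<open>t\<close>. Differentiating it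
  \<open>\<mu>\<close> times shows what the derivatives \<open>u\<^sub>\<mu>\<close> of \<open>u\<^sub>0\<close> have to satisfy:
  \<open>(\<Sum>j\<le>\<mu>. (\<mu> choose j) \<langle>f, u\<^sub>j\<rangle>\<^bsub>E\<^sub>\<mu>\<^sub>-\<^sub>j\<^esub>) = 0\<close> for all \<open>f\<close> and all \<open>\<mu> > 0\<close>. Conversely, by the Riesz
  representation theorem this system determines \<open>u\<^sub>\<mu>\<close> from its predecessors, and the proof takes it as the
  definition of \<open>u\<^sub>\<mu>\<close> (\<open>moment_solution_exists\<close>). It yields both halves of the claim.

  \<^item> Gevrey bound. Testing the \<open>\<mu>\<close>-th equation with \<open>f = u\<^sub>\<mu>\<close> bounds the norm of \<open>u\<^sub>\<mu>\<close> by
  \<open>\<Sum>j<\<mu>. (\<mu> choose j) (sup \<bar>E\<^sub>\<mu>\<^sub>-\<^sub>j\<bar>) \<parallel>u\<^sub>j\<parallel>\<close>, up to a constant. The Gevrey bound on \<open>\<phi>\<close> passes to \<open>E\<^sub>k\<close>, and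
  then to \<open>u\<^sub>\<mu>\<close>, because \<open>(\<mu> choose j) ((\<mu> - j)! j!)\<^sup>s \<le> (\<mu>!)\<^sup>s\<close> for \<open>s \<ge> 1\<close>; both passages are instances of
  \<open>gevrey_bound_if_recursion\<close>.

  \<^item> Derivatives. Subtract the equations at \<open>t\<close> and \<open>t\<^sub>0\<close>. By Pascal's rule the terms that are linear in
  \<open>t - t\<^sub>0\<close> add up to the left-hand side of the equation for \<open>\<mu> + 1\<close>, which vanishes; the rest shows by
  induction that \<open>u\<^sub>\<mu>(t) - u\<^sub>\<mu>(t\<^sub>0) - (t - t\<^sub>0) u\<^sub>\<mu>\<^sub>+\<^sub>1(t\<^sub>0)\<close> has norm \<open>O((t - t\<^sub>0)\<^sup>2)\<close>
  (\<open>moment_solution_quadratic_remainder\<close>). Hence \<open>u\<^sub>\<mu>\<^sub>+\<^sub>1\<close> is the derivative of \<open>u\<^sub>\<mu>\<close>.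

  Point evaluations are bounded on \<open>A2 \<Omega>\<close>, uniformly on compact sets (\<open>A2_point_evaluation_bound\<close>), so
  both facts carry over from norms to the functions \<open>G\<^sub>\<mu>(z, w, t) = u\<^sub>\<mu>(z)\<close>. It remains to see that \<open>G\<^sub>0\<close> is smooth
  in all variables jointly. Each \<open>G\<^sub>\<mu>\<close> is locally bounded, holomorphic in \<open>z\<close>, and antiholomorphic in \<open>w\<close>
  since the kernel is hermitian and so are its derivatives in \<open>t\<close>. By the Cauchy estimates, taking a
  derivative along a complex line leads from such a sequence to another one. Thus all iterated partial
  derivatives exist and are locally bounded, which implies smoothness
  (\<open>smooth_on_line_holomorphic_family\<close>). The same lemma, with the parameter left out, replaces the theory
  of several complex variables: it shows that locally uniform limits of holomorphic functions are
  holomorphic, hence that \<open>A2 \<Omega>\<close> is complete.\<close>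

section \<open>Smoothness from iterated partial derivatives\<close>

lemma Ck_on_cong:
  assumes "open S"
  shows "Ck_on k S f \<Longrightarrow> (\<And>x. x \<in> S \<Longrightarrow> f x = g x) \<Longrightarrow> Ck_on k S g"
proof (induction k arbitrary: f g)
  case 0
  then show ?case by (simp cong: continuous_on_cong)
next
  case (Suc k)
  have tr: "(g has_derivative frechet_derivative f (at x)) (at x)" if "x \<in> S" for x
  proof (rule has_derivative_transform_within_open[OF _ assms that Suc.prems(2)])
    show "(f has_derivative frechet_derivative f (at x)) (at x)"
      using Suc.prems(1) that by (simp add: frechet_derivative_works[symmetric])
  qed
  have eq: "frechet_derivative f (at x) v = frechet_derivative g (at x) v" if "x \<in> S" for x v
    using frechet_derivative_at[OF tr[OF that]] by simp
  have "Ck_on k S (\<lambda>x. frechet_derivative g (at x) v)" for v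
  proof (rule Suc.IH)
    show "Ck_on k S (\<lambda>x. frechet_derivative f (at x) v)" using Suc.prems(1) by simp
  qed (rule eq)
  then show ?case using tr by (auto simp: differentiable_def)
qed

lemma Ck_on_add:
  assumes "open S"
  shows "Ck_on k S f \<Longrightarrow> Ck_on k S g \<Longrightarrow> Ck_on k S (\<lambda>x. f x + g x)"
proof (induction k arbitrary: f g)
  case 0
  then show ?case by (auto intro: continuous_intros)
next
  case (Suc k)
  have tr: "((\<lambda>x. f x + g x) has_derivative
      (\<lambda>v. frechet_derivative f (at x) v + frechet_derivative g (at x) v)) (at x)" if "x \<in> S" for x
    using Suc.prems that by (intro has_derivative_add) (auto simp: frechet_derivative_works)
  have "Ck_on k S (\<lambda>x. frechet_derivative (\<lambda>x. f x + g x) (at x) v)" for v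
  proof (rule Ck_on_cong[OF assms])
    show "Ck_on k S (\<lambda>x. frechet_derivative f (at x) v + frechet_derivative g (at x) v)"
      by (rule Suc.IH) (use Suc.prems in auto)
  qed (simp add: frechet_derivative_at[OF tr, symmetric])
  then show ?case using tr by (auto simp: differentiable_def)
qed

lemma Ck_on_scaleR:
  assumes "open S"
  shows "Ck_on k S f \<Longrightarrow> Ck_on k S (\<lambda>x. c *\<^sub>R f x)"
proof (induction k arbitrary: f)
  case 0
  then show ?case by (auto intro: continuous_intros)
next
  case (Suc k)
  have tr: "((\<lambda>x. c *\<^sub>R f x) has_derivative (\<lambda>v. c *\<^sub>R frechet_derivative f (at x) v)) (at x)"
    if "x \<in> S" for x
    using Suc.prems that by (intro has_derivative_scaleR_right) (auto simp: frechet_derivative_works)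
  have "Ck_on k S (\<lambda>x. frechet_derivative (\<lambda>x. c *\<^sub>R f x) (at x) v)" for v
  proof (rule Ck_on_cong[OF assms])
    show "Ck_on k S (\<lambda>x. c *\<^sub>R frechet_derivative f (at x) v)"
      by (rule Suc.IH) (use Suc.prems in auto)
  qed (simp add: frechet_derivative_at[OF tr, symmetric])
  then show ?case using tr by (auto simp: differentiable_def)
qed

lemma Ck_on_zero: "Ck_on k S (\<lambda>x. 0)"
  by (induction k) simp_all

lemma Ck_on_sum:
  assumes "open S" "\<And>b. b \<in> B \<Longrightarrow> Ck_on k S (f b)"
  shows "Ck_on k S (\<lambda>x. \<Sum>b\<in>B. f b x)"
  using assms(2)
proof (induction B rule: infinite_finite_induct)
  case (insert b B)
  have "Ck_on k S (\<lambda>x. f b x + (\<Sum>b\<in>B. f b x))"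
    by (rule Ck_on_add[OF assms(1)]) (use insert in blast)+
  then show ?case using insert(1,2) by (simp only: sum.insert[OF insert(1,2)])
qed (simp_all only: sum.infinite sum.empty Ck_on_zero not_False_eq_True)

lemma has_vector_derivative_along_line_shift:
  fixes f :: "'a::real_normed_vector \<Rightarrow> 'b::real_normed_vector"
  assumes "((\<lambda>\<tau>. f (p + \<tau>0 *\<^sub>R b + \<tau> *\<^sub>R b)) has_vector_derivative D) (at 0)"
  shows "((\<lambda>\<tau>. f (p + \<tau> *\<^sub>R b)) has_vector_derivative D) (at \<tau>0)"
proof -
  have "((\<lambda>\<tau>. \<tau> - \<tau>0) has_vector_derivative 1) (at \<tau>0)"
    by (auto intro!: derivative_eq_intros)
  then have "(((\<lambda>\<tau>. f (p + \<tau>0 *\<^sub>R b + \<tau> *\<^sub>R b)) \<circ> (\<lambda>\<tau>. \<tau> - \<tau>0)) has_vector_derivative 1 *\<^sub>R D) (at \<tau>0)"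
    using assms by (intro vector_diff_chain_at) auto
  moreover have "p + \<tau>0 *\<^sub>R b + (\<tau> - \<tau>0) *\<^sub>R b = p + \<tau> *\<^sub>R b" for \<tau>
    by (simp add: add.assoc scaleR_add_left[symmetric])
  ultimately show ?thesis by (simp add: o_def)
qed

text \<open>The increment of \<open>f\<close> is telescoped along the coordinate directions; each step is estimated by the mean
  value inequality for \<open>f (q + \<tau> b) - \<tau> G b\<close>. The \<open>\<ell>\<^sup>1\<close> bound on the coefficients keeps all intermediate
  points in the ball. Continuity of \<open>f\<close> follows with \<open>G = 0\<close>, Frechet differentiability with
  \<open>G b = F b x\<close>.\<close>

lemma partials_increment_bound:
  fixes f :: "'a::euclidean_space \<Rightarrow> 'b::real_normed_vector"
  assumes der: "\<And>q b. q \<in> ball x \<delta> \<Longrightarrow> b \<in> Basis \<Longrightarrow>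
      ((\<lambda>\<tau>. f (q + \<tau> *\<^sub>R b)) has_vector_derivative F b q) (at 0)"
    and bd: "\<And>q b. q \<in> ball x \<delta> \<Longrightarrow> b \<in> Basis \<Longrightarrow> norm (F b q - G b) \<le> \<epsilon> b"
    and "finite A" "A \<subseteq> Basis" "(\<Sum>b\<in>A. \<bar>c b\<bar>) < \<delta>"
  shows "norm (f (x + (\<Sum>b\<in>A. c b *\<^sub>R b)) - f x - (\<Sum>b\<in>A. c b *\<^sub>R G b)) \<le> (\<Sum>b\<in>A. \<bar>c b\<bar> * \<epsilon> b)"
  using assms(3-)
proof (induction A rule: finite_induct)
  case empty
  then show ?case by simp
next
  case (insert b A)
  define q where "q = x + (\<Sum>b\<in>A. c b *\<^sub>R b)"
  have b: "b \<in> Basis" "norm b = 1" using insert by auto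
  have nq: "norm (\<Sum>b\<in>A. c b *\<^sub>R b) \<le> (\<Sum>b\<in>A. \<bar>c b\<bar>)"
    using insert.prems by (intro sum_norm_le) auto
  have inball: "q + \<tau> *\<^sub>R b \<in> ball x \<delta>" if "\<bar>\<tau>\<bar> \<le> \<bar>c b\<bar>" for \<tau>
  proof -
    have "norm ((\<Sum>b\<in>A. c b *\<^sub>R b) + \<tau> *\<^sub>R b) \<le> (\<Sum>b\<in>A. \<bar>c b\<bar>) + \<bar>\<tau>\<bar>"
      using nq b norm_triangle_ineq[of "\<Sum>b\<in>A. c b *\<^sub>R b" "\<tau> *\<^sub>R b"] by simp
    also have "\<dots> < \<delta>" using that insert by simp
    finally have "dist (x + ((\<Sum>b\<in>A. c b *\<^sub>R b) + \<tau> *\<^sub>R b)) x < \<delta>" by (simp add: dist_norm)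
    then show ?thesis unfolding mem_ball q_def by (subst dist_commute) (simp only: add.assoc)
  qed
  have "norm ((f (q + c b *\<^sub>R b) - c b *\<^sub>R G b) - (f (q + 0 *\<^sub>R b) - 0 *\<^sub>R G b)) \<le> \<epsilon> b * norm (c b - 0)"
  proof (rule differentiable_bound[where S = "{-\<bar>c b\<bar>..\<bar>c b\<bar>}"
        and f' = "\<lambda>\<tau> h. h *\<^sub>R (F b (q + \<tau> *\<^sub>R b) - G b)"])
    fix \<tau> assume t: "\<tau> \<in> {-\<bar>c b\<bar>..\<bar>c b\<bar>}"
    then have ib: "q + \<tau> *\<^sub>R b \<in> ball x \<delta>" by (intro inball) auto
    have "((\<lambda>\<tau>. f (q + \<tau> *\<^sub>R b)) has_vector_derivative F b (q + \<tau> *\<^sub>R b)) (at \<tau>)"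
      by (rule has_vector_derivative_along_line_shift[OF der[OF ib b(1)]])
    moreover have "((\<lambda>\<tau>. \<tau> *\<^sub>R G b) has_vector_derivative G b) (at \<tau>)"
      unfolding has_vector_derivative_def by (intro derivative_eq_intros) auto
    ultimately have "((\<lambda>\<tau>. f (q + \<tau> *\<^sub>R b) - \<tau> *\<^sub>R G b) has_vector_derivative F b (q + \<tau> *\<^sub>R b) - G b) (at \<tau>)"
      by (rule has_vector_derivative_diff)
    then show "((\<lambda>\<tau>. f (q + \<tau> *\<^sub>R b) - \<tau> *\<^sub>R G b) has_derivative
        (\<lambda>h. h *\<^sub>R (F b (q + \<tau> *\<^sub>R b) - G b))) (at \<tau> within {-\<bar>c b\<bar>..\<bar>c b\<bar>})"
      unfolding has_vector_derivative_def by (rule has_derivative_at_withinI)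
    show "onorm (\<lambda>h. h *\<^sub>R (F b (q + \<tau> *\<^sub>R b) - G b)) \<le> \<epsilon> b"
      using bd[OF ib b(1)]
      by (intro onorm_bound) (auto simp: mult.commute intro: mult_left_mono mult_right_mono order_trans[OF norm_ge_zero])
  qed auto
  moreover have "norm (f q - f x - (\<Sum>b\<in>A. c b *\<^sub>R G b)) \<le> (\<Sum>b\<in>A. \<bar>c b\<bar> * \<epsilon> b)"
    unfolding q_def using insert by (intro insert.IH) auto
  ultimately have "norm ((f (q + c b *\<^sub>R b) - c b *\<^sub>R G b - f q) + (f q - f x - (\<Sum>b\<in>A. c b *\<^sub>R G b)))
      \<le> \<bar>c b\<bar> * \<epsilon> b + (\<Sum>b\<in>A. \<bar>c b\<bar> * \<epsilon> b)"
    by (intro norm_triangle_le add_mono) (auto simp: mult.commute)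
  then show ?case
    using insert by (simp add: q_def algebra_simps)
qed

lemma partials_bounded_imp_isCont:
  fixes f :: "'a::euclidean_space \<Rightarrow> 'b::real_normed_vector"
  assumes "open S" "x \<in> S"
    and der: "\<And>q b. q \<in> S \<Longrightarrow> b \<in> Basis \<Longrightarrow>
      ((\<lambda>\<tau>. f (q + \<tau> *\<^sub>R b)) has_vector_derivative F b q) (at 0)"
    and bd: "\<And>b. b \<in> Basis \<Longrightarrow> \<exists>M. \<forall>\<^sub>F q in nhds x. norm (F b q) \<le> M"
  shows "isCont f x"
proof -
  obtain M where M: "\<And>b. b \<in> Basis \<Longrightarrow> \<forall>\<^sub>F q in nhds x. norm (F b q) \<le> M b"
    using bd by metis
  have "\<forall>\<^sub>F q in nhds x. q \<in> S \<and> (\<forall>b\<in>Basis. norm (F b q) \<le> M b)"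
    using M assms by (auto simp: eventually_ball_finite eventually_conj_iff eventually_nhds_in_open)
  then obtain \<delta> where \<delta>: "\<delta> > 0" "\<And>q. dist q x < \<delta> \<Longrightarrow> q \<in> S \<and> (\<forall>b\<in>Basis. norm (F b q) \<le> M b)"
    unfolding eventually_nhds_metric by blast
  have cl: "((\<lambda>y. \<Sum>b\<in>Basis. \<bar>(y - x) \<bullet> b\<bar>) \<longlongrightarrow> (\<Sum>b\<in>Basis. \<bar>(x - x) \<bullet> b\<bar>)) (at x)"
    by (intro tendsto_intros)
  have ev: "\<forall>\<^sub>F y in at x. norm (f y - f x) \<le> (\<Sum>b\<in>Basis. \<bar>(y - x) \<bullet> b\<bar> * M b)"
  proof -
    have "\<forall>\<^sub>F y in at x. (\<Sum>b\<in>Basis. \<bar>(y - x) \<bullet> b\<bar>) < \<delta>"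
      using order_tendstoD(2)[OF cl, of \<delta>] \<delta>(1) by simp
    then show ?thesis
    proof (rule eventually_mono)
      fix y assume "(\<Sum>b\<in>Basis. \<bar>(y - x) \<bullet> b\<bar>) < \<delta>"
      then have "norm (f (x + (\<Sum>b\<in>Basis. ((y-x) \<bullet> b) *\<^sub>R b)) - f x - (\<Sum>b\<in>Basis. ((y-x) \<bullet> b) *\<^sub>R 0))
          \<le> (\<Sum>b\<in>Basis. \<bar>(y - x) \<bullet> b\<bar> * M b)"
        using \<delta>(2) by (intro partials_increment_bound[where F = F and \<delta> = \<delta>] der) (auto simp: dist_commute)
      then show "norm (f y - f x) \<le> (\<Sum>b\<in>Basis. \<bar>(y - x) \<bullet> b\<bar> * M b)"
        by (simp add: euclidean_representation)
    qed
  qed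
  have "((\<lambda>y. \<Sum>b\<in>Basis. \<bar>(y - x) \<bullet> b\<bar> * M b) \<longlongrightarrow> (\<Sum>b\<in>Basis. \<bar>(x - x) \<bullet> b\<bar> * M b)) (at x)"
    by (intro tendsto_intros)
  then have "((\<lambda>y. f y - f x) \<longlongrightarrow> 0) (at x)"
    by (intro Lim_null_comparison[OF ev]) simp
  then show ?thesis by (simp add: isCont_def LIM_zero_iff)
qed

lemma partials_continuous_imp_has_derivative:
  fixes f :: "'a::euclidean_space \<Rightarrow> 'b::real_normed_vector"
  assumes "open S" "x \<in> S"
    and der: "\<And>q b. q \<in> S \<Longrightarrow> b \<in> Basis \<Longrightarrow>
      ((\<lambda>\<tau>. f (q + \<tau> *\<^sub>R b)) has_vector_derivative F b q) (at 0)"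
    and cont: "\<And>b. b \<in> Basis \<Longrightarrow> isCont (F b) x"
  shows "(f has_derivative (\<lambda>v. \<Sum>b\<in>Basis. (v \<bullet> b) *\<^sub>R F b x)) (at x)"
  unfolding has_derivative_at_alt
proof (intro conjI allI impI)
  show "bounded_linear (\<lambda>v. \<Sum>b\<in>Basis. (v \<bullet> b) *\<^sub>R F b x)"
    by (intro bounded_linear_sum bounded_linear_scaleR_const bounded_linear_inner_left)
  fix e :: real assume "e > 0"
  define N where "N = real DIM('a)"
  have N: "N > 0" by (simp add: N_def)
  have "\<forall>\<^sub>F q in nhds x. norm (F b q - F b x) \<le> e / N" if "b \<in> Basis" for b
  proof -
    have "(F b \<longlongrightarrow> F b x) (nhds x)" using cont[OF that] by (simp add: continuous_within tendsto_at_iff_tendsto_nhds)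
    then have "\<forall>\<^sub>F q in nhds x. dist (F b q) (F b x) < e / N"
      using \<open>e > 0\<close> N by (intro tendstoD) auto
    then show ?thesis by (rule eventually_mono) (simp add: dist_norm)
  qed
  then have "\<forall>\<^sub>F q in nhds x. q \<in> S \<and> (\<forall>b\<in>Basis. norm (F b q - F b x) \<le> e / N)"
    using assms by (auto simp: eventually_ball_finite eventually_conj_iff eventually_nhds_in_open)
  then obtain \<delta> where \<delta>: "\<delta> > 0"
      "\<And>q. dist q x < \<delta> \<Longrightarrow> q \<in> S \<and> (\<forall>b\<in>Basis. norm (F b q - F b x) \<le> e / N)"
    unfolding eventually_nhds_metric by blast
  have "norm (f y - f x - (\<Sum>b\<in>Basis. ((y - x) \<bullet> b) *\<^sub>R F b x)) \<le> e * norm (y - x)"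
    if "norm (y - x) < \<delta> / N" for y
  proof -
    have le: "(\<Sum>b\<in>Basis. \<bar>(y - x) \<bullet> b\<bar>) \<le> N * norm (y - x)"
      unfolding N_def by (intro sum_bounded_above) (simp add: Basis_le_norm)
    also have "\<dots> < \<delta>" using that N by (simp add: field_simps)
    finally have "norm (f (x + (\<Sum>b\<in>Basis. ((y-x) \<bullet> b) *\<^sub>R b)) - f x - (\<Sum>b\<in>Basis. ((y-x) \<bullet> b) *\<^sub>R F b x))
          \<le> (\<Sum>b\<in>Basis. \<bar>(y - x) \<bullet> b\<bar> * (e / N))"
      using \<delta>(2) by (intro partials_increment_bound[where F = F and \<delta> = \<delta>] der) (auto simp: dist_commute)
    also have "\<dots> \<le> (N * norm (y - x)) * (e / N)"
      unfolding sum_distrib_right[symmetric] using \<open>e > 0\<close> N le by (intro mult_right_mono) auto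
    finally show ?thesis using N by (simp add: euclidean_representation mult.commute)
  qed
  then show "\<exists>d>0. \<forall>y. norm (y - x) < d \<longrightarrow>
      norm (f y - f x - (\<Sum>b\<in>Basis. ((y - x) \<bullet> b) *\<^sub>R F b x)) \<le> e * norm (y - x)"
    using \<delta>(1) N by (intro exI[of _ "\<delta> / N"]) auto
qed

text \<open>A class of locally bounded functions that is closed under partial derivatives consists of smooth
  functions: locally bounded partial derivatives make every member continuous, hence the partial
  derivatives of every member are continuous, hence every member is Frechet differentiable, and its
  directional derivatives are linear combinations of members.\<close>

lemma smooth_on_if_closed_under_partials:
  fixes f :: "'a::euclidean_space \<Rightarrow> 'b::real_normed_vector"
  assumes S: "open S"
    and bd: "\<And>f p. f \<in> \<C> \<Longrightarrow> p \<in> S \<Longrightarrow> \<exists>M. \<forall>\<^sub>F q in nhds p. norm (f q) \<le> M"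
    and part: "\<And>f b. f \<in> \<C> \<Longrightarrow> b \<in> Basis \<Longrightarrow>
      \<exists>f'\<in>\<C>. \<forall>p\<in>S. ((\<lambda>\<tau>. f (p + \<tau> *\<^sub>R b)) has_vector_derivative f' p) (at 0)"
    and "f \<in> \<C>"
  shows "smooth_on S f"
proof -
  have cont: "isCont f p" if f: "f \<in> \<C>" and p: "p \<in> S" for f p
  proof -
    obtain F where F: "\<And>b. b \<in> Basis \<Longrightarrow> F b \<in> \<C> \<and>
        (\<forall>p\<in>S. ((\<lambda>\<tau>. f (p + \<tau> *\<^sub>R b)) has_vector_derivative F b p) (at 0))"
      using part[OF f] by metis
    show ?thesis
      using F bd p by (intro partials_bounded_imp_isCont[OF S p, of f F]) auto
  qed
  have "Ck_on k S f" if "f \<in> \<C>" for k f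
    using that
  proof (induction k arbitrary: f)
    case 0
    then show ?case using cont by (auto intro: continuous_at_imp_continuous_on)
  next
    case (Suc k)
    obtain F where F: "\<And>b. b \<in> Basis \<Longrightarrow> F b \<in> \<C> \<and>
        (\<forall>p\<in>S. ((\<lambda>\<tau>. f (p + \<tau> *\<^sub>R b)) has_vector_derivative F b p) (at 0))"
      using part[OF Suc.prems] by metis
    have der: "(f has_derivative (\<lambda>v. \<Sum>b\<in>Basis. (v \<bullet> b) *\<^sub>R F b p)) (at p)" if "p \<in> S" for p
      using F cont that by (intro partials_continuous_imp_has_derivative[OF S that]) auto
    have "Ck_on k S (\<lambda>x. frechet_derivative f (at x) v)" for v
    proof (rule Ck_on_cong[OF S])
      show "Ck_on k S (\<lambda>x. \<Sum>b\<in>Basis. (v \<bullet> b) *\<^sub>R F b x)"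
        using F by (intro Ck_on_sum Ck_on_scaleR Suc.IH S) auto
    qed (simp add: frechet_derivative_at[OF der, symmetric])
    then show ?case using der by (auto simp: differentiable_def)
  qed
  then show ?thesis using assms by (auto simp: smooth_on_def)
qed

section \<open>Families that are holomorphic along complex lines\<close>

lemma holomorphic_first_order_remainder:
  assumes h: "h holomorphic_on ball 0 \<rho>" and "\<rho> > 0"
    and M: "\<And>l. l \<in> ball 0 \<rho> \<Longrightarrow> norm (h l) \<le> M"
  shows "norm (deriv h 0) \<le> 2 * M / \<rho>"
    and "norm l \<le> \<rho> / 4 \<Longrightarrow> norm (h l - h 0 - l * deriv h 0) \<le> 32 * M / \<rho>\<^sup>2 * (norm l)\<^sup>2"
proof -
  have C: "norm ((deriv ^^ n) h z) \<le> fact n * M / r ^ n" if "norm z + r < \<rho>" "r > 0" for n z r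
  proof (rule Cauchy_inequality)
    have sub: "cball z r \<subseteq> ball 0 \<rho>"
      using that by (simp add: cball_subset_ball_iff)
    then show "continuous_on (cball z r) h"
      using h holomorphic_on_imp_continuous_on holomorphic_on_subset by blast
    show "h holomorphic_on ball z r"
      using h sub holomorphic_on_subset ball_subset_cball by blast
    show "norm (h x) \<le> M" if "norm (z - x) = r" for x
      using M sub that by (auto simp: subset_iff dist_norm)
  qed fact
  show "norm (deriv h 0) \<le> 2 * M / \<rho>"
    using C[of 0 "\<rho>/2" 1] \<open>\<rho> > 0\<close> by (simp add: field_simps)
  show "norm (h l - h 0 - l * deriv h 0) \<le> 32 * M / \<rho>\<^sup>2 * (norm l)\<^sup>2" if "norm l \<le> \<rho> / 4"
  proof -
    have "norm ((deriv ^^ 0) h l - (\<Sum>i\<le>1. (deriv ^^ i) h 0 * (l - 0) ^ i / fact i))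
        \<le> (32 * M / \<rho>\<^sup>2) * norm (l - 0) ^ (Suc 1) / fact 1"
    \<comment> \<open>The second derivative is bounded on this disc by Cauchy's inequality on discs of radius \<open>\<rho> / 4\<close>.\<close>
    proof (rule complex_Taylor[where S = "cball 0 (\<rho>/4)"])
      fix i x assume "x \<in> cball (0::complex) (\<rho>/4)"
      then have x: "x \<in> ball 0 \<rho>" using \<open>\<rho> > 0\<close> by auto
      have "(deriv ^^ i) h holomorphic_on ball 0 \<rho>"
        by (intro holomorphic_higher_deriv h) auto
      then show "((deriv ^^ i) h has_field_derivative (deriv ^^ Suc i) h x) (at x within cball 0 (\<rho>/4))"
        using x holomorphic_derivI[of _ "ball 0 \<rho>" x] by (auto intro: DERIV_subset)
    next
      fix x assume "x \<in> cball (0::complex) (\<rho>/4)"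
      then have "norm ((deriv ^^ Suc 1) h x) \<le> fact (Suc 1) * M / (\<rho>/4) ^ Suc 1"
        using \<open>\<rho> > 0\<close> by (intro C) auto
      then show "norm ((deriv ^^ Suc 1) h x) \<le> 32 * M / \<rho>\<^sup>2"
        by (simp add: power2_eq_square field_simps)
    qed (use that \<open>\<rho> > 0\<close> in auto)
    then show ?thesis by (simp add: algebra_simps power2_eq_square)
  qed
qed

text \<open>The members of \<open>\<D>\<close> stand for real-linear maps from \<open>\<complex>\<close> into \<open>'a\<close>. Holomorphy of \<open>l \<mapsto> f (p + d l)\<close> covers
  holomorphic dependence (\<open>d\<close> complex linear) and antiholomorphic dependence (\<open>d\<close> conjugate linear) alike,
  without a complex structure on \<open>'a\<close>. The vector \<open>e\<close> is the direction of the real parameter; \<open>e = 0\<close> is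
  allowed, and then \<open>g (Suc \<mu>) = 0\<close> on \<open>S\<close>.\<close>

definition line_holomorphic_family ::
    "'a::euclidean_space set \<Rightarrow> (complex \<Rightarrow> 'a) set \<Rightarrow> 'a \<Rightarrow> (nat \<Rightarrow> 'a \<Rightarrow> complex) \<Rightarrow> bool" where
  "line_holomorphic_family S \<D> e g \<longleftrightarrow>
     (\<forall>\<mu>. \<forall>p\<in>S. \<exists>M. \<forall>\<^sub>F q in nhds p. norm (g \<mu> q) \<le> M) \<and>
     (\<forall>\<mu>. \<forall>d\<in>\<D>. \<forall>p\<in>S. (\<lambda>l. g \<mu> (p + d l)) field_differentiable at 0) \<and>
     (\<forall>\<mu>. \<forall>p\<in>S. ((\<lambda>\<tau>. g \<mu> (p + \<tau> *\<^sub>R e)) has_vector_derivative g (Suc \<mu>) p) (at 0))"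

lemma line_holomorphic_on_disc:
  fixes d :: "complex \<Rightarrow> 'a::real_normed_vector"
  assumes lin: "bounded_linear d"
    and diff: "\<And>p. p \<in> S \<Longrightarrow> (\<lambda>l. f (p + d l)) field_differentiable at 0"
    and sub: "\<And>l. l \<in> B \<Longrightarrow> p + d l \<in> S"
  shows "(\<lambda>l. f (p + d l)) holomorphic_on B"
proof -
  have "(\<lambda>l. f (p + d l)) field_differentiable at l0" if "l0 \<in> B" for l0
  proof -
    have "(\<lambda>l. f (p + d l0 + d l)) field_differentiable at (l0 + (-l0))"
      using diff[OF sub[OF that]] by simp
    then obtain D where "((\<lambda>l. f (p + d l0 + d l)) has_field_derivative D) (at (l0 + (-l0)))"
      by (auto simp: field_differentiable_def)
    then have "((\<lambda>l. f (p + d l0 + d (l + (-l0)))) has_field_derivative D) (at l0)"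
      by (subst (asm) DERIV_shift)
    moreover have "p + d l0 + d (l + (-l0)) = p + d l" for l
      by (simp add: bounded_linear.linear[OF lin] linear_diff)
    ultimately have "((\<lambda>l. f (p + d l)) has_field_derivative D) (at l0)"
      by (simp only:)
    then show ?thesis by (auto simp: field_differentiable_def)
  qed
  then show ?thesis
    by (auto simp: holomorphic_on_def intro: field_differentiable_at_within)
qed

lemma has_vector_derivative_if_quadratic_remainder:
  fixes f :: "real \<Rightarrow> 'b::real_normed_vector"
  assumes "\<delta> > 0" "\<And>h. \<bar>h\<bar> < \<delta> \<Longrightarrow> norm (f (t + h) - f t - h *\<^sub>R D) \<le> C * h\<^sup>2"
  shows "(f has_vector_derivative D) (at t)"
  unfolding has_vector_derivative_def has_derivative_at_alt
proof (intro conjI allI impI)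
  show "bounded_linear (\<lambda>x. x *\<^sub>R D)" by (rule bounded_linear_scaleR_left)
  fix e :: real assume "e > 0"
  have "norm (f y - f t - (y - t) *\<^sub>R D) \<le> e * norm (y - t)"
    if y: "norm (y - t) < min \<delta> (e / (\<bar>C\<bar> + 1))" for y
  proof -
    have "norm (f y - f t - (y - t) *\<^sub>R D) \<le> C * (y - t)\<^sup>2"
      using assms(2)[of "y - t"] y by simp
    also have "\<dots> \<le> (\<bar>C\<bar> + 1) * (\<bar>y - t\<bar> * \<bar>y - t\<bar>)"
      by (simp add: power2_eq_square mult_right_mono flip: abs_mult)
    also have "\<dots> = ((\<bar>C\<bar> + 1) * \<bar>y - t\<bar>) * \<bar>y - t\<bar>" by simp
    also have "\<dots> \<le> e * \<bar>y - t\<bar>"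
      using y by (intro mult_right_mono) (auto simp: field_simps)
    finally show ?thesis by simp
  qed
  then show "\<exists>d>0. \<forall>y. norm (y - t) < d \<longrightarrow> norm (f y - f t - (y - t) *\<^sub>R D) \<le> e * norm (y - t)"
    using \<open>e > 0\<close> \<open>\<delta> > 0\<close> by (intro exI[of _ "min \<delta> (e / (\<bar>C\<bar> + 1))"]) auto
qed

text \<open>First order differentiability is handled throughout in the form of a quadratic remainder, because this
  form survives evaluation functionals and Cauchy estimates without any limit being exchanged.\<close>

lemma quadratic_remainder_if_twice_differentiable:
  fixes f :: "real \<Rightarrow> 'b::real_normed_vector"
  assumes S: "convex S" "s \<in> S" "t \<in> S"
    and f: "\<And>\<tau>. \<tau> \<in> S \<Longrightarrow> (f has_vector_derivative g \<tau>) (at \<tau>)"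
    and g: "\<And>\<tau>. \<tau> \<in> S \<Longrightarrow> (g has_vector_derivative k \<tau>) (at \<tau>)"
    and M: "\<And>\<tau>. \<tau> \<in> S \<Longrightarrow> norm (k \<tau>) \<le> M"
  shows "norm (f t - f s - (t - s) *\<^sub>R g s) \<le> M * (t - s)\<^sup>2"
proof -
  have seg: "closed_segment s t \<subseteq> S" using S by (simp add: closed_segment_subset)
  have M0: "M \<ge> 0" using M[OF S(2)] norm_ge_zero order_trans by blast
  have gb: "norm (g \<tau> - g s) \<le> M * norm (\<tau> - s)" if "\<tau> \<in> S" for \<tau>
  proof (rule differentiable_bound[OF S(1) _ _ that S(2)])
    show "(g has_derivative (\<lambda>h. h *\<^sub>R k x)) (at x within S)" if "x \<in> S" for x
      using g[OF that] unfolding has_vector_derivative_def by (rule has_derivative_at_withinI)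
    show "onorm (\<lambda>h. h *\<^sub>R k x) \<le> M" if "x \<in> S" for x
      using mult_left_mono[OF M[OF that] abs_ge_zero] M0 by (intro onorm_bound) (auto simp: mult.commute[of M])
  qed
  have "norm (f t - f s - (t - s) *\<^sub>R g s) \<le> norm (t - s) * (M * norm (t - s))"
  proof (rule vector_differentiable_bound_linearization[where S = "closed_segment s t" and f' = g])
    show "(f has_vector_derivative g x) (at x within closed_segment s t)" if "x \<in> closed_segment s t" for x
      using f that seg by (auto intro: has_vector_derivative_at_within)
    show "norm (g x - g s) \<le> M * norm (t - s)" if "x \<in> closed_segment s t" for x
    proof -
      have "norm (g x - g s) \<le> M * norm (x - s)" using gb that seg by auto
      also have "\<dots> \<le> M * norm (t - s)"
        using that M0 segment_bound(1)[of x s t] by (intro mult_left_mono) (auto simp: norm_minus_commute)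
      finally show ?thesis .
    qed
  qed auto
  then show ?thesis by (simp add: power2_eq_square algebra_simps)
qed

lemma locally_bounded_on_tube:
  fixes d :: "complex \<Rightarrow> 'a::real_normed_vector"
  assumes "open S" "p \<in> S" "bounded_linear d" "\<exists>M. \<forall>\<^sub>F q in nhds p. norm (f q) \<le> M"
  obtains \<delta> \<rho> M where "\<delta> > 0" "\<rho> > 0"
    "\<And>q l. dist q p < \<delta> \<Longrightarrow> norm l < \<rho> \<Longrightarrow> q + d l \<in> S \<and> norm (f (q + d l)) \<le> M"
proof -
  obtain M where "\<forall>\<^sub>F q in nhds p. norm (f q) \<le> M" using assms by blast
  then have "\<forall>\<^sub>F q in nhds p. q \<in> S \<and> norm (f q) \<le> M"
    using assms by (simp add: eventually_conj_iff eventually_nhds_in_open)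
  then obtain \<epsilon> where \<epsilon>: "\<epsilon> > 0" "\<And>q. dist q p < \<epsilon> \<Longrightarrow> q \<in> S \<and> norm (f q) \<le> M"
    unfolding eventually_nhds_metric by blast
  obtain K where K: "K > 0" "\<And>l. norm (d l) \<le> norm l * K"
    using bounded_linear.pos_bounded[OF assms(3)] by blast
  show ?thesis
  proof (rule that[of "\<epsilon> / 2" "\<epsilon> / (2 * K)"])
    fix q and l :: complex assume "dist q p < \<epsilon> / 2" "norm l < \<epsilon> / (2 * K)"
    moreover from this have "norm (d l) < \<epsilon> / 2"
      using K(2)[of l] K(1) by (simp add: field_simps)
    ultimately have "dist (q + d l) p < \<epsilon>"
      using norm_triangle_ineq[of "q - p" "d l"] by (simp add: dist_norm algebra_simps)
    then show "q + d l \<in> S \<and> norm (f (q + d l)) \<le> M" by (rule \<epsilon>(2))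
  qed (use \<epsilon> K in auto)
qed

lemma line_derivative_bounded:
  fixes d :: "complex \<Rightarrow> 'a::euclidean_space"
  assumes "open S" "p \<in> S" "bounded_linear d" "\<exists>M. \<forall>\<^sub>F q in nhds p. norm (f q) \<le> M"
    and diff: "\<And>p. p \<in> S \<Longrightarrow> (\<lambda>l. f (p + d l)) field_differentiable at 0"
  shows "\<exists>M. \<forall>\<^sub>F q in nhds p. norm (deriv (\<lambda>l. f (q + d l)) 0) \<le> M"
proof -
  obtain \<delta> \<rho> M where tube: "\<delta> > 0" "\<rho> > 0"
    "\<And>q l. dist q p < \<delta> \<Longrightarrow> norm l < \<rho> \<Longrightarrow> q + d l \<in> S \<and> norm (f (q + d l)) \<le> M"
    using locally_bounded_on_tube[OF assms(1-4)] by blast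
  have "norm (deriv (\<lambda>l. f (q + d l)) 0) \<le> 2 * M / \<rho>" if "dist q p < \<delta>" for q
    using tube that
    by (intro holomorphic_first_order_remainder line_holomorphic_on_disc[OF assms(3) diff]) auto
  then show ?thesis
    using tube(1) unfolding eventually_nhds_metric by blast
qed

text \<open>The derivative along \<open>d\<close> is the limit of difference quotients, each of which is holomorphic along \<open>d'\<close>;
  local boundedness makes the convergence uniform.\<close>

lemma line_derivative_line_holomorphic:
  fixes d d' :: "complex \<Rightarrow> 'a::euclidean_space"
  assumes "open S" "p \<in> S" and d: "bounded_linear d" and bd: "\<exists>M. \<forall>\<^sub>F q in nhds p. norm (f q) \<le> M"
    and diff: "\<And>p. p \<in> S \<Longrightarrow> (\<lambda>l. f (p + d l)) field_differentiable at 0"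
    and d': "bounded_linear d'"
    and diff': "\<And>p. p \<in> S \<Longrightarrow> (\<lambda>l. f (p + d' l)) field_differentiable at 0"
  shows "(\<lambda>k. deriv (\<lambda>l. f (p + d' k + d l)) 0) field_differentiable at 0"
proof -
  obtain \<delta> \<rho> M where tube: "\<delta> > 0" "\<rho> > 0"
    "\<And>q l. dist q p < \<delta> \<Longrightarrow> norm l < \<rho> \<Longrightarrow> q + d l \<in> S \<and> norm (f (q + d l)) \<le> M"
    using locally_bounded_on_tube[OF assms(1-4)] by blast
  obtain K where K: "K > 0" "\<And>l. norm (d' l) \<le> norm l * K"
    using bounded_linear.pos_bounded[OF d'] by blast
  define B where "B = ball (0::complex) (\<delta> / K)"
  have inB: "dist (p + d' k) p < \<delta>" if "k \<in> B" for k
    using that K(1) K(2)[of k] by (simp add: B_def dist_norm field_simps)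
  have q0: "p + d' k \<in> S" if "k \<in> B" for k
    using tube(3)[OF inB[OF that], of 0] tube(2) by (simp add: bounded_linear.linear[OF d] linear_0)
  have M0: "M \<ge> 0"
    using tube(3)[of p 0] tube(1,2) norm_ge_zero order_trans by (metis dist_self norm_zero)
  \<comment> \<open>Increments of modulus at most \<open>\<rho> / 4\<close>, as the quadratic remainder estimate requires.\<close>
  define h where "h n = complex_of_real (\<rho> / (4 * real (Suc n)))" for n
  have h: "norm (h n) \<le> \<rho> / 4" "norm (h n) < \<rho>" "h n \<noteq> 0" for n
  proof -
    have "norm (h n) = \<rho> / (4 * real (Suc n))"
      unfolding h_def using tube(2) by (simp only: norm_of_real) simp
    moreover have "\<rho> / (4 * real (Suc n)) \<le> \<rho> / 4"
      using tube(2) by (intro divide_left_mono) auto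
    ultimately show "norm (h n) \<le> \<rho> / 4" "norm (h n) < \<rho>" using tube(2) by linarith+
    show "h n \<noteq> 0" unfolding h_def using tube(2) by (simp del: of_nat_Suc of_real_divide)
  qed
  define F where "F n k = (f (p + d (h n) + d' k) - f (p + d' k)) / h n" for n k
  have err: "norm (F n k - deriv (\<lambda>l. f (p + d' k + d l)) 0) \<le> 32 * M / \<rho>\<^sup>2 * norm (h n)" if "k \<in> B" for n k
  proof -
    have "norm (f (p + d' k + d (h n)) - f (p + d' k + d 0) - h n * deriv (\<lambda>l. f (p + d' k + d l)) 0)
        \<le> 32 * M / \<rho>\<^sup>2 * (norm (h n))\<^sup>2"
      using tube inB[OF that] h
      by (intro holomorphic_first_order_remainder line_holomorphic_on_disc[OF d diff]) auto
    moreover have "f (p + d' k + d (h n)) - f (p + d' k + d 0) = h n * F n k"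
      using h(3)[of n] bounded_linear.linear[OF d]
      by (simp add: F_def linear_0 add.assoc add.commute[of "d' k"])
    ultimately have "norm (h n * (F n k - deriv (\<lambda>l. f (p + d' k + d l)) 0)) \<le> 32 * M / \<rho>\<^sup>2 * (norm (h n))\<^sup>2"
      by (simp add: right_diff_distrib)
    then have "norm (h n) * norm (F n k - deriv (\<lambda>l. f (p + d' k + d l)) 0) \<le> norm (h n) * (32 * M / \<rho>\<^sup>2 * norm (h n))"
      by (simp only: norm_mult power2_eq_square[of "norm (h n)"] mult_ac)
    then show ?thesis using h(3)[of n] by (subst (asm) mult_le_cancel_left_pos) auto
  qed
  have "(\<lambda>k. deriv (\<lambda>l. f (p + d' k + d l)) 0) holomorphic_on B"
  proof (rule holomorphic_uniform_sequence)
    show "open B" by (simp add: B_def)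
    show "F n holomorphic_on B" for n
      unfolding F_def
    proof (intro holomorphic_intros)
      show "(\<lambda>k. f (p + d (h n) + d' k)) holomorphic_on B"
        using tube(3)[OF inB h(2)] by (intro line_holomorphic_on_disc[OF d' diff']) (auto simp: add.commute add.left_commute)
      show "(\<lambda>k. f (p + d' k)) holomorphic_on B"
        using q0 by (intro line_holomorphic_on_disc[OF d' diff']) auto
    qed (rule h)
    fix x assume "x \<in> B"
    then obtain r where r: "r > 0" "cball x r \<subseteq> B"
      using open_contains_cball unfolding B_def by (metis open_ball)
    have "uniform_limit (cball x r) F (\<lambda>k. deriv (\<lambda>l. f (p + d' k + d l)) 0) sequentially"
    proof (rule uniform_limitI)
      fix e :: real assume "e > 0"
      have "(\<lambda>n. 32 * M / \<rho>\<^sup>2 * norm (h n)) \<longlonglongrightarrow> 32 * M / \<rho>\<^sup>2 * norm (complex_of_real 0)"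
      proof (intro tendsto_intros)
        have "(\<lambda>n. \<rho> / 4 * inverse (real (Suc n))) \<longlonglongrightarrow> \<rho> / 4 * 0"
          by (intro tendsto_intros LIMSEQ_inverse_real_of_nat)
        then have "(\<lambda>n. \<rho> / (4 * real (Suc n))) \<longlonglongrightarrow> 0" by (simp add: field_simps)
        then show "h \<longlonglongrightarrow> complex_of_real 0" unfolding h_def by (intro tendsto_intros)
      qed
      then have "\<forall>\<^sub>F n in sequentially. 32 * M / \<rho>\<^sup>2 * norm (h n) < e"
        using \<open>e > 0\<close> by (intro order_tendstoD) auto
      then show "\<forall>\<^sub>F n in sequentially. \<forall>k\<in>cball x r. dist (F n k) (deriv (\<lambda>l. f (p + d' k + d l)) 0) < e"
      proof (rule eventually_mono, intro ballI)
        fix n k assume "32 * M / \<rho>\<^sup>2 * norm (h n) < e" "k \<in> cball x r"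
        then show "dist (F n k) (deriv (\<lambda>l. f (p + d' k + d l)) 0) < e"
          using err[of k n] r by (auto simp: dist_norm)
      qed
    qed
    then show "\<exists>r>0. cball x r \<subseteq> B \<and>
        uniform_limit (cball x r) F (\<lambda>k. deriv (\<lambda>l. f (p + d' k + d l)) 0) sequentially"
      using r by blast
  qed
  moreover have "0 \<in> B" "open B" using tube(1) K(1) by (auto simp: B_def)
  ultimately show ?thesis by (meson holomorphic_on_imp_differentiable_at)
qed

text \<open>The derivative along \<open>d\<close> commutes with the derivative in the parameter: the remainder of order two of
  \<open>f0\<close> in the parameter is holomorphic along \<open>d\<close>, so that Cauchy's estimate bounds its derivative along
  \<open>d\<close> by a multiple of \<open>\<tau>\<^sup>2\<close> as well.\<close>

lemma line_derivative_parameter_derivative: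
  fixes d :: "complex \<Rightarrow> 'a::euclidean_space"
  assumes "open S" "p \<in> S" and d: "bounded_linear d"
    and bd: "\<exists>M. \<forall>\<^sub>F q in nhds p. norm (f2 q) \<le> M"
    and diff0: "\<And>p. p \<in> S \<Longrightarrow> (\<lambda>l. f0 (p + d l)) field_differentiable at 0"
    and diff1: "\<And>p. p \<in> S \<Longrightarrow> (\<lambda>l. f1 (p + d l)) field_differentiable at 0"
    and der0: "\<And>p. p \<in> S \<Longrightarrow> ((\<lambda>\<tau>. f0 (p + \<tau> *\<^sub>R e)) has_vector_derivative f1 p) (at 0)"
    and der1: "\<And>p. p \<in> S \<Longrightarrow> ((\<lambda>\<tau>. f1 (p + \<tau> *\<^sub>R e)) has_vector_derivative f2 p) (at 0)"
  shows "((\<lambda>\<tau>. deriv (\<lambda>l. f0 (p + \<tau> *\<^sub>R e + d l)) 0) has_vector_derivative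
      deriv (\<lambda>l. f1 (p + d l)) 0) (at 0)"
proof -
  obtain \<delta> \<rho> M where tube: "\<delta> > 0" "\<rho> > 0"
    "\<And>q l. dist q p < \<delta> \<Longrightarrow> norm l < \<rho> \<Longrightarrow> q + d l \<in> S \<and> norm (f2 (q + d l)) \<le> M"
    using locally_bounded_on_tube[OF assms(1-4)] by blast
  define \<eta> where "\<eta> = \<delta> / (norm e + 1)"
  have \<eta>: "\<eta> > 0" unfolding \<eta>_def using tube(1) by (simp add: add_nonneg_pos)
  have near: "dist (p + \<tau> *\<^sub>R e) p < \<delta>" if "\<bar>\<tau>\<bar> < \<eta>" for \<tau>
  proof -
    have "\<bar>\<tau>\<bar> * norm e \<le> \<bar>\<tau>\<bar> * (norm e + 1)" by (simp add: mult_left_mono)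
    also have "\<dots> < \<delta>" using that by (simp add: \<eta>_def pos_less_divide_eq add_nonneg_pos)
    finally show ?thesis by (simp add: dist_norm)
  qed
  have inS: "p + \<tau> *\<^sub>R e + d l \<in> S" if "\<bar>\<tau>\<bar> < \<eta>" "norm l < \<rho>" for \<tau> :: real and l :: complex
    using tube(3)[OF near] that by blast
  show ?thesis
  proof (rule has_vector_derivative_if_quadratic_remainder[OF \<eta>, of _ 0 _ "2 * M / \<rho>"])
    fix \<tau> :: real assume \<tau>: "\<bar>\<tau>\<bar> < \<eta>"
    \<comment> \<open>The remainder at \<open>p + d l\<close>, as a function of \<open>l\<close>.\<close>
    define Q where "Q l = f0 (p + \<tau> *\<^sub>R e + d l) - f0 (p + d l) - of_real \<tau> * f1 (p + d l)" for l
    have at0: "p + d l \<in> S" if "norm l < \<rho>" for l :: complex using inS[of 0 l] \<eta> that by simp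
    have hol: "Q holomorphic_on ball 0 \<rho>"
      unfolding Q_def using \<tau>
      by (intro holomorphic_intros line_holomorphic_on_disc[OF d diff0] line_holomorphic_on_disc[OF d diff1])
         (auto intro: inS at0)
    have Qle: "norm (Q l) \<le> M * \<tau>\<^sup>2" if l: "l \<in> ball 0 \<rho>" for l
    proof -
      define q where "q = p + d l"
      have q: "q + \<sigma> *\<^sub>R e \<in> S" "norm (f2 (q + \<sigma> *\<^sub>R e)) \<le> M" if "\<sigma> \<in> {-\<eta><..<\<eta>}" for \<sigma>
        using tube(3)[OF near, of \<sigma> l] that l by (auto simp: q_def add.commute add.left_commute)
      have "norm (f0 (q + \<tau> *\<^sub>R e) - f0 (q + 0 *\<^sub>R e) - (\<tau> - 0) *\<^sub>R f1 (q + 0 *\<^sub>R e)) \<le> M * (\<tau> - 0)\<^sup>2"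
      proof (rule quadratic_remainder_if_twice_differentiable[where S = "{-\<eta><..<\<eta>}"
            and k = "\<lambda>\<sigma>. f2 (q + \<sigma> *\<^sub>R e)"])
        fix \<sigma> assume "\<sigma> \<in> {-\<eta><..<\<eta>}"
        then show "((\<lambda>\<sigma>. f0 (q + \<sigma> *\<^sub>R e)) has_vector_derivative f1 (q + \<sigma> *\<^sub>R e)) (at \<sigma>)"
          and "((\<lambda>\<sigma>. f1 (q + \<sigma> *\<^sub>R e)) has_vector_derivative f2 (q + \<sigma> *\<^sub>R e)) (at \<sigma>)"
          and "norm (f2 (q + \<sigma> *\<^sub>R e)) \<le> M"
          using has_vector_derivative_along_line_shift[OF der0[OF q(1)]]
            has_vector_derivative_along_line_shift[OF der1[OF q(1)]] q(2) by blast+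
      qed (use \<eta> \<tau> in auto)
      then show ?thesis
        by (simp add: Q_def q_def scaleR_conv_of_real add.commute add.left_commute)
    qed
    have "norm (deriv Q 0) \<le> 2 * (M * \<tau>\<^sup>2) / \<rho>"
      by (rule holomorphic_first_order_remainder(1)[OF hol tube(2) Qle])
    moreover have "deriv Q 0 = deriv (\<lambda>l. f0 (p + \<tau> *\<^sub>R e + d l)) 0 - deriv (\<lambda>l. f0 (p + d l)) 0
        - of_real \<tau> * deriv (\<lambda>l. f1 (p + d l)) 0"
    proof -
      have 1: "p + \<tau> *\<^sub>R e \<in> S" using inS[OF \<tau>, of 0] tube(2) by (simp add: bounded_linear.linear[OF d] linear_0)
      note D = DERIV_deriv_iff_field_differentiable[THEN iffD2]
      show ?thesis
        unfolding Q_def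
        by (rule DERIV_imp_deriv, intro DERIV_diff DERIV_cmult D diff0 diff1 1 assms(2))
    qed
    ultimately show "norm (deriv (\<lambda>l. f0 (p + (0 + \<tau>) *\<^sub>R e + d l)) 0 - deriv (\<lambda>l. f0 (p + 0 *\<^sub>R e + d l)) 0
        - \<tau> *\<^sub>R deriv (\<lambda>l. f1 (p + d l)) 0) \<le> 2 * M / \<rho> * \<tau>\<^sup>2"
      by (simp add: scaleR_conv_of_real)
  qed
qed

text \<open>The step that makes the coinduction in \<open>smooth_on_if_closed_under_partials\<close> work: the derivative along a
  line of the whole sequence is again such a sequence.\<close>

lemma line_holomorphic_family_line_derivative:
  assumes S: "open S" and lin: "\<And>d. d \<in> \<D> \<Longrightarrow> bounded_linear d"
    and g: "line_holomorphic_family S \<D> e g" and d: "d \<in> \<D>"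
  shows "line_holomorphic_family S \<D> e (\<lambda>\<mu> p. deriv (\<lambda>l. g \<mu> (p + d l)) 0)"
proof -
  have bd: "\<exists>M. \<forall>\<^sub>F q in nhds p. norm (g \<mu> q) \<le> M" if "p \<in> S" for \<mu> p
    using g that by (auto simp: line_holomorphic_family_def)
  have diff: "(\<lambda>l. g \<mu> (p + d l)) field_differentiable at 0" if "d \<in> \<D>" "p \<in> S" for \<mu> d p
    using g that by (auto simp: line_holomorphic_family_def)
  have der: "((\<lambda>\<tau>. g \<mu> (p + \<tau> *\<^sub>R e)) has_vector_derivative g (Suc \<mu>) p) (at 0)" if "p \<in> S" for \<mu> p
    using g that by (auto simp: line_holomorphic_family_def)
  show ?thesis
    unfolding line_holomorphic_family_def
    using line_derivative_bounded[OF S _ lin[OF d] bd diff[OF d]]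
      line_derivative_line_holomorphic[OF S _ lin[OF d] bd diff[OF d] lin diff]
      line_derivative_parameter_derivative[OF S _ lin[OF d] bd diff[OF d] diff[OF d] der der]
    by blast
qed

lemma smooth_on_line_holomorphic_family:
  assumes S: "open S" and lin: "\<And>d. d \<in> \<D> \<Longrightarrow> bounded_linear d"
    and g: "line_holomorphic_family S \<D> e g"
    and span: "Basis \<subseteq> insert e ((\<lambda>d. d 1) ` \<D>)"
  shows "smooth_on S (g \<mu>)"
proof (rule smooth_on_if_closed_under_partials[OF S])
  show "g \<mu> \<in> {g \<mu> |g \<mu>. line_holomorphic_family S \<D> e g}" using g by blast
  show "\<exists>M. \<forall>\<^sub>F q in nhds p. norm (f q) \<le> M"
    if "f \<in> {g \<mu> |g \<mu>. line_holomorphic_family S \<D> e g}" "p \<in> S" for f p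
    using that by (auto simp: line_holomorphic_family_def)
  fix f and b :: 'a assume "f \<in> {g \<mu> |g \<mu>. line_holomorphic_family S \<D> e g}" and b: "b \<in> Basis"
  then obtain g \<mu> where fg: "f = g \<mu>" and g: "line_holomorphic_family S \<D> e g" by blast
  consider "b = e" | d where "d \<in> \<D>" "b = d 1" using span b by auto
  then show "\<exists>f'\<in>{g \<mu> |g \<mu>. line_holomorphic_family S \<D> e g}.
      \<forall>p\<in>S. ((\<lambda>\<tau>. f (p + \<tau> *\<^sub>R b)) has_vector_derivative f' p) (at 0)"
  proof cases
    case 1
    then show ?thesis using g fg by (intro bexI[of _ "g (Suc \<mu>)"]) (auto simp: line_holomorphic_family_def)
  next
    case (2 d)
    have "((\<lambda>\<tau>. f (p + \<tau> *\<^sub>R b)) has_vector_derivative deriv (\<lambda>l. g \<mu> (p + d l)) 0) (at 0)"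
      if p: "p \<in> S" for p
    proof -
      have "((\<lambda>l. g \<mu> (p + d l)) has_field_derivative deriv (\<lambda>l. g \<mu> (p + d l)) 0) (at (of_real 0))"
        using g p 2 by (simp add: line_holomorphic_family_def DERIV_deriv_iff_field_differentiable)
      then have "((\<lambda>\<tau>. g \<mu> (p + d (of_real \<tau>))) has_vector_derivative deriv (\<lambda>l. g \<mu> (p + d l)) 0) (at 0)"
        by (rule has_vector_derivative_real_field)
      moreover have "d (of_real \<tau>) = \<tau> *\<^sub>R b" for \<tau>
        using bounded_linear.linear[OF lin[OF 2(1)]] 2(2) by (simp add: of_real_def linear_cmul)
      ultimately show ?thesis by (simp add: fg)
    qed
    then show ?thesis
      using line_holomorphic_family_line_derivative[OF S lin g 2(1)]
      by (intro bexI[of _ "\<lambda>p. deriv (\<lambda>l. g \<mu> (p + d l)) 0"]) auto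
  qed
qed

section \<open>The mean value inequality in several variables\<close>

lemma nn_integral_lborel_translate:
  fixes c :: "'a::euclidean_space"
  assumes "f \<in> borel_measurable borel"
  shows "(\<integral>\<^sup>+x. f (c + x) \<partial>lborel) = (\<integral>\<^sup>+x. f x \<partial>lborel)"
proof -
  have "(\<integral>\<^sup>+x. f x \<partial>lborel) = (\<integral>\<^sup>+x. f x \<partial>distr lborel borel ((+) c))"
    by (simp only: lborel_distr_plus)
  also have "\<dots> = (\<integral>\<^sup>+x. f (c + x) \<partial>lborel)"
    using assms by (subst nn_integral_distr) auto
  finally show ?thesis ..
qed

lemma emeasure_lborel_ball_translate:
  fixes c :: "'a::euclidean_space"
  shows "emeasure lborel (ball c r) = emeasure lborel (ball (0::'a) r)"
proof -
  have "(\<integral>\<^sup>+x. indicator (ball c r) (c + x) \<partial>lborel) = (\<integral>\<^sup>+x. indicator (ball c r) x \<partial>lborel)"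
    by (intro nn_integral_lborel_translate borel_measurable_indicator) auto
  moreover have "indicator (ball c r) (c + x) = (indicator (ball 0 r) x :: ennreal)" for x
    by (auto simp: indicator_def dist_norm)
  ultimately show ?thesis by simp
qed

text \<open>Rotation invariance follows from translation invariance alone: with \<open>B\<close> the unit ball, Fubini's theorem
  applied to \<open>\<integral>\<integral> 1\<^sub>A(x + L y) 1\<^sub>B(x) dy dx\<close> in the two orders gives \<open>vol (L\<^sup>-\<^sup>1 A) vol B\<close> and
  \<open>vol A vol B\<close>.\<close>

lemma lborel_distr_orthogonal_transformation:
  fixes L :: "'a::euclidean_space \<Rightarrow> 'a"
  assumes L: "orthogonal_transformation L"
  shows "distr lborel borel L = lborel"
proof (rule measure_eqI)
  have lin: "linear L" using L by (rule orthogonal_transformation_linear)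
  have [measurable]: "L \<in> borel_measurable borel"
    using lin by (intro borel_measurable_continuous_onI linear_continuous_on linear_conv_bounded_linear[THEN iffD1])
  show "sets (distr lborel borel L) = sets lborel" by simp
  fix A assume "A \<in> sets (distr lborel borel L)"
  then have A[measurable]: "A \<in> sets borel" by simp
  define B where "B = ball (0::'a) 1"
  have B[measurable]: "B \<in> sets borel" by (simp add: B_def)
  define J where "J = (\<integral>\<^sup>+x. \<integral>\<^sup>+y. indicator A (x + L y) * indicator B x \<partial>lborel \<partial>(lborel :: 'a measure))"
  have "J = (\<integral>\<^sup>+x. emeasure (distr lborel borel L) A * indicator B x \<partial>lborel)"
    unfolding J_def
  proof (intro nn_integral_cong)
    fix x
    obtain x' where x': "x = L x'"
      using orthogonal_transformation_surj[OF L] by (metis surjD)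
    have "(\<integral>\<^sup>+y. indicator A (x + L y) * indicator B x \<partial>lborel)
        = (\<integral>\<^sup>+y. indicator A (L (x' + y)) \<partial>lborel) * indicator B x"
      by (subst nn_integral_multc) (simp_all add: x' linear_add[OF lin])
    also have "(\<integral>\<^sup>+y. indicator A (L (x' + y)) \<partial>lborel) = (\<integral>\<^sup>+y. indicator A (L y) \<partial>lborel)"
      by (rule nn_integral_lborel_translate) measurable
    also have "\<dots> = emeasure (distr lborel borel L) A"
      by (subst nn_integral_indicator[symmetric], simp, subst nn_integral_distr) auto
    finally show "(\<integral>\<^sup>+y. indicator A (x + L y) * indicator B x \<partial>lborel)
        = emeasure (distr lborel borel L) A * indicator B x" .
  qed
  then have J1: "J = emeasure (distr lborel borel L) A * emeasure lborel B"
    by (simp add: nn_integral_cmult)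
  have "J = (\<integral>\<^sup>+y. \<integral>\<^sup>+x. indicator A (x + L y) * indicator B x \<partial>lborel \<partial>lborel)"
    unfolding J_def by (rule lborel_pair.Fubini') measurable
  also have "\<dots> = (\<integral>\<^sup>+y. \<integral>\<^sup>+x. indicator A x * indicator B (x - L y) \<partial>lborel \<partial>lborel)"
  proof (rule nn_integral_cong)
    fix y
    have "(\<integral>\<^sup>+x. indicator A x * indicator B (x - L y) \<partial>lborel)
        = (\<integral>\<^sup>+x. indicator A (L y + x) * indicator B (L y + x - L y) \<partial>lborel)"
      by (rule nn_integral_lborel_translate[symmetric]) measurable
    then show "(\<integral>\<^sup>+x. indicator A (x + L y) * indicator B x \<partial>lborel)
        = (\<integral>\<^sup>+x. indicator A x * indicator B (x - L y) \<partial>lborel)"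
      by (simp add: add.commute)
  qed
  also have "\<dots> = (\<integral>\<^sup>+x. \<integral>\<^sup>+y. indicator A x * indicator B (x - L y) \<partial>lborel \<partial>lborel)"
    by (rule lborel_pair.Fubini') measurable
  also have "\<dots> = (\<integral>\<^sup>+x. indicator A x * emeasure lborel B \<partial>lborel)"
  proof (rule nn_integral_cong)
    fix x
    obtain x' where x': "x = L x'"
      using orthogonal_transformation_surj[OF L] by (metis surjD)
    have "indicator B (x - L y) = (indicator (ball x' 1) y :: ennreal)" for y
    proof -
      have "norm (L x' - L y) = norm (x' - y)"
        by (simp add: orthogonal_transformation_norm[OF L] flip: linear_diff[OF lin])
      then have "x - L y \<in> B \<longleftrightarrow> y \<in> ball x' 1"
        by (simp only: B_def dist_0_norm mem_ball x' dist_norm[of x' y])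
      then show ?thesis by (simp add: indicator_def)
    qed
    then show "(\<integral>\<^sup>+y. indicator A x * indicator B (x - L y) \<partial>lborel) = indicator A x * emeasure lborel B"
      by (subst emeasure_lborel_ball_translate[of x' 1, folded B_def, symmetric], subst nn_integral_cmult_indicator[symmetric]) simp_all
  qed
  also have "\<dots> = emeasure lborel A * emeasure lborel B"
    by (simp add: nn_integral_multc)
  finally have "emeasure (distr lborel borel L) A * emeasure lborel B = emeasure lborel A * emeasure lborel B"
    using J1 by simp
  moreover have "emeasure lborel B \<noteq> 0" "emeasure lborel B \<noteq> \<infinity>"
    using emeasure_lborel_ball_finite[of "0::'a" 1] unit_ball_vol_pos[of "real DIM('a)", THEN less_imp_neq]
    by (auto simp: B_def emeasure_ball)
  ultimately show "emeasure (distr lborel borel L) A = emeasure lborel A"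
    by (metis ennreal_mult_cancel_left mult.commute infinity_ennreal_def)
qed

lemma norm_vector_smult: "norm (c *s (v :: complex ^ 'n)) = norm c * norm v"
proof -
  have "(\<Sum>i\<in>UNIV. (norm (c * v $ i))\<^sup>2) = (norm c)\<^sup>2 * (\<Sum>i\<in>UNIV. (norm (v $ i))\<^sup>2)"
    by (simp add: norm_mult power_mult_distrib sum_distrib_left)
  then show ?thesis
    by (simp add: norm_vec_def L2_set_def real_sqrt_mult)
qed

lemma bounded_linear_smult_left: "bounded_linear (\<lambda>l. l *s (a :: complex ^ 'n))"
  by (rule bounded_linear_intro[where K = "norm a"])
     (simp_all add: norm_vector_smult vec_eq_iff algebra_simps)

lemma orthogonal_transformation_smult:
  assumes "norm c = 1"
  shows "orthogonal_transformation (\<lambda>v :: complex ^ 'n. c *s v)"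
  unfolding orthogonal_transformation
proof (intro conjI allI)
  show "linear ((*s) c :: complex ^ 'n \<Rightarrow> _)"
    by (rule linearI) (simp_all add: vec_eq_iff algebra_simps)
qed (simp add: norm_vector_smult assms)

lemma holomorphic_several_continuous:
  "holomorphic_several_on \<Omega> f \<Longrightarrow> continuous_on \<Omega> f"
  by (meson continuous_at_imp_continuous_on has_derivative_continuous holomorphic_several_on_def)

lemma holomorphic_several_line:
  assumes "holomorphic_several_on \<Omega> f" "p \<in> \<Omega>"
  shows "(\<lambda>l. f (p + l *s a)) field_differentiable at 0"
proof -
  obtain f' where f': "(f has_derivative f') (at p)" "\<And>c v. f' (c *s v) = c * f' v"
    using assms by (auto simp: holomorphic_several_on_def)
  have "((\<lambda>l. p + l *s a) has_derivative (\<lambda>l. l *s a)) (at 0)"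
    by (auto intro!: derivative_eq_intros bounded_linear_imp_has_derivative bounded_linear_smult_left)
  moreover have "(f has_derivative f') (at (p + 0 *s a))" using f' by simp
  ultimately have "(f \<circ> (\<lambda>l. p + l *s a) has_derivative f' \<circ> (\<lambda>l. l *s a)) (at 0)"
    by (rule diff_chain_at)
  then have "((\<lambda>l. f (p + l *s a)) has_derivative (*) (f' a)) (at 0)"
    by (simp add: o_def f' mult_commute_abs)
  then show ?thesis
    unfolding field_differentiable_def has_field_derivative_def by blast
qed

text \<open>Cauchy's integral formula at the centre of the unit disc.\<close>

lemma holomorphic_mean_value_ineq:
  assumes "h holomorphic_on cball 0 1"
  shows "ennreal (norm (h 0)) \<le> (\<integral>\<^sup>+x. indicator {0..1} x * ennreal (norm (h (exp (2 * of_real pi * \<i> * of_real x)))) \<partial>lborel)"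
proof -
  define \<gamma> where "\<gamma> x = exp (2 * of_real pi * \<i> * of_real x)" for x :: real
  have "((\<lambda>u. h u / (u - 0)) has_contour_integral (2 * of_real pi * \<i> * h 0)) (circlepath 0 1)"
    by (rule Cauchy_integral_circlepath_simple[OF assms]) simp
  then have "((\<lambda>x. 2 * of_real pi * \<i> * h (\<gamma> x)) has_integral (2 * of_real pi * \<i> * h 0)) {0..1}"
    unfolding has_contour_integral_def
  proof (rule has_integral_eq[rotated])
    fix x :: real assume x: "x \<in> {0..1}"
    have "circlepath 0 1 x = \<gamma> x" by (simp add: circlepath \<gamma>_def)
    moreover have "vector_derivative (circlepath 0 1) (at x within {0..1}) = 2 * of_real pi * \<i> * \<gamma> x"
      using vector_derivative_circlepath01[of x 0 1] x by (simp add: \<gamma>_def)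
    moreover have "\<gamma> x \<noteq> 0" by (simp add: \<gamma>_def)
    ultimately show "h (circlepath 0 1 x) / (circlepath 0 1 x - 0) * vector_derivative (circlepath 0 1) (at x within {0..1})
        = 2 * of_real pi * \<i> * h (\<gamma> x)" by (simp add: field_simps)
  qed
  from has_integral_mult_right[OF this, of "inverse (2 * of_real pi * \<i>)"]
  have int: "((\<lambda>x. h (\<gamma> x)) has_integral h 0) {0..1}"
    by (simp add: field_simps)
  have "continuous_on {0..1} (\<lambda>x. h (\<gamma> x))"
    unfolding \<gamma>_def
    by (rule continuous_on_compose2[OF holomorphic_on_imp_continuous_on[OF assms]])
       (auto intro!: continuous_intros)
  then have si: "set_integrable lborel {0..1} (\<lambda>x. h (\<gamma> x))"
    by (rule borel_integrable_atLeastAtMost')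
  have "h 0 = (LINT x:{0..1}|lborel. h (\<gamma> x))"
    using int set_borel_integral_eq_integral(2)[OF si] by (simp add: integral_unique)
  then have "ennreal (norm (h 0)) \<le> (\<integral>\<^sup>+x. norm (indicator {0..1} x *\<^sub>R h (\<gamma> x)) \<partial>lborel)"
    using integral_norm_bound_ennreal[OF si[unfolded set_integrable_def]]
    by (simp add: set_lebesgue_integral_def)
  also have "\<dots> = (\<integral>\<^sup>+x. indicator {0..1} x * ennreal (norm (h (\<gamma> x))) \<partial>lborel)"
    by (intro nn_integral_cong) (simp add: indicator_def)
  finally show ?thesis unfolding \<gamma>_def .
qed

text \<open>For \<open>v\<close> in the ball, the mean value inequality for \<open>l \<mapsto> f (z + l v)\<^sup>2\<close> on the unit disc bounds
  \<open>\<bar>f z\<bar>\<^sup>2\<close> by the average over the rotations \<open>v \<mapsto> e\<^bsup>i\<theta>\<^esup> v\<close>. Integrating over \<open>v\<close>, the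
  rotations disappear because they preserve volume.\<close>

lemma holomorphic_several_sub_mean_value:
  fixes f :: "complex ^ 'n \<Rightarrow> complex"
  assumes f: "holomorphic_several_on \<Omega> f" and sub: "ball z r \<subseteq> \<Omega>" and "r > 0"
  shows "ennreal ((norm (f z))\<^sup>2) * emeasure lborel (ball z r)
     \<le> (\<integral>\<^sup>+\<zeta>. indicator (ball z r) \<zeta> * ennreal ((norm (f \<zeta>))\<^sup>2) \<partial>lborel)"
proof -
  define F :: "complex ^ 'n \<Rightarrow> ennreal" where "F \<zeta> = ennreal (indicator (ball z r) \<zeta> *\<^sub>R (norm (f \<zeta>))\<^sup>2)" for \<zeta>
  have F': "F \<zeta> = indicator (ball z r) \<zeta> * ennreal ((norm (f \<zeta>))\<^sup>2)" for \<zeta>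
    by (simp add: F_def indicator_def)
  have "continuous_on (ball z r) (\<lambda>\<zeta>. (norm (f \<zeta>))\<^sup>2)"
    using continuous_on_subset[OF holomorphic_several_continuous[OF f] sub] by (intro continuous_intros)
  then have [measurable]: "F \<in> borel_measurable borel"
    unfolding F_def by (intro measurable_compose[OF borel_measurable_continuous_on_indicator measurable_ennreal]) auto
  define e where "e x = exp (2 * of_real pi * \<i> * of_real x)" for x :: real
  have e: "norm (e x) = 1" for x by (simp add: e_def)
  have [measurable]: "(\<lambda>(v, x). F (z + e x *s v)) \<in> borel_measurable (lborel \<Otimes>\<^sub>M lborel)"
  proof -
    have "(\<lambda>p::(complex^'n) \<times> real. \<chi> i. e (snd p) * fst p $ i) \<in> borel_measurable borel"
      unfolding e_def by (intro borel_measurable_continuous_onI continuous_intros)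
    then have "(\<lambda>p::(complex^'n) \<times> real. z + e (snd p) *s fst p) \<in> borel_measurable borel"
      by (simp add: vector_scalar_mult_def)
    then have "(\<lambda>p::(complex^'n) \<times> real. F (z + e (snd p) *s fst p)) \<in> borel_measurable borel"
      by measurable
    then show ?thesis by (simp add: split_beta' lborel_prod)
  qed
  have key: "F z \<le> (\<integral>\<^sup>+x. indicator {0..1} x * F (z + e x *s v) \<partial>lborel)" if v: "v \<in> ball 0 r" for v
  proof -
    define h where "h l = (f (z + l *s v))\<^sup>2" for l
    have inb: "z + l *s v \<in> ball z r" if "norm l \<le> 1" for l
      using v mult_left_le_one_le[OF norm_ge_zero norm_ge_zero that] mult_right_mono[OF that, of "norm v"]
      by (simp add: dist_norm norm_vector_smult)
    have "h holomorphic_on cball 0 1"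
      unfolding h_def using inb sub
      by (intro holomorphic_intros line_holomorphic_on_disc[OF bounded_linear_smult_left holomorphic_several_line[OF f]]) auto
    from holomorphic_mean_value_ineq[OF this]
    have "ennreal (norm (h 0)) \<le> (\<integral>\<^sup>+x. indicator {0..1} x * ennreal (norm (h (e x))) \<partial>lborel)"
      unfolding e_def .
    also have "\<dots> = (\<integral>\<^sup>+x. indicator {0..1} x * F (z + e x *s v) \<partial>lborel)"
      using inb[of "e _"] e by (intro nn_integral_cong) (simp add: F' h_def norm_power)
    also have "ennreal (norm (h 0)) = F z"
      using \<open>r > 0\<close> by (simp add: F' h_def norm_power)
    finally show ?thesis .
  qed
  have "F z * emeasure lborel (ball z r) = (\<integral>\<^sup>+v. F z * indicator (ball (0 :: complex ^ 'n) r) v \<partial>lborel)"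
    by (subst nn_integral_cmult_indicator) (simp_all add: emeasure_lborel_ball_translate[of z])
  also have "\<dots> \<le> (\<integral>\<^sup>+v. \<integral>\<^sup>+x. indicator {0..1} x * F (z + e x *s v) \<partial>lborel \<partial>lborel)"
    using key by (intro nn_integral_mono) (auto simp: indicator_def)
  also have "\<dots> = (\<integral>\<^sup>+x. \<integral>\<^sup>+v. indicator {0..1} x * F (z + e x *s v) \<partial>lborel \<partial>lborel)"
    by (rule lborel_pair.Fubini') measurable
  also have "\<dots> = (\<integral>\<^sup>+x. indicator {0..1} x * (\<integral>\<^sup>+v. F v \<partial>lborel) \<partial>(lborel :: real measure))"
  proof (rule nn_integral_cong)
    fix x :: real
    have [measurable]: "(\<lambda>v :: complex ^ 'n. e x *s v) \<in> borel_measurable borel"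
      by (intro borel_measurable_continuous_onI linear_continuous_on linear_conv_bounded_linear[THEN iffD1]
          orthogonal_transformation_linear orthogonal_transformation_smult e)
    have "(\<integral>\<^sup>+v. F (z + e x *s v) \<partial>lborel) = (\<integral>\<^sup>+v. F (z + v) \<partial>distr lborel borel (\<lambda>v. e x *s v))"
      by (subst nn_integral_distr) auto
    also have "\<dots> = (\<integral>\<^sup>+v. F (z + v) \<partial>lborel)"
      by (simp add: lborel_distr_orthogonal_transformation[OF orthogonal_transformation_smult[OF e]])
    also have "\<dots> = (\<integral>\<^sup>+v. F v \<partial>lborel)"
      by (rule nn_integral_lborel_translate) measurable
    finally show "(\<integral>\<^sup>+v. indicator {0..1} x * F (z + e x *s v) \<partial>lborel) = indicator {0..1} x * (\<integral>\<^sup>+v. F v \<partial>lborel)"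
      by (simp add: nn_integral_cmult)
  qed
  also have "\<dots> = (\<integral>\<^sup>+v. F v \<partial>lborel)"
    by (simp add: nn_integral_multc)
  finally show ?thesis
    using \<open>r > 0\<close> by (simp add: F')
qed

section \<open>The Riesz representation theorem\<close>

lemma discriminant_le_if_quadratic_nonneg:
  fixes a b d :: real
  assumes "d \<ge> 0" and nn: "\<And>c. a + 2 * c * b + c\<^sup>2 * d \<ge> 0"
  shows "b\<^sup>2 \<le> a * d"
proof (cases "d = 0")
  case True
  have "b = 0"
  proof (rule ccontr)
    assume "b \<noteq> 0"
    then show False using nn[of "- (a + 1) / (2 * b)"] True by (simp add: field_simps)
  qed
  then show ?thesis using True by simp
next
  case False
  then have "d > 0" using assms by simp
  define c where "c = - b / d"
  have cd: "c * d = - b" using \<open>d > 0\<close> by (simp add: c_def)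
  have "0 \<le> d * (a + 2 * c * b + c\<^sup>2 * d)"
    using nn[of c] \<open>d > 0\<close> by (intro mult_nonneg_nonneg) auto
  also have "\<dots> = a * d + 2 * (c * d) * b + (c * d) * (c * d)"
    by (simp add: algebra_simps power2_eq_square)
  also have "\<dots> = a * d - b\<^sup>2"
    unfolding cd by (simp add: power2_eq_square)
  finally show ?thesis by simp
qed

text \<open>The theorem for a space of functions given by a carrier \<open>V\<close>. The representing vector minimises
  \<open>J f = \<parallel>f\<parallel>\<^sup>2 - 2 Re (l f)\<close>: by the parallelogram law minimising sequences are Cauchy, and the variations
  of \<open>J\<close> at the limit vanish. They are computed along the sequence, where \<open>J\<close> is within \<open>1 / (n + 1)\<close> of
  its infimum; the bound on \<open>l\<close> makes this infimum finite.\<close>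

lemma riesz_representation:
  fixes V :: "('a \<Rightarrow> complex) set" and ip :: "('a \<Rightarrow> complex) \<Rightarrow> ('a \<Rightarrow> complex) \<Rightarrow> complex"
    and l :: "('a \<Rightarrow> complex) \<Rightarrow> complex"
  assumes zero: "(\<lambda>x. 0) \<in> V"
    and add: "\<And>f g. f \<in> V \<Longrightarrow> g \<in> V \<Longrightarrow> (\<lambda>x. f x + g x) \<in> V"
    and scale: "\<And>c f. f \<in> V \<Longrightarrow> (\<lambda>x. c * f x) \<in> V"
    and ip_add: "\<And>f g h. f \<in> V \<Longrightarrow> g \<in> V \<Longrightarrow> h \<in> V \<Longrightarrow> ip (\<lambda>x. f x + g x) h = ip f h + ip g h"
    and ip_scale: "\<And>c f h. f \<in> V \<Longrightarrow> h \<in> V \<Longrightarrow> ip (\<lambda>x. c * f x) h = c * ip f h"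
    and ip_cnj: "\<And>f g. f \<in> V \<Longrightarrow> g \<in> V \<Longrightarrow> ip g f = cnj (ip f g)"
    and ip_nonneg: "\<And>f. f \<in> V \<Longrightarrow> Re (ip f f) \<ge> 0"
    and complete: "\<And>X. (\<And>n. X n \<in> V) \<Longrightarrow>
        (\<And>e. e > 0 \<Longrightarrow> \<exists>n0. \<forall>m\<ge>n0. \<forall>n\<ge>n0. Re (ip (\<lambda>x. X m x - X n x) (\<lambda>x. X m x - X n x)) < e) \<Longrightarrow>
        \<exists>g\<in>V. (\<lambda>n::nat. Re (ip (\<lambda>x. X n x - g x) (\<lambda>x. X n x - g x))) \<longlonglongrightarrow> 0"
    and l_add: "\<And>f g. f \<in> V \<Longrightarrow> g \<in> V \<Longrightarrow> l (\<lambda>x. f x + g x) = l f + l g"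
    and l_scale: "\<And>c f. f \<in> V \<Longrightarrow> l (\<lambda>x. c * f x) = c * l f"
    and l_bound: "\<And>f. f \<in> V \<Longrightarrow> (norm (l f))\<^sup>2 \<le> M * Re (ip f f)"
    and "M \<ge> 0"
  shows "\<exists>g\<in>V. \<forall>f\<in>V. l f = ip f g"
proof -
  define q where "q f = Re (ip f f)" for f
  define J where "J f = q f - 2 * Re (l f)" for f
  have comb: "(\<lambda>x. f x + c * g x) \<in> V" if "f \<in> V" "g \<in> V" for f g c
    using add[OF that(1) scale[OF that(2)]] .
  have diff: "(\<lambda>x. f x - g x) \<in> V" if "f \<in> V" "g \<in> V" for f g
    using comb[OF that, of "-1"] by simp
  have q_comb: "q (\<lambda>x. f x + of_real c * g x) = q f + 2 * c * Re (ip f g) + c\<^sup>2 * q g"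
    if f: "f \<in> V" and g: "g \<in> V" for f g c
  proof -
    note m = f g scale[OF g, of "of_real c"] comb[OF f g, of "of_real c"]
    let ?h = "\<lambda>x. f x + of_real c * g x"
    have right: "ip k ?h = ip k f + of_real c * ip k g" if k: "k \<in> V" for k
      using m k by (simp add: ip_cnj[of ?h k] ip_add ip_scale ip_cnj[of k f] ip_cnj[of k g])
    have "ip ?h ?h = ip f ?h + of_real c * ip g ?h"
      using m by (simp add: ip_add ip_scale)
    then show ?thesis
      using m by (simp add: q_def right ip_cnj[of f g] power2_eq_square algebra_simps)
  qed
  have Re_sym: "Re (ip f g) = Re (ip g f)" if "f \<in> V" "g \<in> V" for f g
    using ip_cnj[OF that] by simp
  have J_comb: "J (\<lambda>x. f x + of_real c * g x) = J f + 2 * c * (Re (ip f g) - Re (l g)) + c\<^sup>2 * q g"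
    if f: "f \<in> V" and g: "g \<in> V" for f g c
    using q_comb[OF that, of c] l_add[OF f scale[OF g], of "of_real c"] l_scale[OF g, of "of_real c"]
    by (simp add: J_def algebra_simps)
  have J_ge: "J f \<ge> - M" if "f \<in> V" for f
  proof -
    have "norm (l f) \<le> (M + q f) / 2"
    proof (rule power2_le_imp_le)
      have "(norm (l f))\<^sup>2 \<le> M * q f" using l_bound[OF that] by (simp add: q_def)
      also have "\<dots> \<le> ((M + q f) / 2)\<^sup>2"
        using zero_le_power2[of "M - q f"] by (simp add: power2_eq_square field_simps)
      finally show "(norm (l f))\<^sup>2 \<le> ((M + q f) / 2)\<^sup>2" .
    qed (use \<open>M \<ge> 0\<close> ip_nonneg[OF that] in \<open>simp add: q_def\<close>)
    then show ?thesis using complex_Re_le_cmod[of "l f"] by (simp add: J_def)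
  qed
  define I where "I = Inf (J ` V)"
  have bdd: "bdd_below (J ` V)" using J_ge by (intro bdd_belowI2[of V "- M"]) simp
  have I_le: "I \<le> J f" if "f \<in> V" for f
    unfolding I_def using bdd that by (intro cInf_lower) auto
  have "\<exists>f\<in>V. J f < I + 1 / real (Suc n)" for n
  proof -
    have "Inf (J ` V) < I + 1 / real (Suc n)" unfolding I_def by simp
    then show ?thesis using zero by (subst (asm) cInf_less_iff[OF _ bdd]) auto
  qed
  then obtain X where X: "\<And>n. X n \<in> V" "\<And>n. J (X n) < I + 1 / real (Suc n)" by metis
  have inv0: "(\<lambda>n. 1 / real (Suc n)) \<longlonglongrightarrow> 0"
    using LIMSEQ_inverse_real_of_nat by (simp add: inverse_eq_divide)
  have "\<exists>g\<in>V. (\<lambda>n. Re (ip (\<lambda>x. X n x - g x) (\<lambda>x. X n x - g x))) \<longlonglongrightarrow> 0"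
  proof (rule complete)
    fix e :: real assume "e > 0"
    obtain n0 where n0: "\<And>n. n \<ge> n0 \<Longrightarrow> 1 / real (Suc n) < e / 4"
      using order_tendstoD(2)[OF inv0, of "e/4"] \<open>e > 0\<close> by (auto simp: eventually_sequentially)
    have "Re (ip (\<lambda>x. X m x - X n x) (\<lambda>x. X m x - X n x)) < e" if "m \<ge> n0" "n \<ge> n0" for m n
    proof -
      define d where "d x = X n x - X m x" for x
      have d: "d \<in> V" unfolding d_def by (rule diff) (rule X)+
      have "J (X n) = J (\<lambda>x. X m x + of_real 1 * d x)" by (simp add: d_def)
      then have 1: "J (X n) = J (X m) + 2 * (Re (ip (X m) d) - Re (l d)) + q d"
        using J_comb[OF X(1) d, of m 1] by simp
      \<comment> \<open>The value of \<open>J\<close> at the midpoint of \<open>X m\<close> and \<open>X n\<close>.\<close>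
      have 2: "J (X m) + (Re (ip (X m) d) - Re (l d)) + q d / 4 \<ge> I"
        using J_comb[OF X(1) d, of m "1/2"] I_le[OF comb[OF X(1) d, of m "of_real (1/2)"]]
        by (simp add: power2_eq_square)
      have "q d < e"
        using 1 2 less_le_trans[OF X(2)[of m] add_left_mono[OF less_imp_le[OF n0[OF that(1)]]]]
          less_le_trans[OF X(2)[of n] add_left_mono[OF less_imp_le[OF n0[OF that(2)]]]]
        by argo
      moreover have "q (\<lambda>x. X m x - X n x) = q d"
        using q_comb[OF zero d, of "-1"] q_comb[OF zero d, of 0] ip_scale[OF zero d, of 0] ip_scale[OF zero zero, of 0]
        by (simp add: d_def q_def)
      ultimately show ?thesis by (simp add: q_def)
    qed
    then show "\<exists>n0. \<forall>m\<ge>n0. \<forall>n\<ge>n0. Re (ip (\<lambda>x. X m x - X n x) (\<lambda>x. X m x - X n x)) < e" by blast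
  qed (rule X)
  then obtain g where g: "g \<in> V" and lim: "(\<lambda>n. q (\<lambda>x. X n x - g x)) \<longlonglongrightarrow> 0" unfolding q_def by blast
  have Re_eq: "Re (ip f g) = Re (l f)" if f: "f \<in> V" for f
  proof -
    have CS: "(Re (ip f h))\<^sup>2 \<le> q f * q h" if h: "h \<in> V" for h
    proof (rule discriminant_le_if_quadratic_nonneg)
      show "q h \<ge> 0" using ip_nonneg[OF h] by (simp add: q_def)
      show "0 \<le> q f + 2 * c * Re (ip f h) + c\<^sup>2 * q h" for c
        using q_comb[OF f h, of c] ip_nonneg[OF comb[OF f h, of "of_real c"]] by (simp add: q_def)
    qed
    have "(\<lambda>n. (Re (ip f (\<lambda>x. X n x - g x)))\<^sup>2) \<longlonglongrightarrow> 0"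
    proof (rule tendsto_sandwich[where f = "\<lambda>_. 0" and h = "\<lambda>n. q f * q (\<lambda>x. X n x - g x)"])
      show "(\<lambda>n. q f * q (\<lambda>x. X n x - g x)) \<longlonglongrightarrow> 0"
        using tendsto_mult_right_zero[OF lim] by simp
    qed (auto intro: always_eventually CS diff X g)
    then have "(\<lambda>n. sqrt ((Re (ip f (\<lambda>x. X n x - g x)))\<^sup>2)) \<longlonglongrightarrow> sqrt 0"
      by (rule tendsto_real_sqrt)
    then have 0: "(\<lambda>n. Re (ip f (\<lambda>x. X n x - g x))) \<longlonglongrightarrow> 0"
      by (simp add: tendsto_rabs_zero_iff)
    have split: "Re (ip (X n) f) = Re (ip f g) + Re (ip f (\<lambda>x. X n x - g x))" for n
    proof -
      have "ip (\<lambda>x. g x + (X n x - g x)) f = ip g f + ip (\<lambda>x. X n x - g x) f"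
        by (rule ip_add) (auto intro: diff X g f)
      then show ?thesis using Re_sym f g diff[OF X(1) g] by simp
    qed
    have "(Re (ip f g) - Re (l f))\<^sup>2 \<le> 0 * q f"
    proof (rule discriminant_le_if_quadratic_nonneg)
      show "q f \<ge> 0" using ip_nonneg[OF f] by (simp add: q_def)
      fix c :: real
      have "(\<lambda>n. 1 / real (Suc n) + 2 * c * (Re (ip f g) + Re (ip f (\<lambda>x. X n x - g x)) - Re (l f)) + c\<^sup>2 * q f)
          \<longlonglongrightarrow> 0 + 2 * c * (Re (ip f g) + 0 - Re (l f)) + c\<^sup>2 * q f"
        by (intro tendsto_intros inv0 0)
      moreover have "0 \<le> 1 / real (Suc n) + 2 * c * (Re (ip f g) + Re (ip f (\<lambda>x. X n x - g x)) - Re (l f)) + c\<^sup>2 * q f" for n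
        using J_comb[OF X(1) f, of n c] I_le[OF comb[OF X(1) f, of n "of_real c"]] X(2)[of n]
        by (simp only: split)
      ultimately show "0 \<le> 0 + 2 * c * (Re (ip f g) - Re (l f)) + c\<^sup>2 * q f"
        by (intro tendsto_lowerbound[where F = sequentially]) (auto intro: always_eventually)
    qed
    then show ?thesis by simp
  qed
  have "l f = ip f g" if f: "f \<in> V" for f
  proof (rule complex_eqI)
    \<comment> \<open>The real part at \<open>- \<i> f\<close> is the imaginary part at \<open>f\<close>.\<close>
    show "Im (l f) = Im (ip f g)"
      using Re_eq[OF scale[OF f, of "-\<i>"]] ip_scale[OF f g, of "-\<i>"] l_scale[OF f, of "-\<i>"] by simp
  qed (simp add: Re_eq f)
  then show ?thesis using g by blast
qed

section \<open>Locally uniform limits of holomorphic functions\<close>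

text \<open>Local boundedness and holomorphy on complex lines suffice. This is the case of
  \<open>line_holomorphic_family\<close> with trivial parameter direction: it gives Frechet differentiability, and the
  restriction to a line then shows that the derivative is complex linear.\<close>

lemma holomorphic_several_onI:
  assumes "open \<Omega>"
    and bd: "\<And>p. p \<in> \<Omega> \<Longrightarrow> \<exists>M. \<forall>\<^sub>F q in nhds p. norm (f q) \<le> M"
    and line: "\<And>p a. p \<in> \<Omega> \<Longrightarrow> (\<lambda>l. f (p + l *s a)) field_differentiable at 0"
  shows "holomorphic_several_on \<Omega> f"
proof -
  define \<D> where "\<D> = range (\<lambda>(a :: complex ^ 'a) l. l *s a)"
  define g where "g \<mu> = (if \<mu> = (0::nat) then f else (\<lambda>_. 0))" for \<mu>
  have "smooth_on \<Omega> (g 0)"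
  proof (rule smooth_on_line_holomorphic_family[OF assms(1)])
    show "bounded_linear d" if "d \<in> \<D>" for d
      using that by (auto simp: \<D>_def bounded_linear_smult_left)
    show "line_holomorphic_family \<Omega> \<D> 0 g"
      using bd line
      by (auto simp: line_holomorphic_family_def g_def \<D>_def intro!: exI[of _ 0] derivative_eq_intros always_eventually)
    show "Basis \<subseteq> insert 0 ((\<lambda>d. d 1) ` \<D>)"
      by (force simp: \<D>_def image_iff)
  qed
  then have diff: "f differentiable (at p)" if "p \<in> \<Omega>" for p
    using that unfolding smooth_on_def g_def by (auto dest: spec[of _ "Suc 0"])
  show ?thesis
    unfolding holomorphic_several_on_def
  proof (intro ballI)
    fix p assume p: "p \<in> \<Omega>"
    then obtain f' where f': "(f has_derivative f') (at p)"
      using diff by (auto simp: differentiable_def)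
    have "f' (c *s a) = c * f' a" for c a
    proof -
      obtain D where D: "((\<lambda>l. f (p + l *s a)) has_field_derivative D) (at 0)"
        using line[OF p] by (auto simp: field_differentiable_def)
      have "((\<lambda>l. p + l *s a) has_derivative (\<lambda>l. l *s a)) (at 0)"
        by (auto intro!: derivative_eq_intros bounded_linear_imp_has_derivative bounded_linear_smult_left)
      moreover have "(f has_derivative f') (at (p + 0 *s a))" using f' by simp
      ultimately have "(f \<circ> (\<lambda>l. p + l *s a) has_derivative f' \<circ> (\<lambda>l. l *s a)) (at 0)"
        by (rule diff_chain_at)
      then have "((\<lambda>l. f (p + l *s a)) has_derivative (\<lambda>l. f' (l *s a))) (at 0)"
        by (simp only: o_def)
      then have "(\<lambda>l. f' (l *s a)) = (*) D"
        using D unfolding has_field_derivative_def by (rule has_derivative_unique)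
      then have "f' (l *s a) = D * l" for l by (rule fun_cong)
      from this[of c] this[of 1] show ?thesis by (simp add: mult.commute)
    qed
    then show "\<exists>f'. (f has_derivative f') (at p) \<and> (\<forall>c v. f' (c *s v) = c * f' v)" using f' by blast
  qed
qed

lemma holomorphic_several_on_uniform_limit:
  fixes f :: "nat \<Rightarrow> complex ^ 'n \<Rightarrow> complex"
  assumes "open \<Omega>" and hol: "\<And>n. holomorphic_several_on \<Omega> (f n)"
    and lim: "\<And>K. compact K \<Longrightarrow> K \<subseteq> \<Omega> \<Longrightarrow> uniform_limit K f g sequentially"
  shows "holomorphic_several_on \<Omega> g"
proof (rule holomorphic_several_onI[OF assms(1)])
  fix p assume p: "p \<in> \<Omega>"
  then obtain r where r: "r > 0" "cball p r \<subseteq> \<Omega>" using assms(1) open_contains_cball by blast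
  have ul: "uniform_limit (cball p r) f g sequentially" using lim r by auto
  have "continuous_on (cball p r) g"
    using continuous_on_subset[OF holomorphic_several_continuous[OF hol] r(2)]
    by (intro uniform_limit_theorem[OF _ ul]) (simp_all add: always_eventually)
  then have "bounded (g ` cball p r)"
    by (intro compact_imp_bounded compact_continuous_image) auto
  then obtain M where "\<And>q. q \<in> cball p r \<Longrightarrow> norm (g q) \<le> M"
    unfolding bounded_iff by blast
  then show "\<exists>M. \<forall>\<^sub>F q in nhds p. norm (g q) \<le> M"
    using r(1) unfolding eventually_nhds_metric by (intro exI[of _ M] exI[of _ r]) (auto simp: dist_commute)
  fix a :: "complex ^ 'n"
  define B where "B = ball (0::complex) (r / (norm a + 1))"
  have inb: "p + l *s a \<in> cball p r" if "l \<in> B" for l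
  proof -
    have "norm l * norm a \<le> norm l * (norm a + 1)" by (simp add: mult_left_mono)
    also have "\<dots> \<le> r" using that by (simp add: B_def pos_less_divide_eq add_nonneg_pos)
    finally show ?thesis by (simp add: dist_norm norm_vector_smult)
  qed
  have "(\<lambda>l. g (p + l *s a)) holomorphic_on B"
  proof (rule holomorphic_uniform_sequence[where f = "\<lambda>n l. f n (p + l *s a)"])
    show "(\<lambda>l. f n (p + l *s a)) holomorphic_on B" for n
      using inb r by (intro line_holomorphic_on_disc[OF bounded_linear_smult_left holomorphic_several_line[OF hol]]) auto
    show "\<exists>d>0. cball x d \<subseteq> B \<and> uniform_limit (cball x d) (\<lambda>n l. f n (p + l *s a)) (\<lambda>l. g (p + l *s a)) sequentially"
      if x: "x \<in> B" for x
    proof -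
      obtain d where d: "d > 0" "cball x d \<subseteq> B"
        using x open_contains_cball[of B] by (metis B_def open_ball)
      have "uniform_limit (cball x d) (\<lambda>n l. f n (p + l *s a)) (\<lambda>l. g (p + l *s a)) sequentially"
        using d inb by (intro uniform_limit_compose'[OF ul]) auto
      then show ?thesis using d by blast
    qed
  qed (simp add: B_def)
  moreover have "0 \<in> B" "open B" using r(1) by (auto simp: B_def add_nonneg_pos)
  ultimately show "(\<lambda>l. g (p + l *s a)) field_differentiable at 0"
    by (meson holomorphic_on_imp_differentiable_at)
qed

section \<open>Square integrable holomorphic functions\<close>

definition A2 :: "(complex ^ 'n) set \<Rightarrow> (complex ^ 'n \<Rightarrow> complex) set" where
  "A2 \<Omega> = {f. holomorphic_several_on \<Omega> f \<and> set_integrable lborel \<Omega> (\<lambda>z. (cmod (f z))\<^sup>2)}"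

definition l2norm :: "(complex ^ 'n) set \<Rightarrow> (complex ^ 'n \<Rightarrow> complex) \<Rightarrow> real" where
  "l2norm \<Omega> f = sqrt (LINT z:\<Omega>|lborel. (cmod (f z))\<^sup>2)"

definition weighted_inner ::
    "(complex ^ 'n) set \<Rightarrow> (complex ^ 'n \<Rightarrow> real) \<Rightarrow> (complex ^ 'n \<Rightarrow> complex) \<Rightarrow> (complex ^ 'n \<Rightarrow> complex) \<Rightarrow> complex"
where
  "weighted_inner \<Omega> W f g = (LINT z:\<Omega>|lborel. f z * cnj (g z) * complex_of_real (W z))"

text \<open>Weights may change sign: besides \<open>exp (- \<phi>\<^sub>t)\<close> also its derivatives and Taylor remainders in \<open>t\<close> serve
  as weights.\<close>

definition bounded_weight :: "(complex ^ 'n) set \<Rightarrow> real \<Rightarrow> (complex ^ 'n \<Rightarrow> real) \<Rightarrow> bool" where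
  "bounded_weight \<Omega> M W \<longleftrightarrow> continuous_on \<Omega> W \<and> (\<forall>z\<in>\<Omega>. \<bar>W z\<bar> \<le> M)"

lemma set_borel_measurable_continuous_on_open:
  fixes f :: "'a::euclidean_space \<Rightarrow> 'b::{real_normed_vector, second_countable_topology}"
  assumes "open \<Omega>" "continuous_on \<Omega> f"
  shows "set_borel_measurable lborel \<Omega> f"
  using borel_measurable_continuous_on_indicator[OF _ assms(2)] assms(1)
  by (simp add: set_borel_measurable_def)

context
  fixes \<Omega> :: "(complex ^ 'n) set"
  assumes open_\<Omega>: "open \<Omega>"
begin

lemma A2_holomorphic: "f \<in> A2 \<Omega> \<Longrightarrow> holomorphic_several_on \<Omega> f"
  by (simp add: A2_def)

lemma A2_continuous: "f \<in> A2 \<Omega> \<Longrightarrow> continuous_on \<Omega> f"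
  by (simp add: A2_def holomorphic_several_continuous)

lemma A2_weighted_integrable:
  assumes f: "f \<in> A2 \<Omega>" and g: "g \<in> A2 \<Omega>" and W: "bounded_weight \<Omega> M W"
  shows "set_integrable lborel \<Omega> (\<lambda>z. f z * cnj (g z) * complex_of_real (W z))"
proof (rule set_integrable_bound)
  show "set_integrable lborel \<Omega> (\<lambda>z. \<bar>M\<bar> * ((cmod (f z))\<^sup>2 + (cmod (g z))\<^sup>2))"
    using f g by (intro set_integrable_mult_right set_integral_add) (auto simp: A2_def)
  show "set_borel_measurable lborel \<Omega> (\<lambda>z. f z * cnj (g z) * complex_of_real (W z))"
    using A2_continuous[OF f] A2_continuous[OF g] W
    by (intro set_borel_measurable_continuous_on_open open_\<Omega> continuous_intros) (auto simp: bounded_weight_def)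
  have "cmod (f z) * cmod (g z) * \<bar>W z\<bar> \<le> \<bar>M\<bar> * ((cmod (f z))\<^sup>2 + (cmod (g z))\<^sup>2)" if "z \<in> \<Omega>" for z
  proof -
    have "cmod (f z) * cmod (g z) \<le> (cmod (f z))\<^sup>2 + (cmod (g z))\<^sup>2"
      using sum_squares_bound[of "cmod (f z)" "cmod (g z)"] mult_nonneg_nonneg[OF norm_ge_zero norm_ge_zero, of "f z" "g z"]
      by linarith
    moreover have "\<bar>W z\<bar> \<le> \<bar>M\<bar>" using W that by (auto simp: bounded_weight_def intro: order_trans)
    ultimately have "cmod (f z) * cmod (g z) * \<bar>W z\<bar> \<le> ((cmod (f z))\<^sup>2 + (cmod (g z))\<^sup>2) * \<bar>M\<bar>"
      by (intro mult_mono) auto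
    then show ?thesis by (simp add: mult.commute)
  qed
  then show "AE z in lborel. z \<in> \<Omega> \<longrightarrow> norm (f z * cnj (g z) * complex_of_real (W z))
      \<le> norm (\<bar>M\<bar> * ((cmod (f z))\<^sup>2 + (cmod (g z))\<^sup>2))"
    by (auto simp: norm_mult)
qed

lemma A2_scale:
  assumes "f \<in> A2 \<Omega>"
  shows "(\<lambda>z. c * f z) \<in> A2 \<Omega>"
proof -
  have "holomorphic_several_on \<Omega> (\<lambda>z. c * f z)"
    unfolding holomorphic_several_on_def
  proof
    fix z assume "z \<in> \<Omega>"
    then obtain f' where f': "(f has_derivative f') (at z)" "\<forall>c v. f' (c *s v) = c * f' v"
      using assms by (auto simp: A2_def holomorphic_several_on_def)
    have "((\<lambda>z. c * f z) has_derivative (\<lambda>v. c * f' v)) (at z)"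
      by (rule has_derivative_mult_right[OF f'(1)])
    with f'(2) show "\<exists>g'. ((\<lambda>z. c * f z) has_derivative g') (at z) \<and> (\<forall>c v. g' (c *s v) = c * g' v)"
      by (intro exI[of _ "\<lambda>v. c * f' v"]) simp
  qed
  moreover have "set_integrable lborel \<Omega> (\<lambda>z. (cmod c)\<^sup>2 * (cmod (f z))\<^sup>2)"
    using assms by (intro set_integrable_mult_right) (auto simp: A2_def)
  ultimately show ?thesis by (simp add: A2_def norm_mult power_mult_distrib)
qed

lemma A2_add:
  assumes f: "f \<in> A2 \<Omega>" and g: "g \<in> A2 \<Omega>"
  shows "(\<lambda>z. f z + g z) \<in> A2 \<Omega>"
proof -
  have "holomorphic_several_on \<Omega> (\<lambda>z. f z + g z)"
    unfolding holomorphic_several_on_def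
  proof
    fix z assume z: "z \<in> \<Omega>"
    obtain f' where f': "(f has_derivative f') (at z)" "\<forall>c v. f' (c *s v) = c * f' v"
      using f z by (auto simp: A2_def holomorphic_several_on_def)
    obtain g' where g': "(g has_derivative g') (at z)" "\<forall>c v. g' (c *s v) = c * g' v"
      using g z by (auto simp: A2_def holomorphic_several_on_def)
    show "\<exists>h'. ((\<lambda>z. f z + g z) has_derivative h') (at z) \<and> (\<forall>c v. h' (c *s v) = c * h' v)"
      using f' g' by (intro exI[of _ "\<lambda>v. f' v + g' v"]) (simp add: has_derivative_add algebra_simps)
  qed
  moreover have "set_integrable lborel \<Omega> (\<lambda>z. (cmod (f z + g z))\<^sup>2)"
  proof (rule set_integrable_bound)
    show "set_integrable lborel \<Omega> (\<lambda>z. 2 * ((cmod (f z))\<^sup>2 + (cmod (g z))\<^sup>2))"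
      using f g by (intro set_integrable_mult_right set_integral_add) (auto simp: A2_def)
    show "set_borel_measurable lborel \<Omega> (\<lambda>z. (cmod (f z + g z))\<^sup>2)"
      using A2_continuous[OF f] A2_continuous[OF g]
      by (intro set_borel_measurable_continuous_on_open open_\<Omega> continuous_intros)
    have "(cmod (f z + g z))\<^sup>2 \<le> 2 * ((cmod (f z))\<^sup>2 + (cmod (g z))\<^sup>2)" for z
    proof -
      have "(cmod (f z + g z))\<^sup>2 \<le> (cmod (f z) + cmod (g z))\<^sup>2"
        by (intro power_mono norm_triangle_ineq) auto
      also have "\<dots> \<le> 2 * ((cmod (f z))\<^sup>2 + (cmod (g z))\<^sup>2)"
        using sum_squares_bound[of "cmod (f z)" "cmod (g z)"] by (simp add: power2_sum)
      finally show ?thesis .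
    qed
    then show "AE z in lborel. z \<in> \<Omega> \<longrightarrow> norm ((cmod (f z + g z))\<^sup>2) \<le> norm (2 * ((cmod (f z))\<^sup>2 + (cmod (g z))\<^sup>2))"
      by auto
  qed
  ultimately show ?thesis by (simp add: A2_def)
qed

lemma A2_zero: "(\<lambda>z. 0) \<in> A2 \<Omega>"
  by (auto simp: A2_def holomorphic_several_on_def set_integrable_def intro!: exI[of _ "\<lambda>_. 0"])

lemma A2_diff: "f \<in> A2 \<Omega> \<Longrightarrow> g \<in> A2 \<Omega> \<Longrightarrow> (\<lambda>z. f z - g z) \<in> A2 \<Omega>"
  using A2_add[of f "\<lambda>z. -1 * g z"] A2_scale[of g "-1"] by simp

lemma weighted_inner_add_left:
  assumes "f \<in> A2 \<Omega>" "g \<in> A2 \<Omega>" "h \<in> A2 \<Omega>" "bounded_weight \<Omega> M W"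
  shows "weighted_inner \<Omega> W (\<lambda>z. f z + g z) h = weighted_inner \<Omega> W f h + weighted_inner \<Omega> W g h"
  using set_integral_add(2)[OF A2_weighted_integrable[OF assms(1,3,4)] A2_weighted_integrable[OF assms(2,3,4)]]
  by (simp add: weighted_inner_def algebra_simps)

lemma weighted_inner_scale_left: "weighted_inner \<Omega> W (\<lambda>z. c * f z) h = c * weighted_inner \<Omega> W f h"
  using set_integral_mult_right[of lborel \<Omega> c "\<lambda>z. f z * cnj (h z) * complex_of_real (W z)"]
  by (simp add: weighted_inner_def mult.assoc)

lemma weighted_inner_cnj: "weighted_inner \<Omega> W g f = cnj (weighted_inner \<Omega> W f g)"
proof -
  have "cnj (weighted_inner \<Omega> W f g) = (LINT z|lborel. cnj (indicator \<Omega> z *\<^sub>R (f z * cnj (g z) * complex_of_real (W z))))"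
    unfolding weighted_inner_def set_lebesgue_integral_def by (rule Bochner_Integration.integral_cnj[symmetric])
  also have "\<dots> = weighted_inner \<Omega> W g f"
    by (simp add: weighted_inner_def set_lebesgue_integral_def mult.commute mult.left_commute)
  finally show ?thesis ..
qed

lemma weighted_inner_add_right:
  assumes "f \<in> A2 \<Omega>" "g \<in> A2 \<Omega>" "h \<in> A2 \<Omega>" "bounded_weight \<Omega> M W"
  shows "weighted_inner \<Omega> W h (\<lambda>z. f z + g z) = weighted_inner \<Omega> W h f + weighted_inner \<Omega> W h g"
  using weighted_inner_add_left[OF assms] weighted_inner_cnj[of W] by (metis complex_cnj_add)

lemma weighted_inner_scale_right: "weighted_inner \<Omega> W h (\<lambda>z. c * f z) = cnj c * weighted_inner \<Omega> W h f"
  using weighted_inner_scale_left[of W c f h] weighted_inner_cnj[of W] by (metis complex_cnj_mult)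

lemma bounded_weight_add:
  "bounded_weight \<Omega> M W \<Longrightarrow> bounded_weight \<Omega> M' W' \<Longrightarrow> bounded_weight \<Omega> (M + M') (\<lambda>z. W z + W' z)"
  unfolding bounded_weight_def
  by (intro conjI continuous_on_add ballI order_trans[OF abs_triangle_ineq] add_mono) auto

lemma bounded_weight_scale:
  "bounded_weight \<Omega> M W \<Longrightarrow> bounded_weight \<Omega> (\<bar>c\<bar> * M) (\<lambda>z. c * W z)"
  unfolding bounded_weight_def abs_mult
  by (intro conjI ballI continuous_on_mult continuous_on_const mult_left_mono) auto

lemma weighted_inner_add_weight:
  assumes "f \<in> A2 \<Omega>" "g \<in> A2 \<Omega>" "bounded_weight \<Omega> M W" "bounded_weight \<Omega> M' W'"
  shows "weighted_inner \<Omega> (\<lambda>z. W z + W' z) f g = weighted_inner \<Omega> W f g + weighted_inner \<Omega> W' f g"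
  using set_integral_add(2)[OF A2_weighted_integrable[OF assms(1,2,3)] A2_weighted_integrable[OF assms(1,2,4)]]
  by (simp add: weighted_inner_def algebra_simps)

lemma weighted_inner_scale_weight:
  "weighted_inner \<Omega> (\<lambda>z. c * W z) f g = of_real c * weighted_inner \<Omega> W f g"
  using set_integral_mult_right[of lborel \<Omega> "of_real c" "\<lambda>z. f z * cnj (g z) * complex_of_real (W z)"]
  by (simp add: weighted_inner_def mult.assoc mult.left_commute)

lemma l2norm_nonneg: "l2norm \<Omega> f \<ge> 0"
  by (simp add: l2norm_def set_lebesgue_integral_def)

lemma l2norm_square: "(l2norm \<Omega> f)\<^sup>2 = (LINT z:\<Omega>|lborel. (cmod (f z))\<^sup>2)"
  by (simp add: l2norm_def set_lebesgue_integral_def)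

text \<open>The Cauchy--Schwarz inequality.\<close>

lemma weighted_inner_bound:
  assumes f: "f \<in> A2 \<Omega>" and g: "g \<in> A2 \<Omega>" and W: "bounded_weight \<Omega> M W" and "M \<ge> 0"
  shows "norm (weighted_inner \<Omega> W f g) \<le> M * (l2norm \<Omega> f * l2norm \<Omega> g)"
proof -
  define P where "P = (LINT z:\<Omega>|lborel. cmod (f z) * cmod (g z))"
  have one: "bounded_weight \<Omega> 1 (\<lambda>_. 1)" by (simp add: bounded_weight_def)
  have int: "set_integrable lborel \<Omega> (\<lambda>z. cmod (f z) * cmod (g z))"
    using set_integrable_norm[OF A2_weighted_integrable[OF f g one]] by (simp add: norm_mult)
  have sq: "set_integrable lborel \<Omega> (\<lambda>z. (cmod (f z))\<^sup>2)" "set_integrable lborel \<Omega> (\<lambda>z. (cmod (g z))\<^sup>2)"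
    using f g by (auto simp: A2_def)
  have "P\<^sup>2 \<le> (l2norm \<Omega> f)\<^sup>2 * (l2norm \<Omega> g)\<^sup>2"
  proof (rule discriminant_le_if_quadratic_nonneg)
    fix c :: real
    have "0 \<le> (LINT z:\<Omega>|lborel. (cmod (f z) + c * cmod (g z))\<^sup>2)"
      by (simp add: set_lebesgue_integral_def)
    also have "\<dots> = (LINT z:\<Omega>|lborel. (cmod (f z))\<^sup>2 + (2 * c) * (cmod (f z) * cmod (g z)) + c\<^sup>2 * (cmod (g z))\<^sup>2)"
      by (simp add: power2_sum power_mult_distrib algebra_simps)
    also have "\<dots> = (l2norm \<Omega> f)\<^sup>2 + 2 * c * P + c\<^sup>2 * (l2norm \<Omega> g)\<^sup>2"
      using int sq by (simp add: set_integral_add set_integrable_mult_right P_def l2norm_square)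
    finally show "0 \<le> (l2norm \<Omega> f)\<^sup>2 + 2 * c * P + c\<^sup>2 * (l2norm \<Omega> g)\<^sup>2" .
  qed simp
  then have P: "P \<le> l2norm \<Omega> f * l2norm \<Omega> g"
    using power2_le_imp_le[of P "l2norm \<Omega> f * l2norm \<Omega> g"] by (simp add: power_mult_distrib l2norm_nonneg)
  have "norm (weighted_inner \<Omega> W f g) \<le> (LINT z:\<Omega>|lborel. norm (f z * cnj (g z) * complex_of_real (W z)))"
    unfolding weighted_inner_def by (rule set_integral_norm_bound[OF A2_weighted_integrable[OF f g W]])
  also have "\<dots> \<le> (LINT z:\<Omega>|lborel. M * (cmod (f z) * cmod (g z)))"
  proof (rule set_integral_mono)
    show "set_integrable lborel \<Omega> (\<lambda>z. norm (f z * cnj (g z) * complex_of_real (W z)))"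
      by (rule set_integrable_norm[OF A2_weighted_integrable[OF f g W]])
    show "set_integrable lborel \<Omega> (\<lambda>z. M * (cmod (f z) * cmod (g z)))"
      using int by (rule set_integrable_mult_right)
    show "norm (f z * cnj (g z) * complex_of_real (W z)) \<le> M * (cmod (f z) * cmod (g z))" if "z \<in> \<Omega>" for z
      using W that mult_left_mono[of "\<bar>W z\<bar>" M "cmod (f z) * cmod (g z)"]
      by (simp add: bounded_weight_def norm_mult mult.commute mult.left_commute)
  qed
  also have "\<dots> = M * P" by (simp add: P_def)
  also have "\<dots> \<le> M * (l2norm \<Omega> f * l2norm \<Omega> g)" using P \<open>M \<ge> 0\<close> by (rule mult_left_mono)
  finally show ?thesis .
qed

lemma weighted_inner_self_ge:
  assumes "f \<in> A2 \<Omega>" "bounded_weight \<Omega> M W" "\<And>z. z \<in> \<Omega> \<Longrightarrow> W z \<ge> m" "m \<ge> 0"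
  shows "m * (l2norm \<Omega> f)\<^sup>2 \<le> Re (weighted_inner \<Omega> W f f)"
proof -
  have int: "set_integrable lborel \<Omega> (\<lambda>z. W z * (cmod (f z))\<^sup>2)"
  proof (rule set_integrable_cong[THEN iffD1, OF refl refl _ set_integrable_norm[OF A2_weighted_integrable[OF assms(1,1,2)]]])
    fix z assume "z \<in> \<Omega>"
    then have "W z \<ge> 0" using assms(3,4) by force
    then show "norm (f z * cnj (f z) * complex_of_real (W z)) = W z * (cmod (f z))\<^sup>2"
      by (simp add: norm_mult power2_eq_square)
  qed
  have "weighted_inner \<Omega> W f f = (LINT z:\<Omega>|lborel. complex_of_real (W z * (cmod (f z))\<^sup>2))"
    unfolding weighted_inner_def
    by (intro set_lebesgue_integral_cong)
      (simp_all only: of_real_mult complex_norm_square mult.commute open_\<Omega> sets_lborel borel_open simp_thms)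
  then have "Re (weighted_inner \<Omega> W f f) = (LINT z:\<Omega>|lborel. W z * (cmod (f z))\<^sup>2)"
    by (simp only: set_integral_complex_of_real Re_complex_of_real)
  moreover have "m * (l2norm \<Omega> f)\<^sup>2 = (LINT z:\<Omega>|lborel. m * (cmod (f z))\<^sup>2)"
    by (simp add: l2norm_square)
  moreover have "\<dots> \<le> (LINT z:\<Omega>|lborel. W z * (cmod (f z))\<^sup>2)"
    using assms int by (intro set_integral_mono set_integrable_mult_right mult_right_mono) (auto simp: A2_def)
  ultimately show ?thesis by linarith
qed

lemma nn_integral_A2:
  assumes "f \<in> A2 \<Omega>"
  shows "(\<integral>\<^sup>+z. indicator \<Omega> z * ennreal ((cmod (f z))\<^sup>2) \<partial>lborel) = ennreal ((l2norm \<Omega> f)\<^sup>2)"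
proof -
  have "(\<integral>\<^sup>+z. ennreal (indicator \<Omega> z *\<^sub>R (cmod (f z))\<^sup>2) \<partial>lborel) = ennreal ((l2norm \<Omega> f)\<^sup>2)"
    using assms unfolding l2norm_square set_lebesgue_integral_def
    by (intro nn_integral_eq_integral) (auto simp: A2_def set_integrable_def)
  moreover have "ennreal (indicator \<Omega> z *\<^sub>R (cmod (f z))\<^sup>2) = indicator \<Omega> z * ennreal ((cmod (f z))\<^sup>2)" for z
    by (simp add: indicator_def)
  ultimately show ?thesis by simp
qed

text \<open>A radius \<open>r\<close> works for all points of \<open>K\<close>, and the balls of radius \<open>r\<close> have the same volume.\<close>

lemma A2_point_evaluation_bound:
  assumes K: "compact K" "K \<subseteq> \<Omega>"
  shows "\<exists>C>0. \<forall>z\<in>K. \<forall>f\<in>A2 \<Omega>. norm (f z) \<le> C * l2norm \<Omega> f"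
proof -
  obtain r where r: "r > 0" "(\<Union>z\<in>K. cball z r) \<subseteq> \<Omega>"
    using compact_subset_open_imp_cball_epsilon_subset[OF K(1) open_\<Omega> K(2)] by blast
  define v where "v = measure lborel (ball (0 :: complex ^ 'n) r)"
  have v: "emeasure lborel (ball z r) = ennreal v" "v > 0" for z :: "complex ^ 'n"
    using emeasure_lborel_ball_translate[of z r] emeasure_lborel_ball_finite[of "0 :: complex ^ 'n" r] r(1)
      content_ball_pos[of r "0 :: complex ^ 'n"]
    by (auto simp: v_def emeasure_eq_ennreal_measure)
  have "norm (f z) \<le> 1 / sqrt v * l2norm \<Omega> f" if z: "z \<in> K" and f: "f \<in> A2 \<Omega>" for z f
  proof -
    have sub: "ball z r \<subseteq> \<Omega>" using r z ball_subset_cball by blast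
    have "ennreal ((norm (f z))\<^sup>2) * ennreal v \<le> (\<integral>\<^sup>+\<zeta>. indicator (ball z r) \<zeta> * ennreal ((norm (f \<zeta>))\<^sup>2) \<partial>lborel)"
      using holomorphic_several_sub_mean_value[OF A2_holomorphic[OF f] sub r(1)] v(1) by simp
    also have "\<dots> \<le> (\<integral>\<^sup>+\<zeta>. indicator \<Omega> \<zeta> * ennreal ((norm (f \<zeta>))\<^sup>2) \<partial>lborel)"
      using sub by (intro nn_integral_mono) (auto simp: indicator_def)
    also have "\<dots> = ennreal ((l2norm \<Omega> f)\<^sup>2)" by (rule nn_integral_A2[OF f])
    finally have "(norm (f z))\<^sup>2 * v \<le> (l2norm \<Omega> f)\<^sup>2"
      using v(2) by (simp flip: ennreal_mult)
    then have "sqrt ((norm (f z))\<^sup>2 * v) \<le> l2norm \<Omega> f"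
      using l2norm_nonneg real_le_lsqrt by blast
    then show ?thesis using v(2) by (simp add: real_sqrt_mult field_simps)
  qed
  then show ?thesis using v(2) by (intro exI[of _ "1 / sqrt v"]) auto
qed

text \<open>By the bound on point evaluations a Cauchy sequence converges locally uniformly, so the limit is
  holomorphic; Fatou's lemma turns pointwise convergence into convergence in norm.\<close>

lemma A2_complete:
  assumes X: "\<And>n. X n \<in> A2 \<Omega>"
    and Cauchy: "\<And>e. e > 0 \<Longrightarrow> \<exists>n0. \<forall>m\<ge>n0. \<forall>n\<ge>n0. l2norm \<Omega> (\<lambda>z. X m z - X n z) < e"
  shows "\<exists>g\<in>A2 \<Omega>. (\<lambda>n::nat. l2norm \<Omega> (\<lambda>z. X n z - g z)) \<longlonglongrightarrow> 0"
proof -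
  have unif: "uniformly_Cauchy_on K X" if K: "compact K" "K \<subseteq> \<Omega>" for K
  proof -
    obtain C where C: "C > 0" "\<And>z f. z \<in> K \<Longrightarrow> f \<in> A2 \<Omega> \<Longrightarrow> norm (f z) \<le> C * l2norm \<Omega> f"
      using A2_point_evaluation_bound[OF K] by blast
    show ?thesis
      unfolding uniformly_Cauchy_on_def
    proof (intro allI impI)
      fix e :: real assume "e > 0"
      then obtain n0 where n0: "\<And>m n. m \<ge> n0 \<Longrightarrow> n \<ge> n0 \<Longrightarrow> l2norm \<Omega> (\<lambda>z. X m z - X n z) < e / C"
        using Cauchy[of "e / C"] C(1) by auto
      have "dist (X m z) (X n z) < e" if "m \<ge> n0" "n \<ge> n0" "z \<in> K" for m n z
        using C(2)[OF that(3) A2_diff[OF X X], of m n] n0[OF that(1,2)] C(1)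
        by (simp add: dist_norm field_simps)
      then show "\<exists>M. \<forall>x\<in>K. \<forall>m\<ge>M. \<forall>n\<ge>M. dist (X m x) (X n x) < e" by blast
    qed
  qed
  define g where "g z = lim (\<lambda>n. X n z)" for z
  have ul: "uniform_limit K X g sequentially" if K: "compact K" "K \<subseteq> \<Omega>" for K
  proof -
    have "uniformly_convergent_on K X" using unif[OF K] by (rule Cauchy_uniformly_convergent)
    then show ?thesis unfolding g_def by (simp add: uniformly_convergent_uniform_limit_iff)
  qed
  have ptw: "(\<lambda>n. X n z) \<longlonglongrightarrow> g z" if "z \<in> \<Omega>" for z
    using that by (intro tendsto_uniform_limitI[OF ul[of "{z}"]]) auto
  have hol: "holomorphic_several_on \<Omega> g"
    using holomorphic_several_on_uniform_limit[OF open_\<Omega> A2_holomorphic[OF X] ul] by blast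
  have fatou: "(\<integral>\<^sup>+z. indicator \<Omega> z * ennreal ((cmod (X n z - g z))\<^sup>2) \<partial>lborel) \<le> ennreal (e\<^sup>2)"
    if n0: "\<And>m. m \<ge> n0 \<Longrightarrow> l2norm \<Omega> (\<lambda>z. X n z - X m z) < e" for n n0 e
  proof -
    define u where "u m z = ennreal (indicator \<Omega> z *\<^sub>R (cmod (X n z - X m z))\<^sup>2)" for m z
    have u_alt: "u m z = indicator \<Omega> z * ennreal ((cmod (X n z - X m z))\<^sup>2)" for m z
      by (simp add: u_def indicator_def)
    have [measurable]: "u m \<in> borel_measurable lborel" for m
    proof -
      have "continuous_on \<Omega> (\<lambda>z. (cmod (X n z - X m z))\<^sup>2)"
        by (intro continuous_intros A2_continuous X)
      from set_borel_measurable_continuous_on_open[OF open_\<Omega> this]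
      show ?thesis
        unfolding u_def set_borel_measurable_def by (rule measurable_compose[OF _ measurable_ennreal])
    qed
    have "(\<lambda>m. u m z) \<longlonglongrightarrow> indicator \<Omega> z * ennreal ((cmod (X n z - g z))\<^sup>2)" for z
    proof (cases "z \<in> \<Omega>")
      case True
      then show ?thesis by (auto simp: u_alt intro!: tendsto_ennrealI tendsto_intros ptw)
    qed (simp add: u_alt)
    then have "(\<integral>\<^sup>+z. indicator \<Omega> z * ennreal ((cmod (X n z - g z))\<^sup>2) \<partial>lborel)
        = (\<integral>\<^sup>+z. liminf (\<lambda>m. u m z) \<partial>lborel)"
      by (intro nn_integral_cong lim_imp_Liminf[symmetric]) simp_all
    also have "\<dots> \<le> liminf (\<lambda>m. \<integral>\<^sup>+z. u m z \<partial>lborel)"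
      by (rule nn_integral_liminf) measurable
    also have "\<dots> \<le> liminf (\<lambda>m. ennreal (e\<^sup>2))"
    proof (rule Liminf_mono)
      have "(\<integral>\<^sup>+z. u m z \<partial>lborel) \<le> ennreal (e\<^sup>2)" if "m \<ge> n0" for m
        unfolding u_alt nn_integral_A2[OF A2_diff[OF X X]]
        using n0[OF that] by (intro ennreal_leI power_mono l2norm_nonneg) simp
      then show "\<forall>\<^sub>F m in sequentially. (\<integral>\<^sup>+z. u m z \<partial>lborel) \<le> ennreal (e\<^sup>2)"
        by (auto simp: eventually_sequentially)
    qed
    finally show ?thesis by (simp add: Liminf_const)
  qed
  have meas: "set_borel_measurable lborel \<Omega> (\<lambda>z. (cmod (X n z - g z))\<^sup>2)" for n
    by (intro set_borel_measurable_continuous_on_open open_\<Omega> continuous_intros A2_continuous X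
        holomorphic_several_continuous hol)
  have diff_A2: "(\<lambda>z. X n z - g z) \<in> A2 \<Omega>" if "\<And>m. m \<ge> n0 \<Longrightarrow> l2norm \<Omega> (\<lambda>z. X n z - X m z) < e" for n n0 e
  proof -
    have "holomorphic_several_on \<Omega> (\<lambda>z. X n z - g z)"
      by (rule holomorphic_several_on_uniform_limit[OF open_\<Omega>, of "\<lambda>m z. X n z - X m z"])
         (intro A2_holomorphic A2_diff X uniform_limit_minus uniform_limit_const ul; assumption)+
    moreover have "set_integrable lborel \<Omega> (\<lambda>z. (cmod (X n z - g z))\<^sup>2)"
      unfolding set_integrable_def
    proof (rule integrableI_bounded)
      show "(\<lambda>z. indicat_real \<Omega> z *\<^sub>R (cmod (X n z - g z))\<^sup>2) \<in> borel_measurable lborel"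
        using meas by (simp add: set_borel_measurable_def)
      have "(\<integral>\<^sup>+z. norm (indicat_real \<Omega> z *\<^sub>R (cmod (X n z - g z))\<^sup>2) \<partial>lborel)
          = (\<integral>\<^sup>+z. indicator \<Omega> z * ennreal ((cmod (X n z - g z))\<^sup>2) \<partial>lborel)"
        by (intro nn_integral_cong) (simp add: indicator_def)
      also have "\<dots> < \<infinity>"
        by (rule order_le_less_trans[OF fatou[OF that]]) simp_all
      finally show "(\<integral>\<^sup>+z. norm (indicat_real \<Omega> z *\<^sub>R (cmod (X n z - g z))\<^sup>2) \<partial>lborel) < \<infinity>" .
    qed
    ultimately show ?thesis by (simp add: A2_def)
  qed
  obtain n1 where n1: "\<And>m. m \<ge> n1 \<Longrightarrow> l2norm \<Omega> (\<lambda>z. X n1 z - X m z) < 1"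
    using Cauchy[of 1] by auto
  have g: "g \<in> A2 \<Omega>"
    using A2_diff[OF X[of n1] diff_A2[OF n1]] by simp
  have "(\<lambda>n. l2norm \<Omega> (\<lambda>z. X n z - g z)) \<longlonglongrightarrow> 0"
  proof (rule LIMSEQ_I)
    fix e :: real assume "e > 0"
    then obtain n0 where n0: "\<And>m n. m \<ge> n0 \<Longrightarrow> n \<ge> n0 \<Longrightarrow> l2norm \<Omega> (\<lambda>z. X m z - X n z) < e / 2"
      using Cauchy[of "e / 2"] by auto
    have "norm (l2norm \<Omega> (\<lambda>z. X n z - g z) - 0) < e" if n: "n \<ge> n0" for n
    proof -
      have "ennreal ((l2norm \<Omega> (\<lambda>z. X n z - g z))\<^sup>2) \<le> ennreal ((e/2)\<^sup>2)"
        using fatou[of n0 n "e/2"] n0[OF n] nn_integral_A2[OF A2_diff[OF X g, of n]] by simp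
      then have "(l2norm \<Omega> (\<lambda>z. X n z - g z))\<^sup>2 \<le> (e/2)\<^sup>2"
        by (subst (asm) ennreal_le_iff) simp_all
      then have "l2norm \<Omega> (\<lambda>z. X n z - g z) \<le> e / 2"
        by (rule power2_le_imp_le) (use \<open>e > 0\<close> in simp)
      then show ?thesis using \<open>e > 0\<close> l2norm_nonneg[of "\<lambda>z. X n z - g z"] by simp
    qed
    then show "\<exists>n0. \<forall>n\<ge>n0. norm (l2norm \<Omega> (\<lambda>z. X n z - g z) - 0) < e" by blast
  qed
  then show ?thesis using g by blast
qed

text \<open>A weight between two positive constants gives an equivalent inner product, for which \<open>A2 \<Omega>\<close> is complete
  as well.\<close>

lemma weighted_riesz_representation:
  assumes W: "bounded_weight \<Omega> M W" "\<And>z. z \<in> \<Omega> \<Longrightarrow> W z \<ge> m" "m > 0"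
    and l_add: "\<And>f g. f \<in> A2 \<Omega> \<Longrightarrow> g \<in> A2 \<Omega> \<Longrightarrow> l (\<lambda>z. f z + g z) = l f + l g"
    and l_scale: "\<And>c f. f \<in> A2 \<Omega> \<Longrightarrow> l (\<lambda>z. c * f z) = c * l f"
    and l_bound: "\<And>f. f \<in> A2 \<Omega> \<Longrightarrow> norm (l f) \<le> B * l2norm \<Omega> f"
  shows "\<exists>g\<in>A2 \<Omega>. \<forall>f\<in>A2 \<Omega>. l f = weighted_inner \<Omega> W f g"
proof (rule riesz_representation[where M = "B\<^sup>2 / m" and ip = "weighted_inner \<Omega> W" and V = "A2 \<Omega>" and l = l])
  define M' where "M' = \<bar>M\<bar> + 1"
  have W': "bounded_weight \<Omega> M' W" using W(1) by (force simp: bounded_weight_def M'_def)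
  have lower: "m * (l2norm \<Omega> f)\<^sup>2 \<le> Re (weighted_inner \<Omega> W f f)" if "f \<in> A2 \<Omega>" for f
    using W that by (intro weighted_inner_self_ge) auto
  have upper: "Re (weighted_inner \<Omega> W f f) \<le> M' * (l2norm \<Omega> f)\<^sup>2" if "f \<in> A2 \<Omega>" for f
    using weighted_inner_bound[OF that that W'] complex_Re_le_cmod[of "weighted_inner \<Omega> W f f"]
    by (simp add: M'_def power2_eq_square)
  show "0 \<le> Re (weighted_inner \<Omega> W f f)" if "f \<in> A2 \<Omega>" for f
    using lower[OF that] W(3) by (meson mult_nonneg_nonneg less_imp_le order_trans zero_le_power2)
  show "(norm (l f))\<^sup>2 \<le> B\<^sup>2 / m * Re (weighted_inner \<Omega> W f f)" if f: "f \<in> A2 \<Omega>" for f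
  proof -
    have "(norm (l f))\<^sup>2 \<le> (B * l2norm \<Omega> f)\<^sup>2" using l_bound[OF f] by (intro power_mono) auto
    also have "\<dots> = B\<^sup>2 / m * (m * (l2norm \<Omega> f)\<^sup>2)" using W(3) by (simp add: power_mult_distrib)
    also have "\<dots> \<le> B\<^sup>2 / m * Re (weighted_inner \<Omega> W f f)"
      using W(3) lower[OF f] by (intro mult_left_mono) auto
    finally show ?thesis .
  qed
  show "0 \<le> B\<^sup>2 / m" using W(3) by simp
  fix X :: "nat \<Rightarrow> complex ^ 'n \<Rightarrow> complex"
  assume X: "\<And>n. X n \<in> A2 \<Omega>"
    and C: "\<And>e. e > 0 \<Longrightarrow> \<exists>n0. \<forall>m\<ge>n0. \<forall>n\<ge>n0.
        Re (weighted_inner \<Omega> W (\<lambda>x. X m x - X n x) (\<lambda>x. X m x - X n x)) < e"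
  have "\<exists>g\<in>A2 \<Omega>. (\<lambda>n. l2norm \<Omega> (\<lambda>z. X n z - g z)) \<longlonglongrightarrow> 0"
  proof (rule A2_complete[OF X])
    fix e :: real assume "e > 0"
    then obtain n0 where n0: "\<And>i j. i \<ge> n0 \<Longrightarrow> j \<ge> n0 \<Longrightarrow>
        Re (weighted_inner \<Omega> W (\<lambda>x. X i x - X j x) (\<lambda>x. X i x - X j x)) < m * e\<^sup>2"
      using C[of "m * e\<^sup>2"] W(3) by auto
    have "l2norm \<Omega> (\<lambda>z. X i z - X j z) < e" if "i \<ge> n0" "j \<ge> n0" for i j
    proof (rule power2_less_imp_less)
      have "m * (l2norm \<Omega> (\<lambda>z. X i z - X j z))\<^sup>2 < m * e\<^sup>2"
        using lower[OF A2_diff[OF X X, of i j]] n0[OF that] by simp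
      then show "(l2norm \<Omega> (\<lambda>z. X i z - X j z))\<^sup>2 < e\<^sup>2" using W(3) by simp
    qed (use \<open>e > 0\<close> in simp)
    then show "\<exists>n0. \<forall>m\<ge>n0. \<forall>n\<ge>n0. l2norm \<Omega> (\<lambda>z. X m z - X n z) < e" by blast
  qed
  then obtain g where g: "g \<in> A2 \<Omega>" "(\<lambda>n. l2norm \<Omega> (\<lambda>z. X n z - g z)) \<longlonglongrightarrow> 0" by blast
  have "(\<lambda>n. Re (weighted_inner \<Omega> W (\<lambda>x. X n x - g x) (\<lambda>x. X n x - g x))) \<longlonglongrightarrow> 0"
  proof (rule tendsto_sandwich[where f = "\<lambda>_. 0" and h = "\<lambda>n. M' * (l2norm \<Omega> (\<lambda>z. X n z - g z))\<^sup>2"])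
    have "(\<lambda>n. M' * (l2norm \<Omega> (\<lambda>z. X n z - g z))\<^sup>2) \<longlonglongrightarrow> M' * 0\<^sup>2"
      by (intro tendsto_intros g)
    then show "(\<lambda>n. M' * (l2norm \<Omega> (\<lambda>z. X n z - g z))\<^sup>2) \<longlonglongrightarrow> 0" by simp
    show "(\<lambda>n. 0) \<longlonglongrightarrow> (0::real)" by simp
    show "\<forall>\<^sub>F n in sequentially. 0 \<le> Re (weighted_inner \<Omega> W (\<lambda>x. X n x - g x) (\<lambda>x. X n x - g x))"
      using lower[OF A2_diff[OF X g(1)]] W(3)
      by (intro always_eventually allI) (meson mult_nonneg_nonneg less_imp_le order_trans zero_le_power2)
    show "\<forall>\<^sub>F n in sequentially. Re (weighted_inner \<Omega> W (\<lambda>x. X n x - g x) (\<lambda>x. X n x - g x))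
        \<le> M' * (l2norm \<Omega> (\<lambda>z. X n z - g z))\<^sup>2"
      using upper[OF A2_diff[OF X g(1)]] by (intro always_eventually allI)
  qed
  then show "\<exists>g\<in>A2 \<Omega>. (\<lambda>n. Re (weighted_inner \<Omega> W (\<lambda>x. X n x - g x) (\<lambda>x. X n x - g x))) \<longlonglongrightarrow> 0"
    using g(1) by blast
qed ((rule A2_zero A2_add A2_scale weighted_inner_add_left[OF _ _ _ W(1)] weighted_inner_scale_left
    weighted_inner_cnj l_add l_scale; assumption)+)

end

section \<open>Gevrey bounds for recursions of Leibniz type\<close>

text \<open>Pascal's rule in the form of one step of the Leibniz formula: \<open>F j k\<close> stands for a product of a \<open>j\<close>-th and
  a \<open>k\<close>-th derivative.\<close>

lemma sum_binomial_leibniz_step: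
  fixes F :: "nat \<Rightarrow> nat \<Rightarrow> 'a::comm_ring_1"
  shows "(\<Sum>j\<le>\<mu>. of_nat (\<mu> choose j) * (F (Suc j) (\<mu> - j) + F j (Suc (\<mu> - j))))
    = (\<Sum>j\<le>Suc \<mu>. of_nat (Suc \<mu> choose j) * F j (Suc \<mu> - j))"
proof -
  have "(\<Sum>j\<le>Suc \<mu>. of_nat (Suc \<mu> choose j) * F j (Suc \<mu> - j))
      = F 0 (Suc \<mu>) + (\<Sum>j\<le>\<mu>. of_nat (Suc \<mu> choose Suc j) * F (Suc j) (\<mu> - j))"
    by (subst sum.atMost_Suc_shift) simp
  also have "\<dots> = (F 0 (Suc \<mu>) + (\<Sum>j\<le>\<mu>. of_nat (\<mu> choose Suc j) * F (Suc j) (\<mu> - j)))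
      + (\<Sum>j\<le>\<mu>. of_nat (\<mu> choose j) * F (Suc j) (\<mu> - j))"
    by (simp add: algebra_simps sum.distrib)
  also have "F 0 (Suc \<mu>) + (\<Sum>j\<le>\<mu>. of_nat (\<mu> choose Suc j) * F (Suc j) (\<mu> - j))
      = (\<Sum>j\<le>Suc \<mu>. of_nat (\<mu> choose j) * F j (Suc \<mu> - j))"
    by (subst sum.atMost_Suc_shift) simp
  also have "\<dots> = (\<Sum>j\<le>\<mu>. of_nat (\<mu> choose j) * F j (Suc (\<mu> - j)))"
    by (simp add: Suc_diff_le binomial_eq_0)
  finally show ?thesis by (simp add: algebra_simps sum.distrib)
qed

lemma binomial_fact_powr_le:
  assumes "s \<ge> 1" "j \<le> \<mu>"
  shows "real (\<mu> choose j) * (fact (\<mu> - j) powr s * fact j powr s) \<le> fact \<mu> powr s"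
proof -
  have c: "real (\<mu> choose j) \<ge> 1" using assms by (simp add: Suc_le_eq)
  have "fact \<mu> = fact j * fact (\<mu> - j) * real (\<mu> choose j)"
    using binomial_fact_lemma[OF assms(2)] by (metis of_nat_fact of_nat_mult)
  then have "fact \<mu> powr s = real (\<mu> choose j) powr s * (fact (\<mu> - j) powr s * fact j powr s)"
    by (simp add: powr_mult mult_ac)
  moreover have "real (\<mu> choose j) \<le> real (\<mu> choose j) powr s"
    using powr_mono[of 1 s "real (\<mu> choose j)"] assms(1) c by simp
  ultimately show ?thesis by (simp add: mult_right_mono)
qed

text \<open>The constant \<open>R (1 + C)\<close> is chosen such that the geometric sum
  \<open>C \<Sum>j<\<mu>. (1 + C)\<^sup>j = (1 + C)\<^sup>\<mu> - 1\<close> reproduces the bound. The factorials are absorbed by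
  \<open>binomial_fact_powr_le\<close>, which is where \<open>s \<ge> 1\<close> enters.\<close>

lemma gevrey_bound_if_recursion:
  fixes a :: "nat \<Rightarrow> real"
  assumes "A \<ge> 0" "C \<ge> 0" "R > 0" "s \<ge> 1"
    and a0: "a 0 \<le> A"
    and rec: "\<And>\<mu>. \<mu> > 0 \<Longrightarrow> a \<mu> \<le> (\<Sum>j<\<mu>. real (\<mu> choose j) * (C * R ^ (\<mu> - j) * fact (\<mu> - j) powr s) * a j)"
  shows "a \<mu> \<le> A * (R * (1 + C)) ^ \<mu> * fact \<mu> powr s"
proof (induction \<mu> rule: less_induct)
  case (less \<mu>)
  show ?case
  proof (cases "\<mu> = 0")
    case True
    then show ?thesis using a0 by simp
  next
    case False
    have "real (\<mu> choose j) * (C * R ^ (\<mu> - j) * fact (\<mu> - j) powr s) * a j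
        \<le> A * R ^ \<mu> * fact \<mu> powr s * (C * (1 + C) ^ j)" if "j < \<mu>" for j
    proof -
      have "real (\<mu> choose j) * (C * R ^ (\<mu> - j) * fact (\<mu> - j) powr s) * a j
          \<le> real (\<mu> choose j) * (C * R ^ (\<mu> - j) * fact (\<mu> - j) powr s) * (A * (R * (1 + C)) ^ j * fact j powr s)"
        using assms less.IH[OF that] by (intro mult_left_mono) auto
      also have "\<dots> = (real (\<mu> choose j) * (fact (\<mu> - j) powr s * fact j powr s)) * (A * C * (1 + C) ^ j * (R ^ (\<mu> - j) * R ^ j))"
        by (simp add: power_mult_distrib)
      also have "\<dots> \<le> fact \<mu> powr s * (A * C * (1 + C) ^ j * (R ^ (\<mu> - j) * R ^ j))"
        using assms that by (intro mult_right_mono binomial_fact_powr_le) auto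
      also have "R ^ (\<mu> - j) * R ^ j = R ^ \<mu>"
        using that by (simp flip: power_add)
      finally show ?thesis by (simp add: mult_ac)
    qed
    then have "a \<mu> \<le> (\<Sum>j<\<mu>. A * R ^ \<mu> * fact \<mu> powr s * (C * (1 + C) ^ j))"
      using False by (intro order_trans[OF rec] sum_mono) auto
    also have "\<dots> = A * R ^ \<mu> * fact \<mu> powr s * ((1 + C - 1) * (\<Sum>j<\<mu>. (1 + C) ^ j))"
      by (simp add: sum_distrib_left)
    also have "\<dots> = A * R ^ \<mu> * fact \<mu> powr s * ((1 + C) ^ \<mu> - 1)"
      by (simp only: power_diff_1_eq)
    also have "\<dots> \<le> A * R ^ \<mu> * fact \<mu> powr s * (1 + C) ^ \<mu>"
      using assms by (intro mult_left_mono) auto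
    finally show ?thesis by (simp add: power_mult_distrib mult_ac)
  qed
qed

text \<open>If \<open>p j\<close> is the \<open>j\<close>-th derivative of a function at a point, then these are the derivatives of
  the exponential of its negative there, obtained by applying Leibniz' rule to \<open>(e\<^sup>-\<^sup>p)' = - p' e\<^sup>-\<^sup>p\<close>.\<close>

fun exp_neg_derivs :: "(nat \<Rightarrow> real) \<Rightarrow> nat \<Rightarrow> real" where
  "exp_neg_derivs p 0 = exp (- p 0)"
| "exp_neg_derivs p (Suc k) = - (\<Sum>j\<le>k. real (k choose j) * (p (Suc j) * exp_neg_derivs p (k - j)))"

lemma exp_neg_derivs_has_derivative:
  assumes "\<And>j. ((\<lambda>\<tau>. p \<tau> j) has_real_derivative p t (Suc j)) (at t)"
  shows "((\<lambda>\<tau>. exp_neg_derivs (p \<tau>) k) has_real_derivative exp_neg_derivs (p t) (Suc k)) (at t)"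
proof (induction k rule: less_induct)
  case (less k)
  show ?case
  proof (cases k)
    case 0
    have "((\<lambda>\<tau>. exp (- p \<tau> 0)) has_real_derivative exp (- p t 0) * (- p t (Suc 0))) (at t)"
      by (intro DERIV_chain2[OF DERIV_exp] DERIV_minus assms)
    then show ?thesis using 0 by (simp add: mult.commute)
  next
    case (Suc k')
    define F where "F j i = p t (Suc j) * exp_neg_derivs (p t) i" for j i
    have "((\<lambda>\<tau>. p \<tau> (Suc j) * exp_neg_derivs (p \<tau>) (k' - j)) has_real_derivative
        F (Suc j) (k' - j) + F j (Suc (k' - j))) (at t)" for j
    proof -
      have "((\<lambda>\<tau>. p \<tau> (Suc j) * exp_neg_derivs (p \<tau>) (k' - j)) has_real_derivative
          p t (Suc (Suc j)) * exp_neg_derivs (p t) (k' - j) + exp_neg_derivs (p t) (Suc (k' - j)) * p t (Suc j)) (at t)"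
        using Suc by (intro DERIV_mult assms less.IH) auto
      then show ?thesis by (simp only: F_def mult.commute)
    qed
    then have "((\<lambda>\<tau>. exp_neg_derivs (p \<tau>) k) has_real_derivative
        - (\<Sum>j\<le>k'. real (k' choose j) * (F (Suc j) (k' - j) + F j (Suc (k' - j))))) (at t)"
      unfolding Suc exp_neg_derivs.simps by (intro DERIV_minus DERIV_sum DERIV_cmult)
    also have "- (\<Sum>j\<le>k'. real (k' choose j) * (F (Suc j) (k' - j) + F j (Suc (k' - j)))) = exp_neg_derivs (p t) (Suc k)"
      unfolding Suc exp_neg_derivs.simps(2)[of "p t" "Suc k'"]
      using sum_binomial_leibniz_step[of k' F] by (simp only: F_def)
    finally show ?thesis .
  qed
qed

lemma exp_neg_derivs_continuous:
  assumes "\<And>j. continuous_on X (\<lambda>z. p z j)"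
  shows "continuous_on X (\<lambda>z. exp_neg_derivs (p z) k)"
proof (induction k rule: less_induct)
  case (less k)
  show ?case
  proof (cases k)
    case 0
    then show ?thesis using assms by (auto intro!: continuous_intros)
  next
    case (Suc k')
    have "continuous_on X (\<lambda>z. exp_neg_derivs (p z) (k' - j))" for j
      using Suc by (intro less.IH) auto
    then show ?thesis
      unfolding Suc exp_neg_derivs.simps
      by (intro continuous_on_minus continuous_on_sum continuous_on_mult continuous_on_const assms)
  qed
qed

lemma exp_neg_derivs_gevrey:
  assumes "C \<ge> 0" "R > 0" "s \<ge> 1" and p: "\<And>j. \<bar>p j\<bar> \<le> C * R ^ j * fact j powr s"
  shows "\<bar>exp_neg_derivs p k\<bar> \<le> exp C * (R * (1 + C)) ^ k * fact k powr s"
proof (rule gevrey_bound_if_recursion)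
  show "\<bar>exp_neg_derivs p 0\<bar> \<le> exp C" using p[of 0] by simp
  fix k :: nat assume "k > 0"
  then obtain k' where k: "k = Suc k'" by (cases k) auto
  have "\<bar>exp_neg_derivs p k\<bar> \<le> (\<Sum>j<Suc k'. \<bar>real (k' choose j) * (p (Suc j) * exp_neg_derivs p (k' - j))\<bar>)"
    unfolding k exp_neg_derivs.simps abs_minus_cancel lessThan_Suc_atMost by (rule sum_abs)
  also have "\<dots> \<le> (\<Sum>j<Suc k'. real (k choose (k' - j)) * (C * R ^ (k - (k' - j)) * fact (k - (k' - j)) powr s) * \<bar>exp_neg_derivs p (k' - j)\<bar>)"
  proof (rule sum_mono)
    fix j assume "j \<in> {..<Suc k'}"
    then have j: "j \<le> k'" by auto
    then have kj: "k - (k' - j) = Suc j" using k by auto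
    \<comment> \<open>The recursion for the derivative of order \<open>k' + 1\<close> has the binomial coefficients of order \<open>k'\<close>.\<close>
    have "real (k' choose j) \<le> real (k choose (k' - j))"
    proof -
      have "k' choose j = k' choose (k' - j)" by (rule binomial_symmetric[OF j])
      also have "\<dots> \<le> k choose (k' - j)" unfolding k by (rule binomial_right_mono) simp
      finally show ?thesis by simp
    qed
    then have "real (k' choose j) * \<bar>p (Suc j)\<bar> \<le> real (k choose (k' - j)) * (C * R ^ Suc j * fact (Suc j) powr s)"
      using p[of "Suc j"] by (intro mult_mono) auto
    then have "real (k' choose j) * \<bar>p (Suc j)\<bar> * \<bar>exp_neg_derivs p (k' - j)\<bar>
        \<le> real (k choose (k' - j)) * (C * R ^ Suc j * fact (Suc j) powr s) * \<bar>exp_neg_derivs p (k' - j)\<bar>"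
      by (rule mult_right_mono) simp
    then show "\<bar>real (k' choose j) * (p (Suc j) * exp_neg_derivs p (k' - j))\<bar>
        \<le> real (k choose (k' - j)) * (C * R ^ (k - (k' - j)) * fact (k - (k' - j)) powr s) * \<bar>exp_neg_derivs p (k' - j)\<bar>"
      by (simp only: kj abs_mult abs_of_nat mult.assoc)
  qed
  also have "\<dots> = (\<Sum>j<Suc k'. real (k choose j) * (C * R ^ (k - j) * fact (k - j) powr s) * \<bar>exp_neg_derivs p j\<bar>)"
    using sum.nat_diff_reindex[of "\<lambda>j. real (k choose j) * (C * R ^ (k - j) * fact (k - j) powr s) * \<bar>exp_neg_derivs p j\<bar>" "Suc k'"]
    by simp
  finally show "\<bar>exp_neg_derivs p k\<bar> \<le> (\<Sum>j<k. real (k choose j) * (C * R ^ (k - j) * fact (k - j) powr s) * \<bar>exp_neg_derivs p j\<bar>)"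
    by (simp add: k)
qed (use assms in auto)

section \<open>Differentiating the reproducing property\<close>

context
  fixes \<Omega> :: "(complex ^ 'n) set"
  assumes open_\<Omega>: "open \<Omega>"
begin

text \<open>The formal \<open>\<mu>\<close>-th derivative of the inner product of \<open>f\<close> and \<open>u 0\<close> in the weight \<open>E 0\<close>, when \<open>E k\<close> and
  \<open>u j\<close> stand for the derivatives of \<open>E 0\<close> and \<open>u 0\<close> and \<open>f\<close> is constant.\<close>

definition moment_sum ::
    "(nat \<Rightarrow> complex ^ 'n \<Rightarrow> real) \<Rightarrow> (nat \<Rightarrow> complex ^ 'n \<Rightarrow> complex) \<Rightarrow> nat \<Rightarrow> (complex ^ 'n \<Rightarrow> complex) \<Rightarrow> complex"
where
  "moment_sum E u \<mu> f = (\<Sum>j\<le>\<mu>. of_nat (\<mu> choose j) * weighted_inner \<Omega> (E (\<mu> - j)) f (u j))"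

lemma moment_sum_split:
  "moment_sum E u \<mu> f = (\<Sum>j<\<mu>. of_nat (\<mu> choose j) * weighted_inner \<Omega> (E (\<mu> - j)) f (u j))
     + weighted_inner \<Omega> (E 0) f (u \<mu>)"
  by (simp add: moment_sum_def flip: lessThan_Suc_atMost)

lemma l2norm_le_if_coercive:
  assumes f: "f \<in> A2 \<Omega>" and W: "bounded_weight \<Omega> M W" "\<And>z. z \<in> \<Omega> \<Longrightarrow> W z \<ge> m" "m > 0"
    and le: "norm (weighted_inner \<Omega> W f f) \<le> Q * l2norm \<Omega> f" and "Q \<ge> 0"
  shows "l2norm \<Omega> f \<le> Q / m"
proof (cases "l2norm \<Omega> f = 0")
  case True
  then show ?thesis using assms by simp
next
  case False
  then have pos: "l2norm \<Omega> f > 0" using l2norm_nonneg[OF open_\<Omega>, of f] by simp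
  have "m * (l2norm \<Omega> f)\<^sup>2 \<le> Q * l2norm \<Omega> f"
    using weighted_inner_self_ge[OF open_\<Omega> f W(1,2)] W(3) complex_Re_le_cmod[of "weighted_inner \<Omega> W f f"] le
    by linarith
  then have "(m * l2norm \<Omega> f) * l2norm \<Omega> f \<le> Q * l2norm \<Omega> f"
    by (simp add: power2_eq_square mult.assoc)
  then have "m * l2norm \<Omega> f \<le> Q" using pos by simp
  then show ?thesis using W(3) by (simp add: field_simps)
qed

text \<open>In \<open>moment_sum E u \<mu> f\<close> the unknown \<open>u \<mu>\<close> occurs only in the term with the weight \<open>E 0\<close>; the other terms
  form a bounded functional of \<open>f\<close>.\<close>

lemma moment_solution_exists:
  assumes W: "\<And>k. bounded_weight \<Omega> (\<beta> k) (E k)" and \<beta>: "\<And>k. \<beta> k \<ge> 0"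
    and m: "\<And>z. z \<in> \<Omega> \<Longrightarrow> E 0 z \<ge> m" "m > 0" and u0: "u0 \<in> A2 \<Omega>"
  shows "\<exists>u. u 0 = u0 \<and> (\<forall>\<mu>. u \<mu> \<in> A2 \<Omega>) \<and> (\<forall>\<mu>>0. \<forall>f\<in>A2 \<Omega>. moment_sum E u \<mu> f = 0)"
proof -
  define P where "P v \<mu> r \<longleftrightarrow> r \<in> A2 \<Omega> \<and> (\<mu> = 0 \<longrightarrow> r = u0) \<and> (\<mu> > 0 \<longrightarrow> (\<forall>f\<in>A2 \<Omega>.
      (\<Sum>j<\<mu>. of_nat (\<mu> choose j) * weighted_inner \<Omega> (E (\<mu> - j)) f (v j)) + weighted_inner \<Omega> (E 0) f r = 0))"
    for v :: "nat \<Rightarrow> complex ^ 'n \<Rightarrow> complex" and \<mu> :: nat and r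
  have "\<exists>u. \<forall>\<mu>. P u \<mu> (u \<mu>)"
  proof (rule dependent_wellorder_choice)
    show "P f x r = P g x r" if "\<And>y. y < x \<Longrightarrow> f y = g y" for r f g x
      using that by (simp add: P_def)
    fix \<mu> and v :: "nat \<Rightarrow> complex ^ 'n \<Rightarrow> complex" assume IH: "\<And>j. j < \<mu> \<Longrightarrow> P v j (v j)"
    then have v: "v j \<in> A2 \<Omega>" if "j < \<mu>" for j using that by (auto simp: P_def)
    show "\<exists>r. P v \<mu> r"
    proof (cases "\<mu> = 0")
      case True
      then show ?thesis using u0 by (auto simp: P_def)
    next
      case False
      define l where "l f = - (\<Sum>j<\<mu>. of_nat (\<mu> choose j) * weighted_inner \<Omega> (E (\<mu> - j)) f (v j))" for f
      have "\<exists>g\<in>A2 \<Omega>. \<forall>f\<in>A2 \<Omega>. l f = weighted_inner \<Omega> (E 0) f g"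
      proof (rule weighted_riesz_representation[OF open_\<Omega> W m])
        show "l (\<lambda>z. f z + g z) = l f + l g" if "f \<in> A2 \<Omega>" "g \<in> A2 \<Omega>" for f g
          using that v W
          by (simp add: l_def weighted_inner_add_left[OF open_\<Omega> that v W] distrib_left sum.distrib)
        show "l (\<lambda>z. c * f z) = c * l f" if "f \<in> A2 \<Omega>" for c f
          by (simp add: l_def weighted_inner_scale_left[OF open_\<Omega>] sum_distrib_left mult_ac)
        show "norm (l f) \<le> (\<Sum>j<\<mu>. real (\<mu> choose j) * (\<beta> (\<mu> - j) * l2norm \<Omega> (v j))) * l2norm \<Omega> f"
          if f: "f \<in> A2 \<Omega>" for f
        proof -
          have "norm (l f) \<le> (\<Sum>j<\<mu>. norm (of_nat (\<mu> choose j) * weighted_inner \<Omega> (E (\<mu> - j)) f (v j)))"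
            unfolding l_def norm_minus_cancel by (rule norm_sum)
          also have "\<dots> \<le> (\<Sum>j<\<mu>. real (\<mu> choose j) * (\<beta> (\<mu> - j) * (l2norm \<Omega> f * l2norm \<Omega> (v j))))"
            using weighted_inner_bound[OF open_\<Omega> f v W \<beta>]
            by (intro sum_mono) (auto simp: norm_mult intro!: mult_left_mono)
          also have "\<dots> = (\<Sum>j<\<mu>. real (\<mu> choose j) * (\<beta> (\<mu> - j) * l2norm \<Omega> (v j))) * l2norm \<Omega> f"
            unfolding sum_distrib_right by (simp only: mult_ac)
          finally show ?thesis .
        qed
      qed
      then obtain g where g: "g \<in> A2 \<Omega>" "\<And>f. f \<in> A2 \<Omega> \<Longrightarrow> l f = weighted_inner \<Omega> (E 0) f g" by blast
      have "P v \<mu> g"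
        using False g by (auto simp: P_def l_def simp flip: g(2))
      then show ?thesis by blast
    qed
  qed
  then obtain u where "\<And>\<mu>. P u \<mu> (u \<mu>)" by blast
  then show ?thesis
    by (intro exI[of _ u]) (simp add: P_def moment_sum_split)
qed

text \<open>Testing the \<open>\<mu>\<close>-th equation with \<open>f = u \<mu>\<close> turns the system into a recursive inequality for the norms.\<close>

lemma moment_solution_gevrey_bound:
  assumes W: "\<And>k. bounded_weight \<Omega> (A * L ^ k * fact k powr s) (E k)"
    and m: "\<And>z. z \<in> \<Omega> \<Longrightarrow> E 0 z \<ge> m" "m > 0" and "A \<ge> 0" "L > 0" "s \<ge> 1"
    and u: "\<And>\<mu>. u \<mu> \<in> A2 \<Omega>" and l0: "norm (moment_sum E u 0 (u 0)) \<le> B * l2norm \<Omega> (u 0)" "B \<ge> 0"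
    and mom: "\<And>\<mu> f. \<mu> > 0 \<Longrightarrow> f \<in> A2 \<Omega> \<Longrightarrow> moment_sum E u \<mu> f = 0"
  shows "l2norm \<Omega> (u \<mu>) \<le> B / m * (L * (1 + A / m)) ^ \<mu> * fact \<mu> powr s"
proof (rule gevrey_bound_if_recursion[where a = "\<lambda>\<mu>. l2norm \<Omega> (u \<mu>)"])
  show "l2norm \<Omega> (u 0) \<le> B / m"
    using l0 by (intro l2norm_le_if_coercive[OF u W m]) (simp_all add: moment_sum_def)
  fix \<mu> :: nat assume "\<mu> > 0"
  define Q where "Q = (\<Sum>j<\<mu>. real (\<mu> choose j) * (A * L ^ (\<mu> - j) * fact (\<mu> - j) powr s * l2norm \<Omega> (u j)))"
  have "l2norm \<Omega> (u \<mu>) \<le> Q / m"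
  proof (rule l2norm_le_if_coercive[OF u W m])
    have "weighted_inner \<Omega> (E 0) (u \<mu>) (u \<mu>)
        = - (\<Sum>j<\<mu>. of_nat (\<mu> choose j) * weighted_inner \<Omega> (E (\<mu> - j)) (u \<mu>) (u j))"
      using mom[OF \<open>\<mu> > 0\<close> u[of \<mu>]] unfolding moment_sum_split by (simp add: eq_neg_iff_add_eq_0 add.commute)
    then have "norm (weighted_inner \<Omega> (E 0) (u \<mu>) (u \<mu>))
        \<le> (\<Sum>j<\<mu>. norm (of_nat (\<mu> choose j) * weighted_inner \<Omega> (E (\<mu> - j)) (u \<mu>) (u j)))"
      by (simp only: norm_minus_cancel norm_sum)
    also have "\<dots> \<le> (\<Sum>j<\<mu>. real (\<mu> choose j) * (A * L ^ (\<mu> - j) * fact (\<mu> - j) powr s * (l2norm \<Omega> (u \<mu>) * l2norm \<Omega> (u j))))"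
      unfolding norm_mult norm_of_nat using assms
      by (intro sum_mono mult_left_mono weighted_inner_bound[OF open_\<Omega> u u W]) auto
    also have "\<dots> = Q * l2norm \<Omega> (u \<mu>)"
      unfolding Q_def sum_distrib_right by (simp only: mult_ac)
    finally show "norm (weighted_inner \<Omega> (E 0) (u \<mu>) (u \<mu>)) \<le> Q * l2norm \<Omega> (u \<mu>)" .
    show "Q \<ge> 0"
      unfolding Q_def using assms l2norm_nonneg[OF open_\<Omega>] by (intro sum_nonneg mult_nonneg_nonneg) auto
  qed
  also have "Q / m = (\<Sum>j<\<mu>. real (\<mu> choose j) * (A / m * L ^ (\<mu> - j) * fact (\<mu> - j) powr s) * l2norm \<Omega> (u j))"
    unfolding Q_def sum_divide_distrib by (intro sum.cong) (simp_all add: field_simps)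
  finally show "l2norm \<Omega> (u \<mu>) \<le> (\<Sum>j<\<mu>. real (\<mu> choose j) * (A / m * L ^ (\<mu> - j) * fact (\<mu> - j) powr s) * l2norm \<Omega> (u j))" .
qed (use assms in auto)

text \<open>This shows that \<open>u (Suc \<mu>)\<close> is the derivative of \<open>u \<mu>\<close>. Expand every summand of the \<open>\<mu>\<close>-th equation at \<open>t\<close>
  around \<open>t0\<close>. The terms of order zero give the equation at \<open>t0\<close> with the same right-hand side; the terms
  of order one give the equation for \<open>Suc \<mu>\<close>. Hence the remainders \<open>X j\<close> satisfy an equation whose
  other terms are of order two, and the claim follows by induction on \<open>\<mu>\<close> and coercivity of \<open>E 0\<close>.\<close>

lemma moment_solution_quadratic_remainder:
  fixes E :: "nat \<Rightarrow> real \<Rightarrow> complex ^ 'n \<Rightarrow> real" and u :: "nat \<Rightarrow> real \<Rightarrow> complex ^ 'n \<Rightarrow> complex"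
  assumes J: "J = {t0-\<delta>..t0+\<delta>}" "0 < \<delta>" "\<delta> \<le> 1"
    and W: "\<And>k t. t \<in> J \<Longrightarrow> bounded_weight \<Omega> (\<beta> k) (E k t)" and \<beta>: "\<And>k. \<beta> k \<ge> 0"
    and m: "\<And>t z. t \<in> J \<Longrightarrow> z \<in> \<Omega> \<Longrightarrow> E 0 t z \<ge> m" "m > 0"
    and der: "\<And>k t z. t \<in> J \<Longrightarrow> z \<in> \<Omega> \<Longrightarrow> ((\<lambda>\<tau>. E k \<tau> z) has_real_derivative E (Suc k) t z) (at t)"
    and u: "\<And>\<mu> t. t \<in> J \<Longrightarrow> u \<mu> t \<in> A2 \<Omega>"
    and mom0: "\<And>t f. t \<in> J \<Longrightarrow> f \<in> A2 \<Omega> \<Longrightarrow> moment_sum (\<lambda>k. E k t) (\<lambda>j. u j t) 0 f = l f"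
    and mom: "\<And>\<mu> t f. t \<in> J \<Longrightarrow> \<mu> > 0 \<Longrightarrow> f \<in> A2 \<Omega> \<Longrightarrow> moment_sum (\<lambda>k. E k t) (\<lambda>j. u j t) \<mu> f = 0"
  shows "\<exists>C. \<forall>t\<in>J. l2norm \<Omega> (\<lambda>z. u \<mu> t z - u \<mu> t0 z - of_real (t - t0) * u (Suc \<mu>) t0 z) \<le> C * (t - t0)\<^sup>2"
proof (induction \<mu> rule: less_induct)
  case (less \<mu>)
  define X where "X j t z = u j t z - u j t0 z - of_real (t - t0) * u (Suc j) t0 z" for j t z
  define Y where "Y k t z = E k t z - E k t0 z - (t - t0) * E (Suc k) t0 z" for k t z
  define N where "N j = l2norm \<Omega> (u j t0)" for j
  have N: "N j \<ge> 0" for j unfolding N_def by (rule l2norm_nonneg[OF open_\<Omega>])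
  have t0: "t0 \<in> J" using J by simp
  have XA: "X j t \<in> A2 \<Omega>" if "t \<in> J" for j t
    unfolding X_def by (intro A2_diff[OF open_\<Omega>] A2_scale[OF open_\<Omega>] u that t0)
  have YW: "bounded_weight \<Omega> (\<beta> (Suc (Suc k)) * (t - t0)\<^sup>2) (Y k t)" if t: "t \<in> J" for k t
    unfolding bounded_weight_def
  proof (intro conjI ballI)
    show "continuous_on \<Omega> (Y k t)"
      using W[OF t] W[OF t0] unfolding Y_def bounded_weight_def by (intro continuous_intros) auto
    fix z assume z: "z \<in> \<Omega>"
    have "norm (E k t z - E k t0 z - (t - t0) *\<^sub>R E (Suc k) t0 z) \<le> \<beta> (Suc (Suc k)) * (t - t0)\<^sup>2"
    proof (rule quadratic_remainder_if_twice_differentiable[where S = J and k = "\<lambda>t. E (Suc (Suc k)) t z"])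
      show "convex J" using J by simp
      fix \<tau> assume \<tau>: "\<tau> \<in> J"
      show "((\<lambda>t. E k t z) has_vector_derivative E (Suc k) \<tau> z) (at \<tau>)"
        and "((\<lambda>t. E (Suc k) t z) has_vector_derivative E (Suc (Suc k)) \<tau> z) (at \<tau>)"
        using der[OF \<tau> z] by (simp_all add: has_real_derivative_iff_has_vector_derivative)
      show "norm (E (Suc (Suc k)) \<tau> z) \<le> \<beta> (Suc (Suc k))"
        using W[OF \<tau>] z by (simp add: bounded_weight_def)
    qed (use t t0 in auto)
    then show "\<bar>Y k t z\<bar> \<le> \<beta> (Suc (Suc k)) * (t - t0)\<^sup>2" by (simp add: Y_def)
  qed
  \<comment> \<open>The terms of second order in the expansion of the product of \<open>E k\<close> and \<open>u j\<close>, except for the one with \<open>X j\<close>.\<close>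
  define Rem where "Rem j k t f = of_real ((t - t0)\<^sup>2) * weighted_inner \<Omega> (E (Suc k) t0) f (u (Suc j) t0)
      + weighted_inner \<Omega> (Y k t) f (u j t0) + of_real (t - t0) * weighted_inner \<Omega> (Y k t) f (u (Suc j) t0)" for j k t f
  define c where "c j k = \<beta> (Suc k) * N (Suc j) + \<beta> (Suc (Suc k)) * N j + \<beta> (Suc (Suc k)) * N (Suc j)" for j k
  have c: "c j k \<ge> 0" for j k unfolding c_def using N \<beta> by simp
  have Rem: "norm (Rem j k t f) \<le> c j k * (t - t0)\<^sup>2 * l2norm \<Omega> f" if t: "t \<in> J" and f: "f \<in> A2 \<Omega>" for j k t f
  proof -
    have nf: "l2norm \<Omega> f \<ge> 0" by (rule l2norm_nonneg[OF open_\<Omega>])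
    have 1: "norm (weighted_inner \<Omega> (E (Suc k) t0) f (u (Suc j) t0)) \<le> \<beta> (Suc k) * (l2norm \<Omega> f * N (Suc j))"
      unfolding N_def by (rule weighted_inner_bound[OF open_\<Omega> f u[OF t0] W[OF t0] \<beta>])
    have 2: "norm (weighted_inner \<Omega> (Y k t) f (u j' t0)) \<le> \<beta> (Suc (Suc k)) * (t - t0)\<^sup>2 * (l2norm \<Omega> f * N j')" for j'
      unfolding N_def using \<beta> by (intro weighted_inner_bound[OF open_\<Omega> f u[OF t0] YW[OF t]]) auto
    have h: "\<bar>t - t0\<bar> \<le> 1" using t J by auto
    have "norm (Rem j k t f) \<le> (t - t0)\<^sup>2 * norm (weighted_inner \<Omega> (E (Suc k) t0) f (u (Suc j) t0))
        + norm (weighted_inner \<Omega> (Y k t) f (u j t0)) + \<bar>t - t0\<bar> * norm (weighted_inner \<Omega> (Y k t) f (u (Suc j) t0))"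
      unfolding Rem_def by (intro norm_triangle_le add_mono) (simp_all only: norm_mult norm_of_real abs_power2 order_refl)
    also have "\<dots> \<le> (t - t0)\<^sup>2 * (\<beta> (Suc k) * (l2norm \<Omega> f * N (Suc j)))
        + \<beta> (Suc (Suc k)) * (t - t0)\<^sup>2 * (l2norm \<Omega> f * N j)
        + 1 * (\<beta> (Suc (Suc k)) * (t - t0)\<^sup>2 * (l2norm \<Omega> f * N (Suc j)))"
      using 1 2 h by (intro add_mono mult_left_mono mult_mono) auto
    also have "\<dots> = c j k * (t - t0)\<^sup>2 * l2norm \<Omega> f" by (simp add: c_def algebra_simps)
    finally show ?thesis .
  qed
  have expand: "weighted_inner \<Omega> (E k t) f (u j t) = weighted_inner \<Omega> (E k t0) f (u j t0)
      + of_real (t - t0) * (weighted_inner \<Omega> (E k t0) f (u (Suc j) t0) + weighted_inner \<Omega> (E (Suc k) t0) f (u j t0))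
      + (Rem j k t f + weighted_inner \<Omega> (E k t) f (X j t))"
    if t: "t \<in> J" and f: "f \<in> A2 \<Omega>" for j k t f
  proof -
    note in_A2 = u[OF t0] A2_scale[OF open_\<Omega> u[OF t0]] A2_add[OF open_\<Omega>] XA[OF t] f
    define h where "h = complex_of_real (t - t0)"
    have "u j t = (\<lambda>z. (u j t0 z + h * u (Suc j) t0 z) + X j t z)"
      by (auto simp: X_def h_def)
    then have "weighted_inner \<Omega> (E k t) f (u j t) = weighted_inner \<Omega> (E k t) f (\<lambda>z. (u j t0 z + h * u (Suc j) t0 z) + X j t z)"
      by simp
    also have "\<dots> = weighted_inner \<Omega> (E k t) f (\<lambda>z. u j t0 z + h * u (Suc j) t0 z) + weighted_inner \<Omega> (E k t) f (X j t)"
      by (rule weighted_inner_add_right[OF open_\<Omega> _ _ _ W[OF t]]) (intro in_A2)+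
    also have "weighted_inner \<Omega> (E k t) f (\<lambda>z. u j t0 z + h * u (Suc j) t0 z)
        = weighted_inner \<Omega> (E k t) f (u j t0) + h * weighted_inner \<Omega> (E k t) f (u (Suc j) t0)"
      by (subst weighted_inner_add_right[OF open_\<Omega> _ _ _ W[OF t]])
         (intro in_A2 | simp add: weighted_inner_scale_right[OF open_\<Omega>] h_def)+
    finally have 1: "weighted_inner \<Omega> (E k t) f (u j t) = weighted_inner \<Omega> (E k t) f (u j t0)
        + h * weighted_inner \<Omega> (E k t) f (u (Suc j) t0) + weighted_inner \<Omega> (E k t) f (X j t)" .
    have 2: "weighted_inner \<Omega> (E k t) f g = weighted_inner \<Omega> (E k t0) f g + h * weighted_inner \<Omega> (E (Suc k) t0) f g
        + weighted_inner \<Omega> (Y k t) f g" if g: "g \<in> A2 \<Omega>" for g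
    proof -
      have "E k t = (\<lambda>z. (E k t0 z + (t - t0) * E (Suc k) t0 z) + Y k t z)"
        by (auto simp: Y_def)
      then have "weighted_inner \<Omega> (E k t) f g = weighted_inner \<Omega> (\<lambda>z. (E k t0 z + (t - t0) * E (Suc k) t0 z) + Y k t z) f g"
        by simp
      also have "\<dots> = weighted_inner \<Omega> (\<lambda>z. E k t0 z + (t - t0) * E (Suc k) t0 z) f g + weighted_inner \<Omega> (Y k t) f g"
        by (rule weighted_inner_add_weight[OF open_\<Omega> f g bounded_weight_add[OF open_\<Omega> W[OF t0]
              bounded_weight_scale[OF open_\<Omega> W[OF t0]]] YW[OF t]])
      also have "weighted_inner \<Omega> (\<lambda>z. E k t0 z + (t - t0) * E (Suc k) t0 z) f g
          = weighted_inner \<Omega> (E k t0) f g + h * weighted_inner \<Omega> (E (Suc k) t0) f g"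
        unfolding weighted_inner_add_weight[OF open_\<Omega> f g W[OF t0] bounded_weight_scale[OF open_\<Omega> W[OF t0]]]
          weighted_inner_scale_weight[OF open_\<Omega>] h_def ..
      finally show ?thesis .
    qed
    have hh: "complex_of_real ((t - t0)\<^sup>2) = h * h" by (simp add: h_def power2_eq_square)
    show ?thesis
      unfolding 1 2[OF u[OF t0]] Rem_def hh h_def[symmetric] by (simp add: algebra_simps)
  qed
  have key: "weighted_inner \<Omega> (E 0 t) f (X \<mu> t)
      = - (\<Sum>j\<le>\<mu>. of_nat (\<mu> choose j) * Rem j (\<mu> - j) t f)
        - (\<Sum>j<\<mu>. of_nat (\<mu> choose j) * weighted_inner \<Omega> (E (\<mu> - j) t) f (X j t))"
    if t: "t \<in> J" and f: "f \<in> A2 \<Omega>" for t f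
  proof -
    define S where "S = (\<Sum>j\<le>\<mu>. of_nat (\<mu> choose j) * (Rem j (\<mu> - j) t f + weighted_inner \<Omega> (E (\<mu> - j) t) f (X j t)))"
    have same: "moment_sum (\<lambda>k. E k t) (\<lambda>j. u j t) \<mu> f = moment_sum (\<lambda>k. E k t0) (\<lambda>j. u j t0) \<mu> f"
      using mom0[OF t f] mom0[OF t0 f] mom[OF t _ f] mom[OF t0 _ f] by (cases "\<mu> = 0") auto
    have "moment_sum (\<lambda>k. E k t) (\<lambda>j. u j t) \<mu> f = moment_sum (\<lambda>k. E k t0) (\<lambda>j. u j t0) \<mu> f
        + of_real (t - t0) * (\<Sum>j\<le>\<mu>. of_nat (\<mu> choose j) * (weighted_inner \<Omega> (E (\<mu> - j) t0) f (u (Suc j) t0)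
            + weighted_inner \<Omega> (E (Suc (\<mu> - j)) t0) f (u j t0))) + S"
      unfolding moment_sum_def S_def expand[OF t f] sum_distrib_left sum.distrib[symmetric]
      by (intro sum.cong refl) (simp only: algebra_simps)
    also have "(\<Sum>j\<le>\<mu>. of_nat (\<mu> choose j) * (weighted_inner \<Omega> (E (\<mu> - j) t0) f (u (Suc j) t0)
            + weighted_inner \<Omega> (E (Suc (\<mu> - j)) t0) f (u j t0)))
        = moment_sum (\<lambda>k. E k t0) (\<lambda>j. u j t0) (Suc \<mu>) f"
      unfolding moment_sum_def
      using sum_binomial_leibniz_step[of \<mu> "\<lambda>j k. weighted_inner \<Omega> (E k t0) f (u j t0)"] by simp
    also have "\<dots> = 0" using mom[OF t0 _ f] by simp
    finally have "S = 0" using same by simp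
    moreover have "S = (\<Sum>j\<le>\<mu>. of_nat (\<mu> choose j) * Rem j (\<mu> - j) t f)
        + ((\<Sum>j<\<mu>. of_nat (\<mu> choose j) * weighted_inner \<Omega> (E (\<mu> - j) t) f (X j t)) + weighted_inner \<Omega> (E 0 t) f (X \<mu> t))"
      by (simp add: S_def distrib_left sum.distrib flip: lessThan_Suc_atMost)
    ultimately show ?thesis by (simp add: algebra_simps eq_neg_iff_add_eq_0)
  qed
  obtain C where C: "\<And>j t. j < \<mu> \<Longrightarrow> t \<in> J \<Longrightarrow> l2norm \<Omega> (X j t) \<le> C j * (t - t0)\<^sup>2"
    using less.IH unfolding X_def by metis
  have C': "l2norm \<Omega> (X j t) \<le> \<bar>C j\<bar> * (t - t0)\<^sup>2" if "j < \<mu>" "t \<in> J" for j t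
    by (rule order_trans[OF C[OF that] mult_right_mono[OF abs_ge_self zero_le_power2]])
  define Q where "Q = (\<Sum>j\<le>\<mu>. real (\<mu> choose j) * c j (\<mu> - j)) + (\<Sum>j<\<mu>. real (\<mu> choose j) * (\<beta> (\<mu> - j) * \<bar>C j\<bar>))"
  have "l2norm \<Omega> (X \<mu> t) \<le> (Q * (t - t0)\<^sup>2) / m" if t: "t \<in> J" for t
  proof (rule l2norm_le_if_coercive[OF XA[OF t] W[OF t] m(1)[OF t] m(2)])
    let ?f = "X \<mu> t"
    have "norm (weighted_inner \<Omega> (E 0 t) ?f ?f)
        \<le> (\<Sum>j\<le>\<mu>. norm (of_nat (\<mu> choose j) * Rem j (\<mu> - j) t ?f))
          + (\<Sum>j<\<mu>. norm (of_nat (\<mu> choose j) * weighted_inner \<Omega> (E (\<mu> - j) t) ?f (X j t)))"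
      unfolding key[OF t XA[OF t]]
      by (rule order_trans[OF norm_triangle_ineq4]) (simp only: norm_minus_cancel, intro add_mono norm_sum)
    also have "\<dots> \<le> (\<Sum>j\<le>\<mu>. real (\<mu> choose j) * (c j (\<mu> - j) * (t - t0)\<^sup>2 * l2norm \<Omega> ?f))
          + (\<Sum>j<\<mu>. real (\<mu> choose j) * (\<beta> (\<mu> - j) * (l2norm \<Omega> ?f * (\<bar>C j\<bar> * (t - t0)\<^sup>2))))"
      unfolding norm_mult norm_of_nat
    proof (intro add_mono sum_mono mult_left_mono)
      show "norm (Rem j (\<mu> - j) t ?f) \<le> c j (\<mu> - j) * (t - t0)\<^sup>2 * l2norm \<Omega> ?f" for j
        by (rule Rem[OF t XA[OF t]])
      show "norm (weighted_inner \<Omega> (E (\<mu> - j) t) ?f (X j t)) \<le> \<beta> (\<mu> - j) * (l2norm \<Omega> ?f * (\<bar>C j\<bar> * (t - t0)\<^sup>2))"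
        if "j \<in> {..<\<mu>}" for j
        using that C'[of j t] t \<beta> l2norm_nonneg[OF open_\<Omega>]
        by (intro order_trans[OF weighted_inner_bound[OF open_\<Omega> XA[OF t] XA[OF t] W[OF t] \<beta>]] mult_left_mono) auto
    qed auto
    also have "\<dots> = Q * (t - t0)\<^sup>2 * l2norm \<Omega> ?f"
      unfolding Q_def distrib_right sum_distrib_right by (simp only: mult_ac)
    finally show "norm (weighted_inner \<Omega> (E 0 t) ?f ?f) \<le> Q * (t - t0)\<^sup>2 * l2norm \<Omega> ?f" .
    show "0 \<le> Q * (t - t0)\<^sup>2"
      unfolding Q_def using c \<beta> by (intro mult_nonneg_nonneg add_nonneg_nonneg sum_nonneg) auto
  qed
  then show ?case
    unfolding X_def by (intro exI[of _ "Q / m"]) simp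
qed

end

section \<open>Parameter derivatives of functions that are smooth up to the boundary\<close>

lemma dt_0: "dt 0 f p = f p"
  by (simp add: dt_def split: prod.splits)

lemma dt_Suc: "dt (Suc \<mu>) f (x, t) = vector_derivative (\<lambda>\<tau>. dt \<mu> f (x, \<tau>)) (at t)"
  by (simp add: dt_def)

lemma dt_eq_if_derivative_sequence:
  assumes T: "open T"
    and g: "\<And>\<mu> \<tau>. \<tau> \<in> T \<Longrightarrow> (g \<mu> has_vector_derivative g (Suc \<mu>) \<tau>) (at \<tau>)"
    and f: "\<And>\<tau>. \<tau> \<in> T \<Longrightarrow> f (x, \<tau>) = g 0 \<tau>"
  shows "\<tau> \<in> T \<Longrightarrow> dt \<mu> f (x, \<tau>) = g \<mu> \<tau>"
proof (induction \<mu> arbitrary: \<tau>)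
  case 0
  then show ?case using f by (simp add: dt_0)
next
  case (Suc \<mu>)
  have "((\<lambda>\<tau>. dt \<mu> f (x, \<tau>)) has_vector_derivative g (Suc \<mu>) \<tau>) (at \<tau>)"
    using Suc.IH by (intro has_vector_derivative_transform_within_open[OF g[OF Suc.prems] T Suc.prems]) simp
  then show ?case unfolding dt_Suc by (rule vector_derivative_at)
qed

lemma smooth_on_frechet_derivative:
  "smooth_on U F \<Longrightarrow> smooth_on U (\<lambda>p. frechet_derivative F (at p) v)"
  unfolding smooth_on_def by (metis Ck_on.simps(2))

lemma smooth_on_continuous: "smooth_on U F \<Longrightarrow> continuous_on U F"
  unfolding smooth_on_def by (metis Ck_on.simps(1))

lemma smooth_on_vertical_derivative:
  fixes F :: "'a::euclidean_space \<times> real \<Rightarrow> 'b::real_normed_vector"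
  assumes "smooth_on U F" "(x, t) \<in> U"
  shows "((\<lambda>\<tau>. F (x, \<tau>)) has_vector_derivative frechet_derivative F (at (x, t)) (0, 1)) (at t)"
proof -
  have "F differentiable (at (x, t))"
    using assms unfolding smooth_on_def by (metis Ck_on.simps(2))
  then have F: "(F has_derivative frechet_derivative F (at (x, t))) (at (x, t))"
    by (simp add: frechet_derivative_works[symmetric])
  have "((\<lambda>\<tau>. (x, \<tau>)) has_derivative (\<lambda>h. (0, h))) (at t)"
    by (auto intro!: derivative_eq_intros)
  from diff_chain_at[OF this F]
  have "((\<lambda>\<tau>. F (x, \<tau>)) has_derivative (\<lambda>h. frechet_derivative F (at (x, t)) (0, h))) (at t)"
    by (simp only: o_def)
  moreover have eq: "(\<lambda>h. frechet_derivative F (at (x, t)) (0, h)) = (\<lambda>h. h *\<^sub>R frechet_derivative F (at (x, t)) (0, 1))"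
  proof
    fix h :: real
    show "frechet_derivative F (at (x, t)) (0, h) = h *\<^sub>R frechet_derivative F (at (x, t)) (0, 1)"
      using linear_cmul[OF bounded_linear.linear[OF has_derivative_bounded_linear[OF F]], of h "(0, 1)"] by simp
  qed
  ultimately show ?thesis unfolding has_vector_derivative_def by (simp only:)
qed

text \<open>Near \<open>t\<close> the iterated derivatives \<open>dt k \<phi>\<close> are restrictions of iterated Frechet derivatives of a smooth
  extension in the direction \<open>(0, 1)\<close>.\<close>

lemma smooth_on_closure_times_parameter_derivatives:
  fixes \<phi> :: "'a::euclidean_space \<times> real \<Rightarrow> 'b::real_normed_vector"
  assumes sm: "smooth_on_closure_times \<Omega> D \<phi>" and D: "open D" "t \<in> D"
  shows "x \<in> closure \<Omega> \<Longrightarrow> ((\<lambda>\<tau>. dt k \<phi> (x, \<tau>)) has_vector_derivative dt (Suc k) \<phi> (x, t)) (at t)"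
    and "continuous_on (closure \<Omega>) (\<lambda>x. dt k \<phi> (x, t))"
proof -
  obtain e where e: "e > 0" "cball t e \<subseteq> D" using D open_contains_cball by blast
  define T where "T = {t - e<..<t + e}"
  have T: "open T" "t \<in> T" using e by (auto simp: T_def)
  have te: "t - e \<le> t + e \<and> {t - e..t + e} \<subseteq> D" using e by (auto simp: cball_eq_atLeastAtMost)
  obtain U F where UF: "closure \<Omega> \<times> {t - e..t + e} \<subseteq> U" "smooth_on U F"
      "\<forall>p\<in>closure \<Omega> \<times> {t - e..t + e}. F p = \<phi> p"
    using sm[unfolded smooth_on_closure_times_def, rule_format, OF te] by auto
  define G where "G k = ((\<lambda>H p. frechet_derivative H (at p) (0, 1)) ^^ k) F" for k
  have smG: "smooth_on U (G k)" for k
    by (induction k) (simp_all add: G_def UF smooth_on_frechet_derivative)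
  have derG: "((\<lambda>\<tau>. G k (x, \<tau>)) has_vector_derivative G (Suc k) (x, \<tau>)) (at \<tau>)"
    if "x \<in> closure \<Omega>" "\<tau> \<in> T" for x \<tau> k
  proof -
    have "(x, \<tau>) \<in> U" using that UF(1) by (auto simp: T_def)
    from smooth_on_vertical_derivative[OF smG this] show ?thesis
      by (simp only: G_def funpow.simps o_apply)
  qed
  have eq: "dt k \<phi> (x, \<tau>) = G k (x, \<tau>)" if "x \<in> closure \<Omega>" "\<tau> \<in> T" for x \<tau> k
    using that UF(3)
    by (intro dt_eq_if_derivative_sequence[where g = "\<lambda>k \<tau>. G k (x, \<tau>)", OF T(1) derG[OF that(1)]]) (auto simp: G_def T_def)
  show "((\<lambda>\<tau>. dt k \<phi> (x, \<tau>)) has_vector_derivative dt (Suc k) \<phi> (x, t)) (at t)" if x: "x \<in> closure \<Omega>"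
    unfolding eq[OF x T(2)]
    using eq[OF x] by (intro has_vector_derivative_transform_within_open[OF derG[OF x T(2)] T]) simp
  have "continuous_on (closure \<Omega>) (\<lambda>x. G k (x, t))"
    using UF(1) e(1)
    by (intro continuous_on_compose2[OF smooth_on_continuous[OF smG]] continuous_intros) auto
  then show "continuous_on (closure \<Omega>) (\<lambda>x. dt k \<phi> (x, t))"
    using eq[OF _ T(2)] by (simp cong: continuous_on_cong)
qed

section \<open>The Bergman kernel\<close>

context
  fixes \<Omega> :: "(complex ^ 'n) set"
  assumes open_\<Omega>: "open \<Omega>"
begin

lemma bergman_space_eq_A2:
  assumes W: "bounded_weight \<Omega> M (\<lambda>z. exp (- \<psi> z))" and m: "\<And>z. z \<in> \<Omega> \<Longrightarrow> exp (- \<psi> z) \<ge> m" "m > 0"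
  shows "bergman_space \<Omega> \<psi> = A2 \<Omega>"
proof -
  have "set_integrable lborel \<Omega> (\<lambda>z. (cmod (f z))\<^sup>2 * exp (- \<psi> z)) \<longleftrightarrow> set_integrable lborel \<Omega> (\<lambda>z. (cmod (f z))\<^sup>2)"
    if f: "holomorphic_several_on \<Omega> f" for f
  proof
    have cf: "continuous_on \<Omega> f" by (rule holomorphic_several_continuous[OF f])
    assume int: "set_integrable lborel \<Omega> (\<lambda>z. (cmod (f z))\<^sup>2 * exp (- \<psi> z))"
    show "set_integrable lborel \<Omega> (\<lambda>z. (cmod (f z))\<^sup>2)"
    proof (rule set_integrable_bound)
      show "set_integrable lborel \<Omega> (\<lambda>z. 1 / m * ((cmod (f z))\<^sup>2 * exp (- \<psi> z)))"
        using int by (rule set_integrable_mult_right)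
      show "set_borel_measurable lborel \<Omega> (\<lambda>z. (cmod (f z))\<^sup>2)"
        by (intro set_borel_measurable_continuous_on_open open_\<Omega> continuous_intros cf)
      have "(cmod (f z))\<^sup>2 \<le> 1 / m * ((cmod (f z))\<^sup>2 * exp (- \<psi> z))" if "z \<in> \<Omega>" for z
        using mult_left_mono[OF m(1)[OF that], of "(cmod (f z))\<^sup>2"] m(2) by (simp add: field_simps)
      then show "AE z in lborel. z \<in> \<Omega> \<longrightarrow> norm ((cmod (f z))\<^sup>2) \<le> norm (1 / m * ((cmod (f z))\<^sup>2 * exp (- \<psi> z)))"
        using m(2) by (auto simp: abs_mult)
    qed
  next
    have cf: "continuous_on \<Omega> f" by (rule holomorphic_several_continuous[OF f])
    assume int: "set_integrable lborel \<Omega> (\<lambda>z. (cmod (f z))\<^sup>2)"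
    show "set_integrable lborel \<Omega> (\<lambda>z. (cmod (f z))\<^sup>2 * exp (- \<psi> z))"
    proof (rule set_integrable_bound)
      show "set_integrable lborel \<Omega> (\<lambda>z. M * (cmod (f z))\<^sup>2)"
        using int by (rule set_integrable_mult_right)
      show "set_borel_measurable lborel \<Omega> (\<lambda>z. (cmod (f z))\<^sup>2 * exp (- \<psi> z))"
        using W
        by (intro set_borel_measurable_continuous_on_open open_\<Omega> continuous_on_mult continuous_on_power continuous_on_norm cf)
           (simp add: bounded_weight_def)
      have "(cmod (f z))\<^sup>2 * exp (- \<psi> z) \<le> M * (cmod (f z))\<^sup>2" "0 \<le> M" if "z \<in> \<Omega>" for z
      proof -
        have le: "exp (- \<psi> z) \<le> M" using W that by (simp add: bounded_weight_def)
        show "(cmod (f z))\<^sup>2 * exp (- \<psi> z) \<le> M * (cmod (f z))\<^sup>2"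
          using mult_left_mono[OF le, of "(cmod (f z))\<^sup>2"] by (simp add: mult.commute)
        show "0 \<le> M" using le exp_ge_zero[of "- \<psi> z"] by linarith
      qed
      then show "AE z in lborel. z \<in> \<Omega> \<longrightarrow> norm ((cmod (f z))\<^sup>2 * exp (- \<psi> z)) \<le> norm (M * (cmod (f z))\<^sup>2)"
        by (auto simp: abs_mult)
    qed
  qed
  then show ?thesis by (auto simp: bergman_space_def A2_def)
qed

text \<open>Point evaluations are bounded, so the Riesz representation theorem provides a reproducing kernel, and
  the choice operator in the definition picks one.\<close>

lemma bergman_kernel_reproducing:
  assumes W: "bounded_weight \<Omega> M (\<lambda>z. exp (- \<psi> z))" and m: "\<And>z. z \<in> \<Omega> \<Longrightarrow> exp (- \<psi> z) \<ge> m" "m > 0"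
    and w: "w \<in> \<Omega>"
  shows "(\<lambda>z. bergman_kernel \<Omega> \<psi> z w) \<in> A2 \<Omega>"
    and "f \<in> A2 \<Omega> \<Longrightarrow> f w = weighted_inner \<Omega> (\<lambda>z. exp (- \<psi> z)) f (\<lambda>z. bergman_kernel \<Omega> \<psi> z w)"
proof -
  have eq: "bergman_space \<Omega> \<psi> = A2 \<Omega>" by (rule bergman_space_eq_A2[OF W m])
  have "\<exists>g\<in>A2 \<Omega>. \<forall>f\<in>A2 \<Omega>. f w = weighted_inner \<Omega> (\<lambda>z. exp (- \<psi> z)) f g" if w: "w \<in> \<Omega>" for w
  proof -
    obtain C where "\<forall>f\<in>A2 \<Omega>. norm (f w) \<le> C * l2norm \<Omega> f"
      using A2_point_evaluation_bound[OF open_\<Omega>, of "{w}"] w by auto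
    then show ?thesis
      by (intro weighted_riesz_representation[OF open_\<Omega> W m, of "\<lambda>f. f w" C]) auto
  qed
  then obtain K where K: "\<And>w. w \<in> \<Omega> \<Longrightarrow> K w \<in> A2 \<Omega> \<and> (\<forall>f\<in>A2 \<Omega>. f w = weighted_inner \<Omega> (\<lambda>z. exp (- \<psi> z)) f (K w))"
    by metis
  then have "is_reproducing_kernel \<Omega> \<psi> (\<lambda>z w. K w z)"
    unfolding is_reproducing_kernel_def eq by (simp add: weighted_inner_def)
  then have "is_reproducing_kernel \<Omega> \<psi> (bergman_kernel \<Omega> \<psi>)"
    unfolding bergman_kernel_def by (rule someI[of "is_reproducing_kernel \<Omega> \<psi>"])
  then show "(\<lambda>z. bergman_kernel \<Omega> \<psi> z w) \<in> A2 \<Omega>"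
    and "f \<in> A2 \<Omega> \<Longrightarrow> f w = weighted_inner \<Omega> (\<lambda>z. exp (- \<psi> z)) f (\<lambda>z. bergman_kernel \<Omega> \<psi> z w)"
    using w unfolding is_reproducing_kernel_def eq by (simp_all add: weighted_inner_def)
qed

end

lemma has_vector_derivative_unique_on_open:
  fixes f :: "real \<Rightarrow> 'a::real_normed_vector"
  assumes "open T" "t \<in> T" "\<And>\<tau>. \<tau> \<in> T \<Longrightarrow> f \<tau> = g \<tau>"
    and "(f has_vector_derivative a) (at t)" "(g has_vector_derivative b) (at t)"
  shows "a = b"
proof -
  have "(g has_vector_derivative a) (at t)"
    using assms by (intro has_vector_derivative_transform_within_open[OF assms(4,1,2)]) simp
  then show ?thesis using assms(5) by (rule vector_derivative_unique_at)
qed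

section \<open>Gevrey regularity of the Bergman kernel\<close>

theorem theorem1p2:
  fixes \<Omega> :: "(complex ^ 'n) set"
    and D :: "real set"
    and \<phi> :: "(complex ^ 'n) \<times> real \<Rightarrow> real"
    and s :: real
  assumes "open \<Omega>" and "connected \<Omega>" and "\<Omega> \<noteq> {}" and "bounded \<Omega>"
    and "open D"
    and "s \<ge> 1"
    and "smooth_on_closure_times \<Omega> D \<phi>"
    and "gevrey_on_closure_times s \<Omega> D \<phi>"
  shows "gevrey_on_times s (\<Omega> \<times> \<Omega>) D
           (\<lambda>((z, w), t). bergman_kernel \<Omega> (\<lambda>\<zeta>. \<phi> (\<zeta>, t)) z w)"
proof -
  note open_\<Omega> = \<open>open \<Omega>\<close> and open_D = \<open>open D\<close>
  define E where "E k t z = exp_neg_derivs (\<lambda>j. dt j \<phi> (z, t)) k" for k t z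
  have E0: "E 0 t = (\<lambda>z. exp (- \<phi> (z, t)))" for t
    by (simp add: E_def dt_0 fun_eq_iff)
  have E_der: "((\<lambda>\<tau>. E k \<tau> z) has_real_derivative E (Suc k) t z) (at t)" if "t \<in> D" "z \<in> \<Omega>" for k t z
    unfolding E_def
    using smooth_on_closure_times_parameter_derivatives(1)[OF assms(7) open_D that(1)] that(2) closure_subset
    by (intro exp_neg_derivs_has_derivative) (auto simp: has_real_derivative_iff_has_vector_derivative)
  have E_cont: "continuous_on \<Omega> (E k t)" if "t \<in> D" for k t
    unfolding E_def
    using smooth_on_closure_times_parameter_derivatives(2)[OF assms(7) open_D that] closure_subset
    by (intro exp_neg_derivs_continuous) (auto intro: continuous_on_subset)
  have weights: "\<exists>A L m. A \<ge> 0 \<and> L > 0 \<and> m > 0 \<and> (\<forall>t\<in>J. (\<forall>k. bounded_weight \<Omega> (A * L ^ k * fact k powr s) (E k t))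
      \<and> (\<forall>z\<in>\<Omega>. E 0 t z \<ge> m))" if J: "compact J" "J \<subseteq> D" for J
  proof -
    obtain C R where CR: "C > 0" "R > 0" "\<And>\<mu> p. p \<in> closure \<Omega> \<times> J \<Longrightarrow> norm (dt \<mu> \<phi> p) \<le> C * R ^ \<mu> * fact \<mu> powr s"
    proof -
      have "gevrey_bound_on s (closure \<Omega> \<times> J) \<phi>"
        using assms(8) J by (simp add: gevrey_on_closure_times_def)
      then show ?thesis using that unfolding gevrey_bound_on_def by blast
    qed
    have bd: "\<bar>dt \<mu> \<phi> (z, t)\<bar> \<le> C * R ^ \<mu> * fact \<mu> powr s" if "t \<in> J" "z \<in> \<Omega>" for \<mu> t z
      using CR(3)[of "(z, t)" \<mu>] that closure_subset by auto
    have "bounded_weight \<Omega> (exp C * (R * (1 + C)) ^ k * fact k powr s) (E k t)" if "t \<in> J" for k t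
      unfolding bounded_weight_def
    proof (intro conjI ballI)
      show "continuous_on \<Omega> (E k t)" using E_cont that J by blast
      show "\<bar>E k t z\<bar> \<le> exp C * (R * (1 + C)) ^ k * fact k powr s" if "z \<in> \<Omega>" for z
        unfolding E_def using CR(1,2) assms(6) bd[OF \<open>t \<in> J\<close> that] by (intro exp_neg_derivs_gevrey) auto
    qed
    moreover have "E 0 t z \<ge> exp (- C)" if "t \<in> J" "z \<in> \<Omega>" for t z
      using bd[OF that, of 0] by (simp add: E0 dt_0)
    ultimately show ?thesis
      using CR(1,2) by (intro exI[of _ "exp C"] exI[of _ "R * (1 + C)"] exI[of _ "exp (- C)"]) (auto simp: add_pos_pos)
  qed
  have weight_at: "\<exists>A L m. A \<ge> 0 \<and> L > 0 \<and> m > 0 \<and> (\<forall>k. bounded_weight \<Omega> (A * L ^ k * fact k powr s) (E k t))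
      \<and> (\<forall>z\<in>\<Omega>. E 0 t z \<ge> m)" if "t \<in> D" for t
    using weights[of "{t}"] that by simp
  have exp_weight: "\<exists>M m. m > 0 \<and> bounded_weight \<Omega> M (\<lambda>z. exp (- \<phi> (z, t))) \<and> (\<forall>z\<in>\<Omega>. exp (- \<phi> (z, t)) \<ge> m)"
    if t: "t \<in> D" for t
  proof -
    obtain A L m where Am: "m > 0" "\<forall>k. bounded_weight \<Omega> (A * L ^ k * fact k powr s) (E k t)" "\<forall>z\<in>\<Omega>. E 0 t z \<ge> m"
      using weight_at[OF t] by blast
    show ?thesis
      using Am(1) spec[OF Am(2), of 0, unfolded E0] Am(3)[unfolded E0] by blast
  qed
  define K where "K t z w = bergman_kernel \<Omega> (\<lambda>\<zeta>. \<phi> (\<zeta>, t)) z w" for t z w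
  have K_A2: "(\<lambda>z. K t z w) \<in> A2 \<Omega>"
    and K_rep: "f \<in> A2 \<Omega> \<Longrightarrow> f w = weighted_inner \<Omega> (E 0 t) f (\<lambda>z. K t z w)"
    if t: "t \<in> D" and w: "w \<in> \<Omega>" for t w f
  proof -
    obtain M m where Mm: "m > 0" "bounded_weight \<Omega> M (\<lambda>z. exp (- \<phi> (z, t)))" "\<forall>z\<in>\<Omega>. exp (- \<phi> (z, t)) \<ge> m"
      using exp_weight[OF t] by blast
    show "(\<lambda>z. K t z w) \<in> A2 \<Omega>"
      unfolding K_def by (rule bergman_kernel_reproducing(1)[OF open_\<Omega> Mm(2) _ Mm(1) w]) (use Mm(3) in blast)
    show "f w = weighted_inner \<Omega> (E 0 t) f (\<lambda>z. K t z w)" if "f \<in> A2 \<Omega>"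
      unfolding K_def E0
      by (rule bergman_kernel_reproducing(2)[OF open_\<Omega> Mm(2) _ Mm(1) w that]) (use Mm(3) in blast)
  qed
  have K_herm: "K t z w = cnj (K t w z)" if t: "t \<in> D" and z: "z \<in> \<Omega>" and w: "w \<in> \<Omega>" for t z w
    using K_rep[OF t z K_A2[OF t w]] K_rep[OF t w K_A2[OF t z]] weighted_inner_cnj[OF open_\<Omega>] by metis
  \<comment> \<open>The candidates for the derivatives of \<open>K t \<cdot> w\<close> in \<open>t\<close>.\<close>
  define P where "P w t v \<longleftrightarrow> v 0 = (\<lambda>z. K t z w) \<and> (\<forall>\<mu>. v \<mu> \<in> A2 \<Omega>) \<and>
      (\<forall>\<mu>>0. \<forall>f\<in>A2 \<Omega>. moment_sum \<Omega> (\<lambda>k. E k t) v \<mu> f = 0)" for w t v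
  define u where "u w t = (SOME v. P w t v)" for w t
  have P: "P w t (u w t)" if t: "t \<in> D" and w: "w \<in> \<Omega>" for t w
  proof -
    obtain A L m where A: "A \<ge> 0" "L > 0" "m > 0" "\<And>k. bounded_weight \<Omega> (A * L ^ k * fact k powr s) (E k t)" "\<And>z. z \<in> \<Omega> \<Longrightarrow> E 0 t z \<ge> m"
      using weight_at[OF t] by blast
    have "\<exists>v. P w t v"
      unfolding P_def
    proof (rule moment_solution_exists[where \<beta> = "\<lambda>k. A * L ^ k * fact k powr s" and E = "\<lambda>k. E k t", OF open_\<Omega> A(4) _ A(5,3) K_A2[OF t w]])
      show "0 \<le> A * L ^ k * fact k powr s" for k using A(1,2) by simp
    qed
    then show ?thesis unfolding u_def by (rule someI_ex)
  qed
  have u0: "u w t 0 = (\<lambda>z. K t z w)" and uA: "u w t \<mu> \<in> A2 \<Omega>" if "t \<in> D" "w \<in> \<Omega>" for t w \<mu>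
    using P[OF that] unfolding P_def by blast+
  have umom: "moment_sum \<Omega> (\<lambda>k. E k t) (u w t) \<mu> f = 0"
    if "t \<in> D" "w \<in> \<Omega>" "\<mu> > 0" "f \<in> A2 \<Omega>" for t w \<mu> f
    using P[OF that(1,2)] that(3,4) unfolding P_def by blast
  have umom0: "moment_sum \<Omega> (\<lambda>k. E k t) (u w t) 0 f = f w" if "t \<in> D" "w \<in> \<Omega>" "f \<in> A2 \<Omega>" for t w f
    using K_rep[OF that] u0[OF that(1,2)] by (simp add: moment_sum_def[OF open_\<Omega>])
  define G where "G \<mu> = (\<lambda>((z, w), t). u w t \<mu> z)" for \<mu> :: nat
  have taylor: "\<exists>\<delta>>0. \<exists>C. \<forall>h. \<bar>h\<bar> < \<delta> \<longrightarrow>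
      norm (G \<mu> ((z, w), t + h) - G \<mu> ((z, w), t) - h *\<^sub>R G (Suc \<mu>) ((z, w), t)) \<le> C * h\<^sup>2"
    if z: "z \<in> \<Omega>" and w: "w \<in> \<Omega>" and t: "t \<in> D" for \<mu> z w t
  proof -
    obtain e where e: "e > 0" "cball t e \<subseteq> D" using open_D t open_contains_cball by blast
    \<comment> \<open>The expansion in \<open>moment_solution_quadratic_remainder\<close> needs a radius of at most 1.\<close>
    define \<delta> where "\<delta> = min e 1"
    define J where "J = {t-\<delta>..t+\<delta>}"
    have \<delta>: "\<delta> > 0" "\<delta> \<le> 1" using e by (auto simp: \<delta>_def)
    have "J \<subseteq> cball t e" by (auto simp: J_def \<delta>_def cball_eq_atLeastAtMost)
    then have J: "compact J" "J \<subseteq> D" using e(2) by (auto simp: J_def)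
    obtain A L m where A: "A \<ge> 0" "L > 0" "m > 0"
      "\<And>\<tau> k. \<tau> \<in> J \<Longrightarrow> bounded_weight \<Omega> (A * L ^ k * fact k powr s) (E k \<tau>)"
      "\<And>\<tau> z. \<tau> \<in> J \<Longrightarrow> z \<in> \<Omega> \<Longrightarrow> E 0 \<tau> z \<ge> m"
      using weights[OF J] by blast
    have "\<exists>C. \<forall>\<tau>\<in>J. l2norm \<Omega> (\<lambda>z. u w \<tau> \<mu> z - u w t \<mu> z - of_real (\<tau> - t) * u w t (Suc \<mu>) z) \<le> C * (\<tau> - t)\<^sup>2"
    proof (rule moment_solution_quadratic_remainder[where \<beta> = "\<lambda>k. A * L ^ k * fact k powr s" and E = E and m = m, OF open_\<Omega> J_def \<delta> A(4) _ A(5,3), where u = "\<lambda>\<mu> t. u w t \<mu>" and l = "\<lambda>f. f w"])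
      show "0 \<le> A * L ^ k * fact k powr s" for k using A by simp
    qed (use J E_der uA umom umom0 w in auto)
    then obtain C where C: "\<And>\<tau>. \<tau> \<in> J \<Longrightarrow>
        l2norm \<Omega> (\<lambda>z. u w \<tau> \<mu> z - u w t \<mu> z - of_real (\<tau> - t) * u w t (Suc \<mu>) z) \<le> C * (\<tau> - t)\<^sup>2" by blast
    obtain B where B: "B > 0" "\<And>f. f \<in> A2 \<Omega> \<Longrightarrow> norm (f z) \<le> B * l2norm \<Omega> f"
      using A2_point_evaluation_bound[OF open_\<Omega>, of "{z}"] z by auto
    have "norm (G \<mu> ((z, w), t + h) - G \<mu> ((z, w), t) - h *\<^sub>R G (Suc \<mu>) ((z, w), t)) \<le> (B * C) * h\<^sup>2"
      if h: "\<bar>h\<bar> < \<delta>" for h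
    proof -
      have th: "t + h \<in> J" using h by (auto simp: J_def)
      have "(\<lambda>z. u w (t + h) \<mu> z - u w t \<mu> z - of_real (t + h - t) * u w t (Suc \<mu>) z) \<in> A2 \<Omega>"
        using th J t w by (intro A2_diff[OF open_\<Omega>] A2_scale[OF open_\<Omega>] uA) auto
      from B(2)[OF this]
      have "norm (u w (t + h) \<mu> z - u w t \<mu> z - of_real (t + h - t) * u w t (Suc \<mu>) z)
          \<le> B * (C * (t + h - t)\<^sup>2)"
        by (rule order_trans) (use B(1) C[OF th] in \<open>intro mult_left_mono, auto\<close>)
      then show ?thesis by (simp add: G_def scaleR_conv_of_real mult.assoc)
    qed
    then show ?thesis using \<delta>(1) by blast
  qed
  have G_der: "((\<lambda>\<tau>. G \<mu> ((z, w), \<tau>)) has_vector_derivative G (Suc \<mu>) ((z, w), t)) (at t)"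
    if mem: "z \<in> \<Omega>" "w \<in> \<Omega>" "t \<in> D" for \<mu> z w t
  proof -
    obtain \<delta> C where \<delta>: "\<delta> > 0" and C: "\<forall>h. \<bar>h\<bar> < \<delta> \<longrightarrow>
        norm (G \<mu> ((z, w), t + h) - G \<mu> ((z, w), t) - h *\<^sub>R G (Suc \<mu>) ((z, w), t)) \<le> C * h\<^sup>2"
      using taylor[OF mem, of \<mu>] by blast
    show ?thesis
      by (rule has_vector_derivative_if_quadratic_remainder[OF \<delta>, where C = C]) (use C in blast)
  qed
  \<comment> \<open>Symmetry of the kernel passes to its derivatives in \<open>t\<close>; it yields antiholomorphy in \<open>w\<close>.\<close>
  have G_herm: "G \<mu> ((z, w), t) = cnj (G \<mu> ((w, z), t))" if "z \<in> \<Omega>" "w \<in> \<Omega>" "t \<in> D" for \<mu> z w t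
    using that(3)
  proof (induction \<mu> arbitrary: t)
    case 0
    then show ?case using that u0 K_herm[of t z w] by (simp add: G_def)
  next
    case (Suc \<mu>)
    show ?case
      by (rule has_vector_derivative_unique_on_open[OF open_D Suc.prems, where f = "\<lambda>\<tau>. G \<mu> ((z, w), \<tau>)"
            and g = "\<lambda>\<tau>. cnj (G \<mu> ((w, z), \<tau>))"])
         (use Suc.IH Suc.prems that G_der in \<open>auto intro: has_vector_derivative_cnj\<close>)
  qed
  have G_bound: "\<exists>C>0. \<exists>R>0. \<forall>\<mu>. \<forall>p\<in>X. norm (G \<mu> p) \<le> C * R ^ \<mu> * fact \<mu> powr s"
    if X: "compact X" "X \<subseteq> (\<Omega> \<times> \<Omega>) \<times> D" for X
  proof -
    define Xz where "Xz = (\<lambda>p. fst (fst p)) ` X"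
    define Xw where "Xw = (\<lambda>p. snd (fst p)) ` X"
    define J where "J = snd ` X"
    have cp: "compact Xz" "compact Xw" "compact J"
      unfolding Xz_def Xw_def J_def using X(1) by (intro compact_continuous_image continuous_intros; simp)+
    have sb: "Xz \<subseteq> \<Omega>" "Xw \<subseteq> \<Omega>" "J \<subseteq> D" using X(2) by (auto simp: Xz_def Xw_def J_def)
    obtain Cz where Cz: "Cz > 0" "\<And>z f. z \<in> Xz \<Longrightarrow> f \<in> A2 \<Omega> \<Longrightarrow> norm (f z) \<le> Cz * l2norm \<Omega> f"
      using A2_point_evaluation_bound[OF open_\<Omega> cp(1) sb(1)] by blast
    obtain Cw where Cw: "Cw > 0" "\<And>w f. w \<in> Xw \<Longrightarrow> f \<in> A2 \<Omega> \<Longrightarrow> norm (f w) \<le> Cw * l2norm \<Omega> f"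
      using A2_point_evaluation_bound[OF open_\<Omega> cp(2) sb(2)] by blast
    obtain A L m where A: "A \<ge> 0" "L > 0" "m > 0"
      "\<And>\<tau> k. \<tau> \<in> J \<Longrightarrow> bounded_weight \<Omega> (A * L ^ k * fact k powr s) (E k \<tau>)"
      "\<And>\<tau> z. \<tau> \<in> J \<Longrightarrow> z \<in> \<Omega> \<Longrightarrow> E 0 \<tau> z \<ge> m"
      using weights[OF cp(3) sb(3)] by blast
    define R where "R = L * (1 + A / m)"
    have "norm (G \<mu> p) \<le> (Cz * (Cw / m)) * R ^ \<mu> * fact \<mu> powr s" if p: "p \<in> X" for \<mu> p
    proof -
      obtain z w t where pe: "p = ((z, w), t)" by (metis prod.exhaust)
      have mem: "z \<in> Xz" "w \<in> Xw" "t \<in> J" using p unfolding pe Xz_def Xw_def J_def by force+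
      then have mem': "w \<in> \<Omega>" "t \<in> D" using sb by auto
      have "l2norm \<Omega> (u w t \<mu>) \<le> Cw / m * (L * (1 + A / m)) ^ \<mu> * fact \<mu> powr s"
      proof (rule moment_solution_gevrey_bound[where A = A and L = L and s = s and E = "\<lambda>k. E k t" and m = m, OF open_\<Omega> A(4)[OF mem(3)] A(5)[OF mem(3)] A(3,1,2) assms(6) uA[OF mem'(2,1)]])
        show "norm (moment_sum \<Omega> (\<lambda>k. E k t) (u w t) 0 (u w t 0)) \<le> Cw * l2norm \<Omega> (u w t 0)"
          unfolding umom0[OF mem'(2,1) uA[OF mem'(2,1)]] by (rule Cw(2)[OF mem(2) uA[OF mem'(2,1)]])
      qed (use Cw umom mem' in auto)
      then have "Cz * l2norm \<Omega> (u w t \<mu>) \<le> Cz * (Cw / m * R ^ \<mu> * fact \<mu> powr s)"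
        unfolding R_def using Cz(1) by (intro mult_left_mono) auto
      then show ?thesis
        using Cz(2)[OF mem(1) uA[OF mem'(2,1)], of \<mu>] by (simp add: G_def pe mult.assoc)
    qed
    moreover have "R > 0" using A by (simp add: R_def add_pos_nonneg)
    moreover have "Cz * (Cw / m) > 0" using Cz Cw A by simp
    ultimately show ?thesis by blast
  qed
  define S where "S = (\<Omega> \<times> \<Omega>) \<times> D"
  have open_S: "open S" unfolding S_def by (intro open_Times open_\<Omega> open_D)
  \<comment> \<open>Complex lines in the variable \<open>z\<close> and conjugate lines in the variable \<open>w\<close>.\<close>
  define dz where "dz a l = ((l *s a, 0 :: complex ^ 'n), 0 :: real)" for a :: "complex ^ 'n" and l
  define dw where "dw a l = ((0 :: complex ^ 'n, cnj l *s a), 0 :: real)" for a :: "complex ^ 'n" and l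
  have lin_dz: "bounded_linear (dz a)" for a
    unfolding dz_def by (intro bounded_linear_Pair bounded_linear_smult_left bounded_linear_zero)
  have lin_dw: "bounded_linear (dw a)" for a
    unfolding dw_def
    by (intro bounded_linear_Pair bounded_linear_compose[OF bounded_linear_smult_left bounded_linear_cnj] bounded_linear_zero)
  have "line_holomorphic_family S (range dz \<union> range dw) ((0, 0), 1) G"
    unfolding line_holomorphic_family_def
  proof (intro conjI allI ballI)
    fix \<mu> p assume p: "p \<in> S"
    then obtain r where r: "r > 0" "cball p r \<subseteq> S" using open_S open_contains_cball by blast
    then obtain C R where "\<forall>\<mu>. \<forall>q\<in>cball p r. norm (G \<mu> q) \<le> C * R ^ \<mu> * fact \<mu> powr s"
      using G_bound[of "cball p r"] unfolding S_def by auto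
    then show "\<exists>M. \<forall>\<^sub>F q in nhds p. norm (G \<mu> q) \<le> M"
      unfolding eventually_nhds_metric
      by (intro exI[of _ "C * R ^ \<mu> * fact \<mu> powr s"] exI[of _ r]) (use r(1) in \<open>auto simp: dist_commute\<close>)
  next
    fix \<mu> p d assume p: "p \<in> S" and d: "d \<in> range dz \<union> range dw"
    obtain z w t where pe: "p = ((z, w), t)" by (metis prod.exhaust)
    have mem: "z \<in> \<Omega>" "w \<in> \<Omega>" "t \<in> D" using p by (auto simp: pe S_def)
    from d consider a where "d = dz a" | a where "d = dw a" by auto
    then show "(\<lambda>l. G \<mu> (p + d l)) field_differentiable at 0"
    proof cases
      case (1 a)
      show ?thesis
        using holomorphic_several_line[OF A2_holomorphic[OF open_\<Omega> uA[OF mem(3,2)]] mem(1)]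
        by (simp add: 1 dz_def pe G_def)
    next
      case (2 a)
      define h where "h l = u z t \<mu> (w + l *s a)" for l
      have "h field_differentiable at (cnj 0)"
        unfolding h_def using holomorphic_several_line[OF A2_holomorphic[OF open_\<Omega> uA[OF mem(3,1)]] mem(2)] by simp
      then have "(cnj \<circ> h \<circ> cnj) field_differentiable at 0"
        by (rule field_differentiable_cnj_cnj)
      then obtain h' where h': "((cnj \<circ> h \<circ> cnj) has_field_derivative h') (at 0)"
        by (auto simp: field_differentiable_def)
      define N where "N = (\<lambda>l. w + cnj l *s a) -` \<Omega>"
      have N: "open N"
        unfolding N_def
      proof (rule open_vimage[OF open_\<Omega>])
        show "continuous_on UNIV (\<lambda>l. w + cnj l *s a)"
          by (intro continuous_intros linear_continuous_on
              bounded_linear_compose[OF bounded_linear_smult_left bounded_linear_cnj])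
      qed
      have N0: "0 \<in> N" using mem by (simp add: N_def)
      have "(cnj \<circ> h \<circ> cnj) l = G \<mu> (p + d l)" if "l \<in> N" for l
        using that mem G_herm[of z "w + cnj l *s a" t \<mu>] by (simp add: N_def 2 dw_def pe h_def G_def)
      then have "((\<lambda>l. G \<mu> (p + d l)) has_field_derivative h') (at 0)"
        by (rule has_field_derivative_transform_within_open[OF h' N N0])
      then show ?thesis by (auto simp: field_differentiable_def)
    qed
  next
    fix \<mu> p assume p: "p \<in> S"
    obtain z w t where pe: "p = ((z, w), t)" by (metis prod.exhaust)
    have mem: "z \<in> \<Omega>" "w \<in> \<Omega>" "t \<in> D" using p by (auto simp: pe S_def)
    obtain \<delta> C where \<delta>: "\<delta> > 0" and C: "\<forall>h. \<bar>h\<bar> < \<delta> \<longrightarrow>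
        norm (G \<mu> ((z, w), t + h) - G \<mu> ((z, w), t) - h *\<^sub>R G (Suc \<mu>) ((z, w), t)) \<le> C * h\<^sup>2"
      using taylor[OF mem, of \<mu>] by blast
    show "((\<lambda>\<tau>. G \<mu> (p + \<tau> *\<^sub>R ((0, 0), 1))) has_vector_derivative G (Suc \<mu>) p) (at 0)"
      by (rule has_vector_derivative_if_quadratic_remainder[OF \<delta>, where C = C]) (use C in \<open>simp add: pe\<close>)
  qed
  then have "smooth_on S (G 0)"
  proof (rule smooth_on_line_holomorphic_family[OF open_S, rotated])
    show "bounded_linear d" if "d \<in> range dz \<union> range dw" for d
      using that lin_dz lin_dw by auto
    show "Basis \<subseteq> insert ((0, 0), 1) ((\<lambda>d. d 1) ` (range dz \<union> range dw))"
    proof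
      fix b :: "((complex ^ 'n) \<times> (complex ^ 'n)) \<times> real" assume "b \<in> Basis"
      then consider a where "b = ((a, 0), 0)" | a where "b = ((0, a), 0)" | "b = ((0, 0), 1)"
        by (auto simp: Basis_prod_def zero_prod_def)
      then show "b \<in> insert ((0, 0), 1) ((\<lambda>d. d 1) ` (range dz \<union> range dw))"
      proof cases
        case (1 a)
        then have "b = dz a 1" by (simp add: dz_def)
        then show ?thesis by blast
      next
        case (2 a)
        then have "b = dw a 1" by (simp add: dw_def)
        then show ?thesis by blast
      qed simp
    qed
  qed
  have G0: "G 0 p = (\<lambda>((z, w), t). bergman_kernel \<Omega> (\<lambda>\<zeta>. \<phi> (\<zeta>, t)) z w) p" if "p \<in> S" for p
    using that u0 by (auto simp: G_def K_def S_def)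
  show ?thesis
    unfolding gevrey_on_times_def
  proof (intro conjI allI impI)
    show "smooth_on ((\<Omega> \<times> \<Omega>) \<times> D) (\<lambda>((z, w), t). bergman_kernel \<Omega> (\<lambda>\<zeta>. \<phi> (\<zeta>, t)) z w)"
      unfolding smooth_on_def S_def[symmetric]
    proof
      fix k
      show "Ck_on k S (\<lambda>((z, w), t). bergman_kernel \<Omega> (\<lambda>\<zeta>. \<phi> (\<zeta>, t)) z w)"
        by (rule Ck_on_cong[OF open_S _ G0]) (use \<open>smooth_on S (G 0)\<close> in \<open>auto simp: smooth_on_def\<close>)
    qed
    fix X assume X: "compact X \<and> X \<subseteq> (\<Omega> \<times> \<Omega>) \<times> D"
    have "dt \<mu> (\<lambda>((z, w), t). bergman_kernel \<Omega> (\<lambda>\<zeta>. \<phi> (\<zeta>, t)) z w) p = G \<mu> p" if "p \<in> X" for \<mu> p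
    proof -
      obtain z w t where pe: "p = ((z, w), t)" by (metis prod.exhaust)
      have mem: "z \<in> \<Omega>" "w \<in> \<Omega>" "t \<in> D" using X that by (auto simp: pe)
      show ?thesis
        unfolding pe
      proof (rule dt_eq_if_derivative_sequence[where g = "\<lambda>\<mu> \<tau>. G \<mu> ((z, w), \<tau>)", OF open_D _ _ mem(3)])
        show "((\<lambda>\<tau>. G \<mu> ((z, w), \<tau>)) has_vector_derivative G (Suc \<mu>) ((z, w), \<tau>)) (at \<tau>)" if "\<tau> \<in> D" for \<mu> \<tau>
          using G_der mem that by blast
        show "(\<lambda>((z, w), t). bergman_kernel \<Omega> (\<lambda>\<zeta>. \<phi> (\<zeta>, t)) z w) ((z, w), \<tau>) = G 0 ((z, w), \<tau>)" if "\<tau> \<in> D" for \<tau>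
          by (rule G0[symmetric]) (use mem that in \<open>simp add: S_def\<close>)
      qed
    qed
    then show "gevrey_bound_on s X (\<lambda>((z, w), t). bergman_kernel \<Omega> (\<lambda>\<zeta>. \<phi> (\<zeta>, t)) z w)"
      using G_bound X unfolding gevrey_bound_on_def by simp
  qed
qed

end
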